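(* Let $n,m\in\mathbb{N}=\{0,1,2,\dots\}$, let $c_0,\dots,c_n$ be distinct non-zero complex constants, and let $A_{ij}(z)$ $(i=0,1,\ldots,n,\ j=0,1,\ldots,m)$ and $F(z)$ be meromorphic functions in $\mathbb{C}$. Consider the delay-differential equations \[ \sum_{i=0}^{n}\sum_{j=0}^{m}A_{ij}(z)f^{(j)}(z+c_{i})=F(z)\qquad (\ast) \] and \[ \sum_{i=0}^{n}\sum_{j=0}^{m}A_{ij}(z)f^{(j)}(z+c_{i})=0.\qquad (\ast\ast) \] Let $a,l\in\{0,1,\ldots,n\}$ and $b\in\{0,1,\ldots,m\}$ with $(a,b)\neq(l,0)$. Set $S:=\{F\}\cup\{A_{ij}\colon (i,j)\neq(a,b),(l,0)\}$ and $\rho_{\log}(S):=\max\{\rho_{\log}(g)\colon g\in S\}$. Suppose that $\lambda_{\log}\left(\frac{1}{A_{l0}}\right)+1<\mu_{\log}(A_{l0})<\infty$ and that: (i) $\max\{\mu_{\log}(A_{ab}),\rho_{\log}(S)\}\leq\mu_{\log}(A_{l0})<\infty$; (ii) $\underline{\tau}_{\log}(A_{l0})>\underline{\tau}_{\log}(A_{ab})$ whenever $\mu_{\log}(A_{l0})=\mu_{\log}(A_{ab})$; (iii) $\sum_{\rho_{\log}(A_{ij})=\mu_{\log}(A_{l0}),\,(i,j)\neq(l,0),(a,b)}\tau_{\log}(A_{ij})+\tau_{\log}(F)<\underline{\tau}_{\log}(A_{l0})<\infty$ whenever $\mu_{\log}(A_{l0})=\rho_{\log}(S)$; (iv) $\sum_{\rho_{\log}(A_{ij})=\mu_{\log}(A_{l0}),\,(i,j)\neq(l,0),(a,b)}\tau_{\log}(A_{ij})+\tau_{\log}(F)+\underline{\tau}_{\log}(A_{ab})<\underline{\tau}_{\log}(A_{l0})<\infty$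 whenever $\mu_{\log}(A_{l0})=\mu_{\log}(A_{ab})=\rho_{\log}(S)$. Then, if $F\not\equiv0$, every meromorphic solution $f$ of $(\ast)$ satisfies $\rho_{\log}(f)\geq\mu_{\log}(A_{l0})$. Further, if $F\equiv 0$, every meromorphic solution $f\not\equiv0$ of $(\ast\ast)$ satisfies $\rho_{\log}(f)\geq\mu_{\log}(A_{l0})+1$.
   Context: For a meromorphic function $f$, $T(r,f)$ is the Nevanlinna characteristic and $n(r,f)$ (resp. $N(r,f)$) the number (resp. integrated counting function) of poles in $|z|\le r$. The logarithmic order and logarithmic lower order are $\rho_{\log}(f)=\limsup_{r\to+\infty}\frac{\log T(r,f)}{\log\log r}$ and $\mu_{\log}(f)=\liminf_{r\to+\infty}\frac{\log T(r,f)}{\log\log r}$. The logarithmic type and logarithmic lower type are $\tau_{\log}(f)=\limsup_{r\to+\infty}\frac{T(r,f)}{(\log r)^{\rho_{\log}(f)}}$ and $\underline{\tau}_{\log}(f)=\liminf_{r\to+\infty}\frac{T(r,f)}{(\log r)^{\mu_{\log}(f)}}$. The logarithmic exponent of convergence of poles is $\lambda_{\log}\left(\frac1f\right)=\limsup_{r\to+\infty}\frac{\log n(r,f)}{\log\log r}=\limsup_{r\to+\infty}\frac{\log N(r,f)}{\log\log r}-1$. The sums in (iii) and (iv) range over those pairs $(i,j)\neq(l,0),(a,b)$ with $\rho_{\log}(A_{ij})=\mu_{\log}(A_{l0})$. *)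

theory Defs
  imports "HOL-Complex_Analysis.Complex_Analysis"
begin

text \<open>Nevanlinna theory notions for a meromorphic function f on the whole plane.
  Values of f at poles / removable singularities are irrelevant for all notions below.\<close>

definition nev_m :: "(complex \<Rightarrow> complex) \<Rightarrow> real \<Rightarrow> real" where
  "nev_m f r = integral {0..2*pi} (\<lambda>\<theta>. max 0 (ln (cmod (f (complex_of_real r * cis \<theta>))))) / (2*pi)"

definition nev_n :: "(complex \<Rightarrow> complex) \<Rightarrow> real \<Rightarrow> nat" where
  "nev_n f t = (\<Sum>z\<in>{z. cmod z \<le> t \<and> is_pole f z}. nat (- zorder f z))"

definition nev_N :: "(complex \<Rightarrow> complex) \<Rightarrow> real \<Rightarrow> real" where
  "nev_N f r = integral {0..r} (\<lambda>t. (real (nev_n f t) - real (nev_n f 0)) / t)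
              + real (nev_n f 0) * ln r"

definition nev_T :: "(complex \<Rightarrow> complex) \<Rightarrow> real \<Rightarrow> real" where
  "nev_T f r = nev_m f r + nev_N f r"

definition log_order :: "(complex \<Rightarrow> complex) \<Rightarrow> ereal" where
  "log_order f = Limsup at_top (\<lambda>r::real. ereal (ln (nev_T f r) / ln (ln r)))"

definition log_lower_order :: "(complex \<Rightarrow> complex) \<Rightarrow> ereal" where
  "log_lower_order f = Liminf at_top (\<lambda>r::real. ereal (ln (nev_T f r) / ln (ln r)))"

text \<open>Logarithmic type; only meaningful when the logarithmic order is finite
  (the value for infinite order is an arbitrary convention and never used).\<close>
definition log_type :: "(complex \<Rightarrow> complex) \<Rightarrow> ereal" where
  "log_type f = (case log_order f of
      ereal p \<Rightarrow> Limsup at_top (\<lambda>r::real. ereal (nev_T f r / (ln r) powr p))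
    | _ \<Rightarrow> \<infinity>)"

definition log_lower_type :: "(complex \<Rightarrow> complex) \<Rightarrow> ereal" where
  "log_lower_type f = (case log_lower_order f of
      ereal p \<Rightarrow> Liminf at_top (\<lambda>r::real. ereal (nev_T f r / (ln r) powr p))
    | _ \<Rightarrow> \<infinity>)"

definition log_exp_conv_poles :: "(complex \<Rightarrow> complex) \<Rightarrow> ereal" where
  "log_exp_conv_poles f = Limsup at_top (\<lambda>r::real. ereal (ln (real (nev_n f r)) / ln (ln r)))"

definition dde_solution ::
  "nat \<Rightarrow> nat \<Rightarrow> (nat \<Rightarrow> complex) \<Rightarrow> (nat \<Rightarrow> nat \<Rightarrow> complex \<Rightarrow> complex)
   \<Rightarrow> (complex \<Rightarrow> complex) \<Rightarrow> (complex \<Rightarrow> complex) \<Rightarrow> bool" where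
  "dde_solution n m c A G f \<longleftrightarrow> f meromorphic_on UNIV \<and>
     (\<forall>\<^sub>\<approx>z. (\<Sum>i\<le>n. \<Sum>j\<le>m. A i j z * (deriv ^^ j) f (z + c i)) = G z)"

end

theory Submission
  imports Defs "HOL-Real_Asymp.Real_Asymp"
begin

text \<open>Solve the equation for \<open>A\<^bsub>l0\<^esub>\<close>: it is a sum of products of the other coefficients with
  quotients \<open>f\<^bsup>(j)\<^esup>(z + c\<^sub>i) / f(z + c\<^sub>l)\<close>, plus \<open>F(z) / f(z + c\<^sub>l)\<close>. Its poles contribute little to
  \<open>T(r, A\<^bsub>l0\<^esub>)\<close>, so everything rests on the proximity functions of these quotients. If \<open>T(r, f) \<le> (log r)\<^sup>s\<close>, Jensen's
  formula bounds the number of zeros and poles of \<open>f\<close> in \<open>|z| \<le> r\<close> by a constant times \<open>(log r)\<^bsup>s-1\<^esup>\<close>. On a disc of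
  radius about \<open>r\<^sup>2\<close> one writes \<open>f = e\<^sup>H B\<close> with a finite product \<open>B\<close> of Blaschke factors; the Schwarz
  formula makes \<open>H'\<close> negligible on \<open>|z| \<le> 2r\<close>, and each zero or pole contributes a bounded amount to the circle means. Hence the
  quotients have proximity function \<open>O((log r)\<^bsup>s-1\<^esup>)\<close>, and \<open>1/f(z + c\<^sub>l)\<close> has \<open>O((log r)\<^sup>s)\<close>. Evaluating along radii that
  realise the lower order and lower type of \<open>A\<^bsub>ab\<^esub>\<close> contradicts the growth of \<open>A\<^bsub>l0\<^esub>\<close> if \<open>s\<close> is too small.\<close>

text \<open>The obstacle is that \<open>A a b\<close> is controlled only by its lower order and
  lower type, so it is small merely along some unknown sequence of radii. Every other estimate must
  therefore hold for all large \<open>r\<close>: a bound outside an exceptional set could miss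
  exactly these radii. This dictates the choice of radii. The radius \<open>r\<close> stays
  arbitrary, with zeros and poles allowed on the circle and on its shifts, and only the auxiliary
  radius between \<open>r ^ 2\<close> and \<open>r ^ 3\<close> is chosen so as to avoid them. Such a
  large auxiliary radius is affordable because it changes powers of \<open>ln r\<close> by constant
  factors only, and next to it the shifts \<open>c i\<close> are negligible. The additional 1 in the
  homogeneous case is the difference between the two proximity bounds. In a quotient of two values
  of \<open>f\<close> the large parts of the logarithms cancel and only the number of zeros and
  poles matters, which costs the exponent \<open>s - 1\<close>; an isolated \<open>1 / f\<close>
  costs \<open>s\<close>. If \<open>F\<close> vanishes, only quotients remain, so \<open>s\<close>
  may range up to \<open>\<mu> + 1\<close> before the contradiction is lost.\<close>

subsection \<open>Circle means\<close>

text \<open>The library has \<open>ln 0 = 0\<close> and \<open>ln (-x) = ln x\<close>, so \<open>logp\<close> is monotone only on nonnegative arguments.\<close>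
definition logp :: "real \<Rightarrow> real" where "logp x = max 0 (ln x)"

lemma logp_nonneg [simp]: "0 \<le> logp x" by (simp add: logp_def)

lemma ln_le_logp: "ln x \<le> logp x" by (simp add: logp_def)

lemma logp_mono: "0 \<le> x \<Longrightarrow> x \<le> y \<Longrightarrow> logp x \<le> logp y"
  by (cases "x = 0") (auto simp: logp_def max_def)

lemma logp_eq_0: "0 \<le> x \<Longrightarrow> x \<le> 1 \<Longrightarrow> logp x = 0"
  by (cases "x = 0") (auto simp: logp_def)

lemma logp_eq_ln: "1 \<le> x \<Longrightarrow> logp x = ln x"
  by (auto simp: logp_def)

lemma logp_mult:
  assumes "0 \<le> x" "0 \<le> y"
  shows "logp (x * y) \<le> logp x + logp y"
  using assms by (cases "x = 0 \<or> y = 0") (auto simp: logp_def ln_mult)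

text \<open>The sum is at most \<open>card A\<close> times its largest term, and \<open>logp\<close>
  of that term is one of the summands on the right. The empty sum fits because
  \<open>ln 0 = 0\<close>.\<close>

lemma logp_sum_le:
  assumes "finite A" "\<And>i. i \<in> A \<Longrightarrow> 0 \<le> x i"
  shows "logp (\<Sum>i\<in>A. x i) \<le> (\<Sum>i\<in>A. logp (x i)) + ln (real (card A))"
proof (cases "A = {}")
  case False
  define M where "M = Max (x ` A)"
  have le: "x i \<le> M" if "i \<in> A" for i using that assms by (simp add: M_def)
  have "M \<in> x ` A" unfolding M_def using assms False by (intro Max_in) auto
  then obtain k where k: "k \<in> A" "M = x k" by auto
  have M0: "0 \<le> M" using k assms by auto
  have c1: "1 \<le> real (card A)"
    using False assms(1) by (simp add: Suc_leI card_gt_0_iff)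
  have "logp (\<Sum>i\<in>A. x i) \<le> logp (real (card A) * M)"
    using assms le by (intro logp_mono sum_nonneg sum_bounded_above) auto
  also have "\<dots> \<le> logp (real (card A)) + logp M" using M0 by (intro logp_mult) auto
  also have "logp (real (card A)) = ln (real (card A))" by (rule logp_eq_ln[OF c1])
  also have "logp M \<le> (\<Sum>i\<in>A. logp (x i))"
    unfolding k(2) using k(1) assms(1) by (intro member_le_sum) auto
  finally show ?thesis by simp
qed (simp add: logp_def)

lemma abs_ln_eq: "\<bar>ln x\<bar> = logp x + logp (1 / x)"
  by (cases "x = 0") (auto simp: logp_def ln_div)

lemma ln_eq_logp_diff: "ln x = logp x - logp (1 / x)"
  by (cases "x = 0") (auto simp: logp_def ln_div)

definition circ_mean :: "real \<Rightarrow> (complex \<Rightarrow> real) \<Rightarrow> real" where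
  "circ_mean r u = integral {0..2*pi} (\<lambda>\<theta>. u (complex_of_real r * cis \<theta>)) / (2*pi)"

text \<open>Absolute integrability is demanded because gauge integrability alone is not inherited by
  absolute values and positive parts, which \<open>logp\<close> requires.\<close>

definition circ_int :: "real \<Rightarrow> (complex \<Rightarrow> real) \<Rightarrow> bool" where
  "circ_int r u \<longleftrightarrow> (\<lambda>\<theta>. u (complex_of_real r * cis \<theta>)) absolutely_integrable_on {0..2*pi}"

lemma nev_m_eq: "nev_m f r = circ_mean r (\<lambda>z. logp (cmod (f z)))"
  by (simp add: nev_m_def circ_mean_def logp_def)

lemma circ_int_integrable:
  "circ_int r u \<Longrightarrow> (\<lambda>\<theta>. u (complex_of_real r * cis \<theta>)) integrable_on {0..2*pi}"
  unfolding circ_int_def by (rule set_lebesgue_integral_eq_integral)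

lemma circ_int_const [simp, intro]: "circ_int r (\<lambda>_. k)"
  unfolding circ_int_def by (intro absolutely_integrable_continuous_real continuous_intros)

lemma circ_int_add [intro]: "circ_int r u \<Longrightarrow> circ_int r v \<Longrightarrow> circ_int r (\<lambda>z. u z + v z)"
  unfolding circ_int_def by (rule set_integral_add)

lemma circ_int_diff [intro]: "circ_int r u \<Longrightarrow> circ_int r v \<Longrightarrow> circ_int r (\<lambda>z. u z - v z)"
  unfolding circ_int_def by (rule set_integral_diff)

lemma circ_int_cmult [intro]: "circ_int r u \<Longrightarrow> circ_int r (\<lambda>z. k * u z)"
  unfolding circ_int_def by (simp add: set_integrable_mult_right)

lemma circ_int_sum [intro]: "(\<And>i. i \<in> A \<Longrightarrow> circ_int r (u i)) \<Longrightarrow> circ_int r (\<lambda>z. \<Sum>i\<in>A. u i z)"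
  by (induction A rule: infinite_finite_induct) auto

lemma circ_int_abs [intro]: "circ_int r u \<Longrightarrow> circ_int r (\<lambda>z. \<bar>u z\<bar>)"
  unfolding circ_int_def by (rule set_integrable_abs)

lemma circ_int_max0 [intro]: "circ_int r u \<Longrightarrow> circ_int r (\<lambda>z. max 0 (u z))"
proof -
  assume u: "circ_int r u"
  have eq: "(\<lambda>z. max 0 (u z)) = (\<lambda>z. 1/2 * (u z + \<bar>u z\<bar>))" by (auto simp: max_def)
  show ?thesis unfolding eq using u by (intro circ_int_cmult circ_int_add circ_int_abs)
qed

lemma circ_int_logp [intro]: "circ_int r (\<lambda>z. ln (u z)) \<Longrightarrow> circ_int r (\<lambda>z. logp (u z))"
  unfolding logp_def by (rule circ_int_max0)

lemma circ_mean_const [simp]: "circ_mean r (\<lambda>_. k) = k"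
  by (simp add: circ_mean_def)

lemma circ_mean_add: "circ_int r u \<Longrightarrow> circ_int r v \<Longrightarrow> circ_mean r (\<lambda>z. u z + v z) = circ_mean r u + circ_mean r v"
  unfolding circ_mean_def by (simp add: integral_add circ_int_integrable add_divide_distrib)

lemma circ_mean_diff: "circ_int r u \<Longrightarrow> circ_int r v \<Longrightarrow> circ_mean r (\<lambda>z. u z - v z) = circ_mean r u - circ_mean r v"
  unfolding circ_mean_def by (simp add: integral_diff circ_int_integrable diff_divide_distrib)

lemma circ_mean_cmult: "circ_mean r (\<lambda>z. k * u z) = k * circ_mean r u"
  unfolding circ_mean_def by simp

lemma circ_mean_sum: "(\<And>i. i \<in> A \<Longrightarrow> circ_int r (u i)) \<Longrightarrow>
    circ_mean r (\<lambda>z. \<Sum>i\<in>A. u i z) = (\<Sum>i\<in>A. circ_mean r (u i))"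
  by (induction A rule: infinite_finite_induct) (auto simp: circ_mean_add circ_int_sum)

lemma finite_cis_vimage:
  assumes "finite E" "r > 0"
  shows "finite {\<theta>\<in>{0..2*pi}. complex_of_real r * cis \<theta> \<in> E}"
proof -
  have inj: "inj_on (\<lambda>\<theta>. complex_of_real r * cis \<theta>) {0..<2*pi}"
  proof (rule inj_onI)
    fix x y assume xy: "x \<in> {0..<2*pi}" "y \<in> {0..<2*pi}" "complex_of_real r * cis x = complex_of_real r * cis y"
    hence "cis x = cis y" using assms by simp
    hence "sin x = sin y \<and> cos x = cos y" by (metis cis.sel)
    then obtain n :: int where n: "x = y + 2 * pi * n" using sin_cos_eq_iff by metis
    have "\<bar>2 * pi * n\<bar> < 2 * pi" using xy n by auto
    hence "\<bar>real_of_int n\<bar> < 1" by (simp add: abs_mult)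
    hence "n = 0" by linarith
    with n show "x = y" by simp
  qed
  have "finite ((\<lambda>\<theta>. complex_of_real r * cis \<theta>) -` E \<inter> {0..<2*pi})"
    by (rule finite_vimage_IntI[OF assms(1) inj])
  hence "finite (insert (2*pi) ((\<lambda>\<theta>. complex_of_real r * cis \<theta>) -` E \<inter> {0..<2*pi}))" by simp
  thus ?thesis by (rule finite_subset[rotated]) auto
qed

text \<open>Identities between meromorphic functions hold off a sparse set. On a circle this leaves
  finitely many exceptional angles, which integrals do not see.\<close>

lemma cosparse_circle_finite:
  assumes "\<forall>\<^sub>\<approx>z. P z" "r > 0"
  shows "finite {\<theta>\<in>{0..2*pi}. \<not> P (complex_of_real r * cis \<theta>)}"
proof -
  have sp: "{z. \<not> P z} sparse_in UNIV" using assms(1) by (simp add: eventually_cosparse)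
  have "finite (cball 0 r \<inter> {z. \<not> P z})"
    by (rule sparse_in_compact_finite) (auto intro: sparse_in_subset[OF sp])
  from finite_cis_vimage[OF this assms(2)] show ?thesis
    by (rule finite_subset[rotated]) (use assms(2) in \<open>auto simp: norm_mult\<close>)
qed

lemma circ_int_cong:
  assumes "\<forall>\<^sub>\<approx>z. cmod z = r \<longrightarrow> u z = v z" "r > 0" "circ_int r u"
  shows "circ_int r v"
proof -
  define S where "S = {\<theta>\<in>{0..2*pi}. \<not> (cmod (complex_of_real r * cis \<theta>) = r \<longrightarrow>
    u (complex_of_real r * cis \<theta>) = v (complex_of_real r * cis \<theta>))}"
  have "finite S" unfolding S_def by (rule cosparse_circle_finite[OF assms(1,2)])
  hence "negligible S" by (rule negligible_finite)
  from absolutely_integrable_spike[OF assms(3)[unfolded circ_int_def] this] show ?thesis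
    unfolding circ_int_def S_def using assms(2) by (auto simp: norm_mult)
qed

lemma circ_mean_mono:
  assumes "\<forall>\<^sub>\<approx>z. cmod z = r \<longrightarrow> u z \<le> v z" "r > 0" "circ_int r u" "circ_int r v"
  shows "circ_mean r u \<le> circ_mean r v"
proof -
  define S where "S = {\<theta>\<in>{0..2*pi}. \<not> (cmod (complex_of_real r * cis \<theta>) = r \<longrightarrow>
    u (complex_of_real r * cis \<theta>) \<le> v (complex_of_real r * cis \<theta>))}"
  have "finite S" unfolding S_def by (rule cosparse_circle_finite[OF assms(1,2)])
  hence ng: "negligible S" by (rule negligible_finite)
  \<comment> \<open>Changing \<open>u\<close> on the finite exceptional set makes the inequality
    hold at every angle, as the comparison of integrals requires.\<close>
  define u' where "u' = (\<lambda>\<theta>. if \<theta> \<in> S then v (complex_of_real r * cis \<theta>) else u (complex_of_real r * cis \<theta>))"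
  have "u' integrable_on {0..2*pi}"
    by (rule integrable_spike[OF circ_int_integrable[OF assms(3)] ng]) (auto simp: u'_def)
  hence "integral {0..2*pi} u' \<le> integral {0..2*pi} (\<lambda>\<theta>. v (complex_of_real r * cis \<theta>))"
    by (rule integral_le[OF _ circ_int_integrable[OF assms(4)]])
       (use assms(2) in \<open>auto simp: u'_def S_def norm_mult\<close>)
  moreover have "integral {0..2*pi} u' = integral {0..2*pi} (\<lambda>\<theta>. u (complex_of_real r * cis \<theta>))"
    by (rule integral_spike[OF ng]) (auto simp: u'_def)
  ultimately have "integral {0..2*pi} (\<lambda>\<theta>. u (complex_of_real r * cis \<theta>)) \<le> integral {0..2*pi} (\<lambda>\<theta>. v (complex_of_real r * cis \<theta>))"
    by simp
  thus ?thesis unfolding circ_mean_def by (intro divide_right_mono) auto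
qed

lemma circ_mean_cong:
  assumes "\<forall>\<^sub>\<approx>z. cmod z = r \<longrightarrow> u z = v z" "r > 0"
  shows "circ_mean r u = circ_mean r v"
proof -
  define S where "S = {\<theta>\<in>{0..2*pi}. \<not> (cmod (complex_of_real r * cis \<theta>) = r \<longrightarrow>
    u (complex_of_real r * cis \<theta>) = v (complex_of_real r * cis \<theta>))}"
  have "finite S" unfolding S_def by (rule cosparse_circle_finite[OF assms(1,2)])
  hence ng: "negligible S" by (rule negligible_finite)
  have "integral {0..2*pi} (\<lambda>\<theta>. u (complex_of_real r * cis \<theta>)) = integral {0..2*pi} (\<lambda>\<theta>. v (complex_of_real r * cis \<theta>))"
    by (rule integral_spike[OF ng]) (use assms(2) in \<open>auto simp: S_def norm_mult\<close>)
  thus ?thesis unfolding circ_mean_def by simp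
qed

lemma circ_mean_nonneg: "(\<And>z. 0 \<le> u z) \<Longrightarrow> 0 \<le> circ_mean r u"
  unfolding circ_mean_def
  \<comment> \<open>If the integrand is not integrable, its integral is 0 by convention, so
    integrability need not be assumed.\<close>
  by (cases "(\<lambda>\<theta>. u (complex_of_real r * cis \<theta>)) integrable_on {0..2*pi}")
     (auto simp: not_integrable_integral intro!: integral_nonneg divide_nonneg_pos)

lemma circ_int_continuous:
  assumes "continuous_on (sphere 0 r) u" "r > 0"
  shows "circ_int r u"
  unfolding circ_int_def
proof (rule absolutely_integrable_continuous_real)
  show "continuous_on {0..2*pi} (\<lambda>\<theta>. u (complex_of_real r * cis \<theta>))"
    by (rule continuous_on_compose2[OF assms(1)])
       (use assms(2) in \<open>auto intro!: continuous_intros simp: norm_mult\<close>)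
qed

section \<open>Logarithmic singularities on a circle\<close>

lemma logp_inverse_le_sqrt: "x \<noteq> 0 \<Longrightarrow> logp (1 / \<bar>x\<bar>) \<le> 2 / sqrt \<bar>x\<bar>"
proof -
  assume x: "x \<noteq> 0"
  have "ln (1 / \<bar>x\<bar>) = 2 * ln (1 / sqrt \<bar>x\<bar>)" using x by (simp add: ln_div ln_sqrt)
  also have "ln (1 / sqrt \<bar>x\<bar>) \<le> 1 / sqrt \<bar>x\<bar> - 1" using x by (intro ln_le_minus_one) auto
  finally show ?thesis by (simp add: logp_def)
qed

text \<open>The integrand majorises the logarithmic singularity at \<open>b\<close>. Since
  \<open>sqrt\<close> is an odd function here, \<open>4 * sqrt (x - b)\<close> is a continuous
  primitive on both sides of \<open>b\<close>, so neither the position of \<open>b\<close> nor a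
  splitting of the interval matters.\<close>

lemma has_integral_inverse_sqrt_abs:
  assumes "p \<le> q"
  shows "((\<lambda>x. 2 / sqrt \<bar>x - b\<bar>) has_integral (4 * sqrt (q - b) - 4 * sqrt (p - b))) {p..q}"
proof (rule fundamental_theorem_of_calculus_strong[of "{b}"])
  fix x assume "x \<in> {p..q} - {b}"
  hence xb: "x - b \<noteq> 0" by auto
  have "(sqrt has_field_derivative 1 / (2 * sqrt \<bar>x - b\<bar>)) (at (x - b))"
    using xb by (intro DERIV_real_sqrt_generic) (use real_sqrt_minus[of "x - b"] in \<open>auto simp: divide_simps\<close>)
  hence "((\<lambda>x. sqrt (x - b)) has_field_derivative 1 / (2 * sqrt \<bar>x - b\<bar>) * 1) (at x)"
    by (rule DERIV_chain2) (auto intro!: derivative_eq_intros)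
  from DERIV_cmult[OF this, of 4]
  have "((\<lambda>x. 4 * sqrt (x - b)) has_field_derivative 2 / sqrt \<bar>x - b\<bar>) (at x)"
    by simp
  thus "((\<lambda>x. 4 * sqrt (x - b)) has_vector_derivative 2 / sqrt \<bar>x - b\<bar>) (at x)"
    by (rule has_real_derivative_iff_has_vector_derivative[THEN iffD1])
qed (auto intro!: continuous_intros assms)

lemma abs_sin_lower:
  assumes "-(pi/2) \<le> v" "v \<le> pi/2"
  shows "\<bar>v\<bar> / 2 \<le> \<bar>sin v\<bar>"
proof -
  have *: "x / 2 \<le> sin x" if x: "0 \<le> x" "x \<le> pi/2" for x :: real
  proof (cases "x = 0")
    case False
    define y where "y = x / 2"
    have y: "0 < y" "y \<le> pi / 4" using x False by (auto simp: y_def)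
    obtain \<xi> where \<xi>: "0 < \<xi>" "\<xi> < y" "sin y - sin 0 = (y - 0) * cos \<xi>"
      using MVT2[of 0 y sin cos] y by (auto intro: DERIV_sin)
    have cos_ge: "sqrt 2 / 2 \<le> cos t" if "0 \<le> t" "t \<le> pi / 4" for t
      using cos_monotone_0_pi_le[of t "pi/4"] that by (simp add: cos_45)
    \<comment> \<open>Halving the angle moves it below pi/4, where the cosine is at least
      \<open>sqrt 2 / 2\<close>. One such factor comes from the mean value theorem for
      \<open>sin y\<close>, the other from \<open>sin x = 2 sin y cos y\<close>; their product is
      1/2.\<close>
    have "x / 2 = 2 * (y * (sqrt 2 / 2)) * (sqrt 2 / 2)" by (simp add: y_def)
    also have "\<dots> \<le> 2 * sin y * cos y"
      using \<xi> y cos_ge[of \<xi>] cos_ge[of y]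
      by (intro mult_mono) (auto intro!: mult_nonneg_nonneg order_trans[OF _ cos_ge])
    also have "\<dots> = sin x" using sin_double[of y] by (simp add: y_def)
    finally show ?thesis .
  qed auto
  show ?thesis
  proof (cases "0 \<le> v")
    case True thus ?thesis using *[of v] assms by auto
  next
    case False thus ?thesis using *[of "-v"] assms by auto
  qed
qed

lemma cmod_cis_diff: "cmod (cis s - cis t) = 2 * \<bar>sin ((s - t) / 2)\<bar>"
proof -
  have "(cmod (cis s - cis t))\<^sup>2 = 2 - 2 * cos (s - t)"
    using sin_cos_squared_add[of s] sin_cos_squared_add[of t]
    unfolding cmod_power2 by (simp add: power2_eq_square cos_diff algebra_simps)
  also have "\<dots> = (2 * \<bar>sin ((s - t) / 2)\<bar>)\<^sup>2"
  proof -
    have "cos (s - t) = 1 - 2 * (sin ((s - t) / 2))\<^sup>2"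
      using cos_double_sin[of "(s - t) / 2"] by (metis nonzero_mult_div_cancel_left times_divide_eq_right zero_neq_numeral)
    thus ?thesis by (simp add: power_mult_distrib)
  qed
  finally show ?thesis by (metis abs_ge_zero mult_nonneg_nonneg norm_ge_zero power2_eq_imp_eq zero_le_numeral)
qed


text \<open>The distance from \<open>r e\<^sup>i\<^sup>\<theta>\<close> to \<open>a\<close> is at least half its distance to the
  radial projection of \<open>a\<close> onto the circle, so it suffices to treat singularities on the circle.\<close>
lemma logp_inverse_circle_le:
  assumes r: "1 \<le> r" and \<theta>: "\<theta> \<in> {0..2*pi}" and ne: "\<theta> \<noteq> Arg a" "\<theta> \<noteq> Arg a + 2 * pi"
  shows "logp (1 / cmod (complex_of_real r * cis \<theta> - a)) \<le>
     ln 4 + 2 / sqrt \<bar>\<theta> - Arg a\<bar> + 2 / sqrt \<bar>\<theta> - (Arg a + 2 * pi)\<bar>"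
proof -
  define d where "d = cmod (complex_of_real r * cis \<theta> - a)"
  have aeq: "a = complex_of_real (cmod a) * cis (Arg a)"
    by (metis rcis_cmod_Arg rcis_def)
  have n0: "cmod (complex_of_real x * cis t) = \<bar>x\<bar>" for x t by (simp add: norm_mult)
  have "r * (2 * \<bar>sin ((\<theta> - Arg a) / 2)\<bar>) = cmod (complex_of_real r * (cis \<theta> - cis (Arg a)))"
    using r by (simp add: norm_mult cmod_cis_diff)
  also have "\<dots> = cmod ((complex_of_real r * cis \<theta> - a) + complex_of_real (cmod a - r) * cis (Arg a))"
    by (subst (2) aeq) (simp add: algebra_simps)
  also have "\<dots> \<le> d + \<bar>cmod a - r\<bar>"
    unfolding d_def by (rule order_trans[OF norm_triangle_ineq]) (simp only: n0)
  also have "\<bar>cmod a - r\<bar> \<le> d"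
    using norm_triangle_ineq3[of a "complex_of_real r * cis \<theta>"] r
    by (simp add: d_def norm_minus_commute norm_mult)
  finally have "r * \<bar>sin ((\<theta> - Arg a) / 2)\<bar> \<le> d" by simp
  moreover have "1 * \<bar>sin ((\<theta> - Arg a) / 2)\<bar> \<le> r * \<bar>sin ((\<theta> - Arg a) / 2)\<bar>"
    using r by (intro mult_right_mono) auto
  ultimately have sin_le: "\<bar>sin ((\<theta> - Arg a) / 2)\<bar> \<le> d" by simp
  have Arg: "-pi < Arg a" "Arg a \<le> pi" using Arg_bounded by auto
  have main: "logp (1 / d) \<le> ln 4 + 2 / sqrt \<bar>x\<bar>" if x: "x \<noteq> 0" "\<bar>x\<bar> / 4 \<le> d" for x
  proof -
    have "logp (1 / d) \<le> logp (4 * (1 / \<bar>x\<bar>))"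
    proof (rule logp_mono)
      have "0 < d" using x by linarith
      thus "0 \<le> 1 / d" "1 / d \<le> 4 * (1 / \<bar>x\<bar>)" using x by (auto simp: field_simps)
    qed
    also have "\<dots> \<le> logp 4 + logp (1 / \<bar>x\<bar>)" by (intro logp_mult) auto
    also have "logp (4::real) = ln 4" by (simp add: logp_eq_ln)
    also have "logp (1 / \<bar>x\<bar>) \<le> 2 / sqrt \<bar>x\<bar>" using x by (intro logp_inverse_le_sqrt)
    finally show ?thesis by simp
  qed
  show ?thesis
  \<comment> \<open>The difference of the angles lies between \<open>-pi\<close> and
    \<open>3 * pi\<close>, so one of the two representatives \<open>Arg a\<close> and
    \<open>Arg a + 2 * pi\<close> is within \<open>pi\<close> of \<open>\<theta>\<close>, and the
    lower bound for the sine applies to half of that distance.\<close>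
  proof (cases "\<theta> - Arg a \<le> pi")
    case True
    have "\<bar>(\<theta> - Arg a) / 2\<bar> / 2 \<le> \<bar>sin ((\<theta> - Arg a) / 2)\<bar>"
      using True \<theta> Arg by (intro abs_sin_lower) auto
    hence "logp (1 / d) \<le> ln 4 + 2 / sqrt \<bar>\<theta> - Arg a\<bar>"
      using ne sin_le by (intro main) auto
    thus ?thesis unfolding d_def by (rule order_trans) simp
  next
    case False
    have "\<bar>(\<theta> - (Arg a + 2 * pi)) / 2\<bar> / 2 \<le> \<bar>sin ((\<theta> - (Arg a + 2 * pi)) / 2)\<bar>"
      using False \<theta> Arg by (intro abs_sin_lower) auto
    also have "sin ((\<theta> - (Arg a + 2 * pi)) / 2) = - sin ((\<theta> - Arg a) / 2)"
      using sin_minus_pi[of "(\<theta> - Arg a) / 2"] by (simp add: diff_divide_distrib add_divide_distrib algebra_simps)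
    finally have "logp (1 / d) \<le> ln 4 + 2 / sqrt \<bar>\<theta> - (Arg a + 2 * pi)\<bar>"
      using ne sin_le by (intro main) auto
    thus ?thesis unfolding d_def by (rule order_trans) simp
  qed
qed

text \<open>Negative arguments are meant too, \<open>sqrt\<close> being odd; the factor 2 covers an
  interval with 0 inside, where both halves contribute. The estimate removes \<open>Arg a\<close>
  from the integral of the majorant.\<close>

lemma sqrt_diff_le: "p \<le> q \<Longrightarrow> sqrt q - sqrt p \<le> 2 * sqrt (q - p)"
proof -
  assume pq: "p \<le> q"
  consider "0 \<le> p" | "q \<le> 0" | "p < 0" "0 < q" by linarith
  thus ?thesis
  proof cases
    case 1
    have "sqrt (p + (q - p)) \<le> sqrt p + sqrt (q - p)"
      using 1 pq by (intro sqrt_add_le_add_sqrt) auto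
    moreover have "0 \<le> sqrt (q - p)" using pq by (intro real_sqrt_ge_zero) auto
    ultimately show ?thesis by (simp only: diff_add_cancel add_diff_cancel_left' add.commute[of p])
  next
    case 2
    have "sqrt (-q + (q - p)) \<le> sqrt (-q) + sqrt (q - p)"
      using 2 pq by (intro sqrt_add_le_add_sqrt) auto
    also have "-q + (q - p) = - p" by simp
    finally have "- sqrt p \<le> - sqrt q + sqrt (q - p)" by (simp only: real_sqrt_minus)
    moreover have "0 \<le> sqrt (q - p)" using pq by (intro real_sqrt_ge_zero) auto
    ultimately show ?thesis by linarith
  next
    case 3
    have "sqrt q \<le> sqrt (q - p)" "sqrt (-p) \<le> sqrt (q - p)"
      using 3 by (auto intro!: real_sqrt_le_mono)
    thus ?thesis unfolding real_sqrt_minus by linarith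
  qed
qed

text \<open>The mean of the majorant: the constant \<open>ln 4\<close>, and two singular terms whose
  integrals are at most \<open>8 * sqrt (2 * pi)\<close> each, divided by
  \<open>2 * pi\<close>.\<close>

definition circle_log_const :: real where "circle_log_const = ln 4 + 8 * sqrt (2 * pi) / pi"

text \<open>The bound depends neither on \<open>a\<close> nor on \<open>r\<close>. Hence a zero or
  pole costs a bounded amount on every circle, even when it lies on the circle, and no radius has to
  be excluded.\<close>

lemma
  assumes r: "1 \<le> r"
  shows circ_int_logp_inverse: "circ_int r (\<lambda>z. logp (1 / cmod (z - a)))"
    and circ_mean_logp_inverse: "circ_mean r (\<lambda>z. logp (1 / cmod (z - a))) \<le> circle_log_const"
proof -
  define u where "u = (\<lambda>\<theta>. logp (1 / cmod (complex_of_real r * cis \<theta> - a)))"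
  define v where "v = (\<lambda>\<theta>. ln 4 + 2 / sqrt \<bar>\<theta> - Arg a\<bar> + 2 / sqrt \<bar>\<theta> - (Arg a + 2 * pi)\<bar>)"
  \<comment> \<open>At the two singular angles the majorant \<open>v\<close> loses a term because
    \<open>x / 0 = 0\<close>, while \<open>u\<close> may be large there if \<open>a\<close> is close
    to the circle. Setting the value to 0 at these angles restores domination everywhere.\<close>
  define u' where "u' = (\<lambda>\<theta>. if \<theta> \<in> {Arg a, Arg a + 2 * pi} then 0 else u \<theta>)"
  define V where "V = ln 4 * (2 * pi) + (4 * sqrt (2 * pi - Arg a) - 4 * sqrt (0 - Arg a))
     + (4 * sqrt (2 * pi - (Arg a + 2 * pi)) - 4 * sqrt (0 - (Arg a + 2 * pi)))"
  have v: "(v has_integral V) {0..2*pi}"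
    unfolding v_def V_def
    using has_integral_const_real[of "ln 4 :: real" 0 "2*pi"]
    by (intro has_integral_add has_integral_inverse_sqrt_abs) (auto simp: mult.commute)
  have meas: "u' \<in> borel_measurable (lebesgue_on {0..2*pi})"
  proof -
    have "(\<lambda>\<theta>::real. cis \<theta>) \<in> borel_measurable borel"
      by (intro borel_measurable_continuous_onI continuous_intros)
    hence "u' \<in> borel_measurable borel" unfolding u'_def u_def logp_def by measurable
    thus ?thesis by (simp add: borel_measurable_if_D measurable_completion measurable_restrict_space1)
  qed
  have nn: "0 \<le> u' \<theta>" for \<theta> by (simp add: u'_def u_def)
  have le: "u' \<theta> \<le> v \<theta>" if "\<theta> \<in> {0..2*pi}" for \<theta>
    using logp_inverse_circle_le[OF r that, of a] by (auto simp: u'_def u_def v_def)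
  have ai: "u' absolutely_integrable_on {0..2*pi}"
    by (rule measurable_bounded_by_integrable_imp_absolutely_integrable[OF meas, of v])
       (use v nn le in \<open>auto simp: has_integral_integrable\<close>)
  have "u absolutely_integrable_on {0..2*pi}"
    by (rule absolutely_integrable_spike[OF ai negligible_finite[of "{Arg a, Arg a + 2 * pi}"]])
       (auto simp: u'_def)
  thus "circ_int r (\<lambda>z. logp (1 / cmod (z - a)))" by (simp add: circ_int_def u_def)
  have "integral {0..2*pi} u = integral {0..2*pi} u'"
    by (rule integral_spike[OF negligible_finite[of "{Arg a, Arg a + 2 * pi}"]]) (auto simp: u'_def)
  also have "\<dots> \<le> V"
    using integral_le[OF set_lebesgue_integral_eq_integral(1)[OF ai] has_integral_integrable[OF v]] le
      integral_unique[OF v] by auto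
  also have "V \<le> ln 4 * (2 * pi) + 4 * (2 * sqrt (2 * pi)) + 4 * (2 * sqrt (2 * pi))"
    using sqrt_diff_le[of "0 - Arg a" "2 * pi - Arg a"]
      sqrt_diff_le[of "0 - (Arg a + 2 * pi)" "2 * pi - (Arg a + 2 * pi)"]
    unfolding V_def by simp
  also have "\<dots> = circle_log_const * (2 * pi)" by (simp add: circle_log_const_def field_simps)
  finally show "circ_mean r (\<lambda>z. logp (1 / cmod (z - a))) \<le> circle_log_const"
    by (simp add: circ_mean_def u_def divide_le_eq)
qed

lemma circle_log_const_nonneg: "0 \<le> circle_log_const" by (simp add: circle_log_const_def)

lemma circ_int_ln_dist:
  assumes r: "1 \<le> r"
  shows "circ_int r (\<lambda>z. ln (cmod (z - a)))"
proof -
  \<comment> \<open>In this form the positive part is visibly continuous, also where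
    \<open>z = a\<close>. Only the negative part of the logarithm is singular.\<close>
  have eq: "logp x = ln (max 1 x)" if "0 \<le> x" for x
    using that by (auto simp: max_def logp_eq_ln logp_eq_0)
  have "continuous_on (sphere 0 r) (\<lambda>z. ln (max 1 (cmod (z - a))))"
    by (intro continuous_intros) (auto simp: max_def)
  hence "circ_int r (\<lambda>z. logp (cmod (z - a)))"
    using r by (simp add: eq circ_int_continuous)
  from circ_int_diff[OF this circ_int_logp_inverse[OF r, of a]] show ?thesis
    by (simp flip: ln_eq_logp_diff)
qed

subsection \<open>Divisors and proximity functions of meromorphic functions\<close>

lemma meromorphic_nonzero_cosparse:
  assumes "f meromorphic_on UNIV" "\<not> (\<forall>\<^sub>\<approx>z. f z = 0)"
  shows "\<forall>\<^sub>\<approx>z. f z \<noteq> 0"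
  using meromorphic_imp_constant_or_avoid[OF assms(1), of 0] assms(2) by auto

lemma meromorphic_nonzero_at:
  assumes "f meromorphic_on UNIV" "\<not> (\<forall>\<^sub>\<approx>z. f z = 0)"
  shows "eventually (\<lambda>w. f w \<noteq> 0) (at z)" "\<exists>\<^sub>F w in at z. f w \<noteq> 0"
proof -
  show *: "eventually (\<lambda>w. f w \<noteq> 0) (at z)"
    by (rule eventually_cosparse_imp_eventually_at[OF meromorphic_nonzero_cosparse[OF assms]]) auto
  show "\<exists>\<^sub>F w in at z. f w \<noteq> 0" by (rule eventually_frequently[OF _ *]) auto
qed

text \<open>Zeros and poles share one set and are told apart by the sign of \<open>zorder\<close>,
  so that a single product with integer exponents carries both.\<close>

definition div_set :: "(complex \<Rightarrow> complex) \<Rightarrow> real \<Rightarrow> complex set" where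
  "div_set f R = {z. cmod z \<le> R \<and> zorder f z \<noteq> 0}"

lemma finite_div_set:
  assumes "f meromorphic_on UNIV" "\<not> (\<forall>\<^sub>\<approx>z. f z = 0)"
  shows "finite (div_set f R)"
proof -
  have "\<forall>\<^sub>\<approx>z. zorder f z = 0"
    using meromorphic_on_imp_analytic_cosparse[OF assms(1)] meromorphic_nonzero_cosparse[OF assms]
    by eventually_elim (rule zorder_eq_0I)
  hence sp: "{z. zorder f z \<noteq> 0} sparse_in UNIV" by (simp add: eventually_cosparse)
  have "finite (cball 0 R \<inter> {z. zorder f z \<noteq> 0})"
    by (rule sparse_in_compact_finite) (auto intro: sparse_in_subset[OF sp])
  thus ?thesis by (rule finite_subset[rotated]) (auto simp: div_set_def)
qed

lemma is_pole_iff_zorder: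
  assumes "f meromorphic_on UNIV" "\<not> (\<forall>\<^sub>\<approx>z. f z = 0)"
  shows "is_pole f z \<longleftrightarrow> zorder f z < 0"
proof -
  have "f meromorphic_on {z}" using assms(1) by (rule meromorphic_on_subset) auto
  thus ?thesis
    using isolated_pole_imp_neg_zorder[of f z] zorder_neg_imp_is_pole[OF _ meromorphic_nonzero_at(1)[OF assms]]
    by (auto simp: meromorphic_at_iff)
qed

text \<open>The quotient of \<open>f\<close> by the product has order 0 at every point of the closed
  disc, so \<open>remove_sings\<close> turns it into a zero-free analytic function there. The
  identity holds only off a sparse set because the values of \<open>f\<close> at its singularities
  are arbitrary.\<close>

lemma meromorphic_factorization:
  assumes f: "f meromorphic_on UNIV" "\<not> (\<forall>\<^sub>\<approx>z. f z = 0)"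
  obtains g where "g analytic_on cball 0 R" "\<And>z. z \<in> cball 0 R \<Longrightarrow> g z \<noteq> 0"
    "\<forall>\<^sub>\<approx>z. f z = g z * (\<Prod>a\<in>div_set f R. (z - a) powi zorder f a)"
proof -
  let ?D = "div_set f R"
  have fin: "finite ?D" by (rule finite_div_set[OF f])
  define P where "P = (\<lambda>z. \<Prod>a\<in>?D. (z - a) powi zorder f a)"
  have Pm: "P meromorphic_on A" for A unfolding P_def by (intro meromorphic_intros)
  have Pnz: "P z \<noteq> 0" if "z \<notin> ?D" for z using that fin by (auto simp: P_def)
  have Pnz_ev: "eventually (\<lambda>w. P w \<noteq> 0) (at z)" for z
    using islimpt_finite[OF fin, of z] Pnz
    by (auto simp: islimpt_iff_eventually elim: eventually_mono)
  have Pord: "zorder P z = (if z \<in> ?D then zorder f z else 0)" for z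
  proof -
    have m1: "(\<lambda>w. w - a) meromorphic_on {z}" for a by (intro meromorphic_intros)
    have nz1: "\<exists>\<^sub>F w in at z. w - a \<noteq> 0" for a
      by (rule eventually_frequently) (auto intro: eventually_neq_at_within)
    have o1: "zorder (\<lambda>w. w - a) z = (if z = a then 1 else 0)" for a
    proof (cases "z = a")
      case True
      have "zorder (\<lambda>w. w - a) z = 1"
        by (rule zorder_eqI[of UNIV _ "\<lambda>_. 1"]) (auto simp: True)
      thus ?thesis using True by simp
    next
      case False
      thus ?thesis by (auto intro!: zorder_eq_0I analytic_intros)
    qed
    have "zorder P z = (\<Sum>a\<in>?D. zorder (\<lambda>w. (w - a) powi zorder f a) z)"
      unfolding P_def by (rule zorder_prod) (use Pnz_ev[of z] in \<open>auto simp: P_def intro!: meromorphic_intros\<close>)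
    also have "\<dots> = (\<Sum>a\<in>?D. zorder f a * (if z = a then 1 else 0))"
      by (intro sum.cong refl) (simp add: zorder_power_int[OF m1 nz1] o1)
    also have "\<dots> = (if z \<in> ?D then zorder f z else 0)" using fin by (simp add: if_distrib sum.delta cong: if_cong)
    finally show ?thesis .
  qed
  define q where "q = (\<lambda>z. f z / P z)"
  have qm: "q meromorphic_on A" for A
    unfolding q_def using f(1) Pm by (intro meromorphic_intros) (auto intro: meromorphic_on_subset)
  have fm: "f meromorphic_on {z}" for z using f(1) by (rule meromorphic_on_subset) auto
  have qnz: "eventually (\<lambda>w. q w \<noteq> 0) (at z)" for z
    using meromorphic_nonzero_at(1)[OF f, of z] Pnz_ev[of z]
    by eventually_elim (auto simp: q_def)
  have qord: "zorder q z = 0" if "z \<in> cball 0 R" for z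
  proof -
    have "zorder q z = zorder f z - zorder P z" unfolding q_def
      by (rule zorder_divide[OF fm meromorphic_nonzero_at(2)[OF f] Pm])
         (rule eventually_frequently[OF _ Pnz_ev], simp)
    thus ?thesis using that by (auto simp: Pord div_set_def)
  qed
  define g where "g = remove_sings q"
  have an: "g analytic_on {z} \<and> g z \<noteq> 0" if z: "z \<in> cball 0 R" for z
  proof -
    have iso: "isolated_singularity_at q z" "not_essential q z"
      using qm[of "{z}"] by (auto simp: meromorphic_at_iff)
    have fr: "\<exists>\<^sub>F w in at z. q w \<noteq> 0" by (rule eventually_frequently[OF _ qnz]) simp
    have np: "\<not> is_pole q z" using isolated_pole_imp_neg_zorder[OF iso(1)] qord[OF z] by auto
    have niz: "\<not> isolated_zero q z" using zorder_isolated_zero_pos'[OF _ iso(1)] qord[OF z] by auto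
    from np iso(2) obtain c where c: "q \<midarrow>z\<rightarrow> c" by (auto simp: not_essential_def)
    have "g analytic_on {z}" unfolding g_def by (rule remove_sings_analytic_at[OF iso(1) c])
    moreover have "g z \<noteq> 0"
      using niz np qnz[of z] iso(2) unfolding g_def by (auto simp: remove_sings_eq_0_iff isolated_zero_def)
    ultimately show ?thesis by blast
  qed
  have "g analytic_on cball 0 R" using an analytic_on_analytic_at by blast
  moreover have "\<forall>\<^sub>\<approx>z. f z = g z * P z"
  proof -
    have "\<forall>\<^sub>\<approx>z. z \<notin> ?D" using fin by (intro eventually_not_in_cosparse finite_imp_sparse)
    with eventually_remove_sings_eq[OF qm[of UNIV]] show ?thesis
      by eventually_elim (use Pnz in \<open>auto simp: g_def q_def\<close>)
  qed
  ultimately show ?thesis using an that[of g] by (auto simp: P_def)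
qed

lemma ln_norm_prod_powi:
  fixes h :: "'a \<Rightarrow> complex"
  assumes "finite A" "\<And>a. a \<in> A \<Longrightarrow> h a \<noteq> 0"
  shows "ln (cmod (\<Prod>a\<in>A. h a powi o' a)) = (\<Sum>a\<in>A. of_int (o' a) * ln (cmod (h a)))"
proof -
  have "ln (cmod (\<Prod>a\<in>A. h a powi o' a)) = ln (\<Prod>a\<in>A. cmod (h a) powi o' a)"
    by (simp add: prod_norm[symmetric] norm_power_int)
  also have "\<dots> = (\<Sum>a\<in>A. ln (cmod (h a) powi o' a))"
    using assms by (intro ln_prod) auto
  also have "\<dots> = (\<Sum>a\<in>A. of_int (o' a) * ln (cmod (h a)))"
    using assms(2) by (intro sum.cong refl) (simp add: ln_powr flip: powr_real_of_int')
  finally show ?thesis .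
qed

text \<open>The factorization on the disc reduces \<open>ln (cmod (f z))\<close> to a continuous
  function plus finitely many terms \<open>ln (cmod (z - a))\<close>. For \<open>f\<close> vanishing
  off a sparse set the claim rests on \<open>ln 0 = 0\<close>.\<close>

lemma circ_int_ln_meromorphic:
  assumes f: "f meromorphic_on UNIV" and r: "1 \<le> r"
  shows "circ_int r (\<lambda>z. ln (cmod (f z)))"
proof (cases "\<forall>\<^sub>\<approx>z. f z = 0")
  case True
  show ?thesis
    by (rule circ_int_cong[of r "\<lambda>_. 0"]) (use True r in \<open>auto elim: eventually_mono\<close>)
next
  case False
  obtain g where g: "g analytic_on cball 0 r" "\<And>z. z \<in> cball 0 r \<Longrightarrow> g z \<noteq> 0"
    "\<forall>\<^sub>\<approx>z. f z = g z * (\<Prod>a\<in>div_set f r. (z - a) powi zorder f a)"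
    by (rule meromorphic_factorization[OF f False, of r]) blast
  have fin: "finite (div_set f r)" by (rule finite_div_set[OF f False])
  have cg: "continuous_on (sphere 0 r) (\<lambda>z. ln (cmod (g z)))"
    using g(1,2) by (intro continuous_intros continuous_on_subset[OF holomorphic_on_imp_continuous_on[OF analytic_imp_holomorphic[OF g(1)]]]) auto
  have i: "circ_int r (\<lambda>z. ln (cmod (g z)) + (\<Sum>a\<in>div_set f r. of_int (zorder f a) * ln (cmod (z - a))))"
    using r by (intro circ_int_add circ_int_continuous[OF cg] circ_int_sum circ_int_cmult circ_int_ln_dist) auto
  have nd: "\<forall>\<^sub>\<approx>z. z \<notin> div_set f r" using fin by (intro eventually_not_in_cosparse finite_imp_sparse)
  show ?thesis
  proof (rule circ_int_cong[OF _ _ i])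
    show "\<forall>\<^sub>\<approx>z. cmod z = r \<longrightarrow> ln (cmod (g z)) + (\<Sum>a\<in>div_set f r. of_int (zorder f a) * ln (cmod (z - a))) = ln (cmod (f z))"
      using g(3) nd
    proof eventually_elim
      case (elim z)
      show ?case
      proof
        assume "cmod z = r"
        hence gz: "g z \<noteq> 0" by (intro g(2)) auto
        have za: "z - a \<noteq> 0" if "a \<in> div_set f r" for a using that elim(2) by auto
        have "ln (cmod (f z)) = ln (cmod (g z)) + ln (cmod (\<Prod>a\<in>div_set f r. (z - a) powi zorder f a))"
          unfolding elim(1) norm_mult using gz za fin by (intro ln_mult_pos) auto
        also have "ln (cmod (\<Prod>a\<in>div_set f r. (z - a) powi zorder f a)) =
          (\<Sum>a\<in>div_set f r. of_int (zorder f a) * ln (cmod (z - a)))"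
          by (rule ln_norm_prod_powi[OF fin za])
        finally show "ln (cmod (g z)) + (\<Sum>a\<in>div_set f r. of_int (zorder f a) * ln (cmod (z - a))) = ln (cmod (f z))"
          by simp
      qed
    qed
  qed (use r in auto)
qed

lemma circ_int_nev_m: "f meromorphic_on UNIV \<Longrightarrow> 1 \<le> r \<Longrightarrow> circ_int r (\<lambda>z. logp (cmod (f z)))"
  by (intro circ_int_logp circ_int_ln_meromorphic)

lemma nev_m_nonneg: "0 \<le> nev_m f r"
  unfolding nev_m_eq by (rule circ_mean_nonneg) simp

lemma nev_m_mult:
  assumes "f meromorphic_on UNIV" "g meromorphic_on UNIV" "1 \<le> r"
  shows "nev_m (\<lambda>z. f z * g z) r \<le> nev_m f r + nev_m g r"
proof -
  have "nev_m (\<lambda>z. f z * g z) r \<le> circ_mean r (\<lambda>z. logp (cmod (f z)) + logp (cmod (g z)))"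
    unfolding nev_m_eq using assms
    by (intro circ_mean_mono circ_int_add circ_int_nev_m meromorphic_intros) (auto simp: norm_mult intro!: always_eventually logp_mult)
  thus ?thesis using assms by (simp add: circ_mean_add circ_int_nev_m nev_m_eq)
qed

lemma nev_m_sum:
  assumes "finite A" "\<And>i. i \<in> A \<Longrightarrow> f i meromorphic_on UNIV" "1 \<le> r"
  shows "nev_m (\<lambda>z. \<Sum>i\<in>A. f i z) r \<le> (\<Sum>i\<in>A. nev_m (f i) r) + ln (real (card A))"
proof -
  have pw: "logp (cmod (\<Sum>i\<in>A. f i z)) \<le> (\<Sum>i\<in>A. logp (cmod (f i z))) + ln (real (card A))" for z
  proof -
    have "logp (cmod (\<Sum>i\<in>A. f i z)) \<le> logp (\<Sum>i\<in>A. cmod (f i z))"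
      by (intro logp_mono norm_sum) auto
    also have "\<dots> \<le> (\<Sum>i\<in>A. logp (cmod (f i z))) + ln (real (card A))"
      using assms(1) by (intro logp_sum_le) auto
    finally show ?thesis .
  qed
  have "nev_m (\<lambda>z. \<Sum>i\<in>A. f i z) r \<le> circ_mean r (\<lambda>z. (\<Sum>i\<in>A. logp (cmod (f i z))) + ln (real (card A)))"
    unfolding nev_m_eq using assms pw
    by (intro circ_mean_mono circ_int_add circ_int_sum circ_int_nev_m meromorphic_intros) (auto intro!: always_eventually)
  also have "\<dots> = (\<Sum>i\<in>A. nev_m (f i) r) + ln (real (card A))"
    using assms by (simp add: circ_mean_add circ_mean_sum circ_int_sum circ_int_nev_m nev_m_eq)
  finally show ?thesis .
qed

lemma nev_m_cong: "\<forall>\<^sub>\<approx>z. f z = g z \<Longrightarrow> 1 \<le> r \<Longrightarrow> nev_m f r = nev_m g r"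
  unfolding nev_m_eq by (rule circ_mean_cong) (auto elim: eventually_mono)

lemma nev_m_le:
  assumes "f meromorphic_on UNIV" "1 \<le> r" "\<forall>\<^sub>\<approx>z. cmod z = r \<longrightarrow> logp (cmod (f z)) \<le> u z" "circ_int r u"
  shows "nev_m f r \<le> circ_mean r u"
  unfolding nev_m_eq using assms by (intro circ_mean_mono circ_int_nev_m) auto

subsection \<open>Representation on a disc and Jensen's formula\<close>

lemma circle_integral_mean_value:
  assumes h: "h holomorphic_on cball 0 R" and R: "R > 0"
  shows "((\<lambda>t. h (complex_of_real R * cis t)) has_integral (2 * of_real pi * h 0)) {0..2*pi}"
proof -
  have "((\<lambda>u. h u / (u - 0)) has_contour_integral (2 * of_real pi * \<i> * h 0)) (circlepath 0 R)"
    using R by (intro Cauchy_integral_circlepath_simple[OF h]) auto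
  hence "((\<lambda>t. h (0 + R * cis t) / (0 + R * cis t - 0) * R * \<i> * cis t) has_integral (2 * of_real pi * \<i> * h 0)) {0..2*pi}"
    unfolding circlepath_def by (subst (asm) has_contour_integral_part_circlepath_iff) auto
  hence "((\<lambda>t. -\<i> * (h (0 + R * cis t) / (0 + R * cis t - 0) * R * \<i> * cis t)) has_integral (-\<i> * (2 * of_real pi * \<i> * h 0))) {0..2*pi}"
    by (rule has_integral_mult_right)
  thus ?thesis
    by (rule has_integral_eq_rhs[OF has_integral_eq[rotated]]) (use R in \<open>auto simp: algebra_simps simp flip: power2_eq_square\<close>)
qed

lemma circ_mean_Re:
  assumes h: "h holomorphic_on cball 0 R" and R: "R > 0"
  shows "circ_mean R (\<lambda>z. Re (h z)) = Re (h 0)"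
proof -
  have "((\<lambda>t. Re (h (complex_of_real R * cis t))) has_integral Re (2 * of_real pi * h 0)) {0..2*pi}"
    using has_integral_linear[OF circle_integral_mean_value[OF assms] bounded_linear_Re] by (simp add: o_def)
  from integral_unique[OF this] show ?thesis by (simp add: circ_mean_def)
qed

lemma blaschke_denom_nonzero:
  assumes "cmod a < R" "cmod z \<le> R"
  shows "of_real (R\<^sup>2) - cnj a * z \<noteq> 0"
proof
  have R: "R > 0" using assms(1) norm_ge_zero[of a] by linarith
  assume "of_real (R\<^sup>2) - cnj a * z = 0"
  hence "cmod (of_real (R\<^sup>2)) = cmod (cnj a * z)" by simp
  hence "R\<^sup>2 = cmod a * cmod z" using R by (simp add: norm_mult norm_power)
  also have "\<dots> \<le> cmod a * R" using assms by (intro mult_left_mono) auto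
  also have "\<dots> < R * R" using assms R by simp
  finally show False by (simp add: power2_eq_square)
qed

text \<open>Differentiated Schwarz formula: \<open>h'(z)\<close> is the circle mean of \<open>2 Re h(w) w / (w - z)\<^sup>2\<close>,
  because the corresponding integral with \<open>h\<close> conjugated vanishes by Cauchy's theorem.\<close>
lemma deriv_bound_Re:
  assumes h: "h holomorphic_on cball 0 R" and z: "cmod z < R"
  shows "cmod (deriv h z) \<le> 2 * R / (R - cmod z)\<^sup>2 * circ_mean R (\<lambda>w. \<bar>Re (h w)\<bar>)"
proof -
  have R: "R > 0" using z norm_ge_zero[of z] by linarith
  have cont: "continuous_on (cball 0 R) h" by (rule holomorphic_on_imp_continuous_on[OF h])
  have hb: "h holomorphic_on ball 0 R" using h by (rule holomorphic_on_subset) auto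
  note C = Cauchy_derivative_integral_circlepath[OF cont hb, of z]
  have "((\<lambda>u. h u / (u - z)\<^sup>2) has_contour_integral (2 * of_real pi * \<i> * deriv h z)) (circlepath 0 R)"
    using has_contour_integral_integral[OF C(1)] DERIV_imp_deriv[OF C(2)] z by simp
  hence "((\<lambda>t. h (0 + R * cis t) / (0 + R * cis t - z)\<^sup>2 * R * \<i> * cis t) has_integral (2 * of_real pi * \<i> * deriv h z)) {0..2*pi}"
    unfolding circlepath_def by (subst (asm) has_contour_integral_part_circlepath_iff) auto
  hence "((\<lambda>t. -\<i> * (h (0 + R * cis t) / (0 + R * cis t - z)\<^sup>2 * R * \<i> * cis t)) has_integral (-\<i> * (2 * of_real pi * \<i> * deriv h z))) {0..2*pi}"
    by (rule has_integral_mult_right)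
  hence 1: "((\<lambda>t. h (R * cis t) * (R * cis t) / (R * cis t - z)\<^sup>2) has_integral (2 * of_real pi * deriv h z)) {0..2*pi}"
    by (rule has_integral_eq_rhs[OF has_integral_eq[rotated]]) (auto simp: mult_ac)
  \<comment> \<open>On the circle \<open>k w\<close> is \<open>h w\<close> times the conjugate of
    \<open>w / (w - z)^2\<close>; substituting \<open>R^2 / w\<close> for \<open>cnj w\<close> turns
    this into a holomorphic function on the disc. It vanishes at 0, so its circle mean is 0.\<close>
  define k where "k = (\<lambda>w. h w * (of_real (R\<^sup>2) * w) / (of_real (R\<^sup>2) - cnj z * w)\<^sup>2)"
  have nz: "of_real (R\<^sup>2) - cnj z * w \<noteq> 0" if "w \<in> cball 0 R" for w
    using blaschke_denom_nonzero[OF z] that by simp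
  have "k holomorphic_on cball 0 R"
    unfolding k_def using nz by (intro holomorphic_intros h) auto
  from circle_integral_mean_value[OF this R]
  have "((\<lambda>t. k (R * cis t)) has_integral 0) {0..2*pi}" by (simp add: k_def)
  hence "((\<lambda>t. cnj (k (R * cis t))) has_integral 0) {0..2*pi}"
    using has_integral_cnj[of "\<lambda>t. k (R * cis t)" 0] by (simp add: o_def)
  moreover have "cnj (k (R * cis t)) = cnj (h (R * cis t)) * (R * cis t) / (R * cis t - z)\<^sup>2" for t
  proof -
    define w where "w = R * cis t"
    have cw: "cmod w = R" using R by (simp add: w_def norm_mult)
    have wn: "cnj w \<noteq> 0" using cw R by auto
    have wz: "w - z \<noteq> 0" using cw z by auto
    have RR: "of_real (R\<^sup>2) = w * cnj w" using complex_norm_square[of w] unfolding cw .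
    have "of_real (R\<^sup>2) - z * cnj w = cnj w * (w - z)" unfolding RR by (simp add: algebra_simps)
    hence "cnj (k w) = cnj (h w) * (w * cnj w * cnj w) / (cnj w * (w - z))\<^sup>2"
      unfolding k_def RR by (simp add: mult_ac)
    also have "\<dots> = cnj (h w) * w / (w - z)\<^sup>2"
    proof -
      have "cnj (h w) * (w * cnj w * cnj w) / (cnj w * (w - z))\<^sup>2 =
        ((cnj w)\<^sup>2 * (cnj (h w) * w)) / ((cnj w)\<^sup>2 * (w - z)\<^sup>2)"
        by (simp add: power_mult_distrib) (simp add: power2_eq_square mult_ac)
      thus ?thesis using wn by simp
    qed
    finally show ?thesis by (simp add: w_def)
  qed
  ultimately have 2: "((\<lambda>t. cnj (h (R * cis t)) * (R * cis t) / (R * cis t - z)\<^sup>2) has_integral 0) {0..2*pi}"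
    by simp
  have 3: "((\<lambda>t. 2 * of_real (Re (h (R * cis t))) * (R * cis t) / (R * cis t - z)\<^sup>2) has_integral (2 * of_real pi * deriv h z)) {0..2*pi}"
    using has_integral_add[OF 1 2] complex_add_cnj
    by (simp flip: add_divide_distrib distrib_right add: complex_add_cnj)
  have csph: "continuous_on (sphere 0 R) (\<lambda>w. \<bar>Re (h w)\<bar>)"
    by (intro continuous_intros continuous_on_subset[OF cont]) auto
  have ci: "circ_int R (\<lambda>w. \<bar>Re (h w)\<bar>)" by (rule circ_int_continuous[OF csph R])
  have "cmod (2 * of_real pi * deriv h z) = cmod (integral {0..2*pi} (\<lambda>t. 2 * of_real (Re (h (R * cis t))) * (R * cis t) / (R * cis t - z)\<^sup>2))"
    using integral_unique[OF 3] by simp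
  also have "\<dots> \<le> integral {0..2*pi} (\<lambda>t. 2 * R / (R - cmod z)\<^sup>2 * \<bar>Re (h (R * cis t))\<bar>)"
  proof (rule integral_norm_bound_integral[OF has_integral_integrable[OF 3]])
    show "(\<lambda>t. 2 * R / (R - cmod z)\<^sup>2 * \<bar>Re (h (complex_of_real R * cis t))\<bar>) integrable_on {0..2 * pi}"
      by (rule circ_int_integrable[OF circ_int_cmult[OF ci]])
    fix t :: real
    have "R - cmod z \<le> cmod (R * cis t - z)"
      using norm_triangle_ineq2[of "R * cis t" z] R by (simp add: norm_mult)
    hence "(R - cmod z)\<^sup>2 \<le> (cmod (R * cis t - z))\<^sup>2" using z by (intro power_mono) auto
    moreover have pos: "0 < (R - cmod z)\<^sup>2" using z by simp
    moreover have "0 < (cmod (R * cis t - z))\<^sup>2" using less_le_trans[OF pos calculation(1)] .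
    ultimately have "2 * \<bar>Re (h (R * cis t))\<bar> * R / (cmod (R * cis t - z))\<^sup>2 \<le> 2 * \<bar>Re (h (R * cis t))\<bar> * R / (R - cmod z)\<^sup>2"
      using R by (intro divide_left_mono mult_nonneg_nonneg mult_pos_pos) auto
    thus "cmod (2 * of_real (Re (h (R * cis t))) * (R * cis t) / (R * cis t - z)\<^sup>2) \<le> 2 * R / (R - cmod z)\<^sup>2 * \<bar>Re (h (R * cis t))\<bar>"
      using R by (simp add: norm_mult norm_divide norm_power mult_ac)
  qed
  also have "\<dots> = 2 * pi * (2 * R / (R - cmod z)\<^sup>2 * circ_mean R (\<lambda>w. \<bar>Re (h w)\<bar>))"
    by (simp add: circ_mean_def)
  finally have "2 * pi * cmod (deriv h z) \<le> 2 * pi * (2 * R / (R - cmod z)\<^sup>2 * circ_mean R (\<lambda>w. \<bar>Re (h w)\<bar>))"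
    by (simp add: norm_mult)
  thus ?thesis by (rule mult_left_le_imp_le) simp
qed

section \<open>Exponential times Blaschke product\<close>

definition blaschke :: "real \<Rightarrow> complex \<Rightarrow> complex \<Rightarrow> complex" where
  "blaschke R a z = of_real R * (z - a) / (of_real (R\<^sup>2) - cnj a * z)"

lemma cmod_blaschke_circle:
  assumes "cmod z = R" "cmod a < R"
  shows "cmod (blaschke R a z) = 1"
proof -
  have R: "R > 0" using assms(2) norm_ge_zero[of a] by linarith
  have RR: "of_real (R\<^sup>2) = z * cnj z" using complex_norm_square[of z] unfolding assms(1) .
  have "of_real (R\<^sup>2) - cnj a * z = z * cnj (z - a)" unfolding RR by (simp add: algebra_simps)
  hence "cmod (of_real (R\<^sup>2) - cnj a * z) = R * cmod (z - a)"
    using assms(1) by (simp only: norm_mult complex_mod_cnj)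
  moreover have "z \<noteq> a" using assms by auto
  ultimately show ?thesis using R by (simp add: blaschke_def norm_divide norm_mult)
qed

text \<open>Moving the denominators of the Blaschke factors into the zero-free factor
  \<open>g\<close> leaves it zero-free, hence an exponential. As no zero or pole lies on the circle,
  those denominators do not vanish on the closed disc; the margin \<open>R' > R\<close> makes
  \<open>H\<close> available on the circle itself.\<close>

lemma meromorphic_disc_representation:
  assumes f: "f meromorphic_on UNIV" "\<not> (\<forall>\<^sub>\<approx>z. f z = 0)" and R: "R > 0"
    and gen: "\<And>z. cmod z = R \<Longrightarrow> zorder f z = 0"
  obtains R' H where "R' > R" "H holomorphic_on ball 0 R'"
    "\<forall>\<^sub>\<approx>z. cmod z < R' \<longrightarrow> f z = exp (H z) * (\<Prod>a\<in>div_set f R. blaschke R a z powi zorder f a)"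
proof -
  let ?D = "div_set f R"
  have fin: "finite ?D" by (rule finite_div_set[OF f])
  have Dlt: "cmod a < R" if "a \<in> ?D" for a using that gen by (force simp: div_set_def)
  obtain g where g: "g analytic_on cball 0 R" "\<And>z. z \<in> cball 0 R \<Longrightarrow> g z \<noteq> 0"
    "\<forall>\<^sub>\<approx>z. f z = g z * (\<Prod>a\<in>?D. (z - a) powi zorder f a)"
    by (rule meromorphic_factorization[OF f, of R]) blast
  from g(1) obtain S where S: "open S" "cball 0 R \<subseteq> S" "g holomorphic_on S"
    unfolding analytic_on_holomorphic by blast
  define d where "d = (\<lambda>a z. of_real (R\<^sup>2) - cnj a * z :: complex)"
  \<comment> \<open>\<open>p\<close> gathers everything that must not vanish. It is non-zero on the
    compact disc, hence on a slightly larger one.\<close>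
  define p where "p = (\<lambda>z. g z * (\<Prod>a\<in>?D. d a z))"
  have "continuous_on S p" unfolding p_def d_def
    by (intro continuous_intros holomorphic_on_imp_continuous_on S)
  hence "open (p -` (-{0}) \<inter> S)" using S(1) by (subst (asm) continuous_on_open_vimage) auto
  moreover have "cball 0 R \<subseteq> p -` (-{0}) \<inter> S"
    using S(2) g(2) fin Dlt blaschke_denom_nonzero by (auto simp: p_def d_def)
  ultimately obtain e where e: "e > 0" "(\<Union>x\<in>cball 0 R. ball x e) \<subseteq> p -` (-{0}) \<inter> S"
    using compact_subset_open_imp_ball_epsilon_subset[of "cball 0 R"] by (metis compact_cball)
  define R' where "R' = R + e"
  have "ball (0::complex) R' \<subseteq> (\<Union>x\<in>cball 0 R. ball x e)"
  proof (rule subsetI)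
    fix z :: complex assume z: "z \<in> ball 0 R'"
    show "z \<in> (\<Union>x\<in>cball 0 R. ball x e)"
    proof (cases "cmod z \<le> R")
      case True
      thus ?thesis using e(1) by (intro UN_I[of z]) auto
    next
      case False
      define x where "x = of_real (R / cmod z) * z"
      have "z - x = of_real (1 - R / cmod z) * z" by (simp add: x_def algebra_simps)
      hence "cmod (z - x) = \<bar>1 - R / cmod z\<bar> * cmod z" by (simp only: norm_mult norm_of_real)
      also have "\<dots> = cmod z - R" using False R by (auto simp: abs_if field_simps)
      finally have "cmod (z - x) < e" using z by (simp add: R'_def)
      moreover have "cmod x = R" using False R by (auto simp: x_def norm_mult norm_divide)
      ultimately show ?thesis by (intro UN_I[of x]) (auto simp: dist_norm norm_minus_commute)
    qed
  qed
  with e have sub: "ball 0 R' \<subseteq> p -` (-{0}) \<inter> S" by blast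
  have gnz: "g z \<noteq> 0" and dnz: "\<And>a. a \<in> ?D \<Longrightarrow> d a z \<noteq> 0" if "cmod z < R'" for z
  proof -
    have "p z \<noteq> 0" using sub that by auto
    thus "g z \<noteq> 0" "\<And>a. a \<in> ?D \<Longrightarrow> d a z \<noteq> 0" using fin by (auto simp: p_def)
  qed
  define k where "k = (\<lambda>z. g z * (\<Prod>a\<in>?D. (d a z / of_real R) powi zorder f a))"
  have kh: "k holomorphic_on ball 0 R'"
    unfolding k_def d_def
    by (intro holomorphic_intros holomorphic_on_subset[OF S(3)]) (use sub dnz R in \<open>auto simp: d_def\<close>)
  have knz: "k z \<noteq> 0" if "z \<in> ball 0 R'" for z
    using that gnz[of z] dnz[of z] fin R by (auto simp: k_def)
  have "0 \<in> ball (0::complex) R'" using R e(1) by (simp add: R'_def)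
  then obtain H where H: "H holomorphic_on ball 0 R'" "\<And>x. x \<in> ball 0 R' \<Longrightarrow> exp (H x) = k x"
    using holomorphic_logarithm_exists[OF convex_ball open_ball kh knz] by metis
  have "\<forall>\<^sub>\<approx>z. cmod z < R' \<longrightarrow> f z = exp (H z) * (\<Prod>a\<in>?D. blaschke R a z powi zorder f a)"
    using g(3)
  proof eventually_elim
    case (elim z)
    show ?case
    proof
      assume z: "cmod z < R'"
      have "exp (H z) * (\<Prod>a\<in>?D. blaschke R a z powi zorder f a) =
        g z * (\<Prod>a\<in>?D. (d a z / of_real R) powi zorder f a * blaschke R a z powi zorder f a)"
        using H(2)[of z] z by (simp add: k_def prod.distrib)
      also have "(\<Prod>a\<in>?D. (d a z / of_real R) powi zorder f a * blaschke R a z powi zorder f a) =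
         (\<Prod>a\<in>?D. (z - a) powi zorder f a)"
        using dnz[OF z] R
        by (intro prod.cong refl) (auto simp: blaschke_def d_def simp flip: power_int_mult_distrib)
      finally show "f z = exp (H z) * (\<Prod>a\<in>?D. blaschke R a z powi zorder f a)" using elim by simp
    qed
  qed
  thus ?thesis using H(1) e(1) that[of R' H] by (auto simp: R'_def)
qed

section \<open>Jensen's formula\<close>

definition jensen_weight :: "real \<Rightarrow> complex \<Rightarrow> real" where
  "jensen_weight r a = (if a = 0 then ln r else ln (r / cmod a))"

lemma jensen_weight_nonneg: "1 \<le> r \<Longrightarrow> cmod a \<le> r \<Longrightarrow> 0 \<le> jensen_weight r a"
  by (auto simp: jensen_weight_def intro!: ln_ge_zero)

lemma finite_poles:
  assumes "f meromorphic_on UNIV"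
  shows "finite {z. cmod z \<le> r \<and> is_pole f z}"
proof -
  have sp: "{z. is_pole f z} sparse_in UNIV"
    using meromorphic_on_imp_not_pole_cosparse[OF assms] by (simp add: eventually_cosparse)
  have "finite (cball 0 r \<inter> {z. is_pole f z})"
    by (rule sparse_in_compact_finite) (auto intro: sparse_in_subset[OF sp])
  thus ?thesis by (rule finite_subset[rotated]) auto
qed

text \<open>A pole \<open>a\<close> contributes the integral of \<open>dt / t\<close> from
  \<open>cmod a\<close> to \<open>r\<close>, and a pole at 0 the separate term with
  \<open>ln r\<close>; these are the two cases of \<open>jensen_weight\<close>. In this form
  \<open>nev_N\<close> can be compared with sums over the divisor.\<close>

lemma nev_N_eq:
  assumes f: "f meromorphic_on UNIV" and r: "r > 0"
  shows "nev_N f r = (\<Sum>a\<in>{z. cmod z \<le> r \<and> is_pole f z}. real (nat (- zorder f a)) * jensen_weight r a)"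
proof -
  define P where "P = {z. cmod z \<le> r \<and> is_pole f z}"
  have fin: "finite P" unfolding P_def by (rule finite_poles[OF f])
  define m where "m = (\<lambda>a. real (nat (- zorder f a)))"
  have n_eq: "real (nev_n f t) = (\<Sum>a\<in>P. if cmod a \<le> t then m a else 0)" if "t \<le> r" for t
  proof -
    have "real (nev_n f t) = (\<Sum>a\<in>{z. cmod z \<le> t \<and> is_pole f z}. m a)"
      by (simp add: nev_n_def m_def)
    also have "{z. cmod z \<le> t \<and> is_pole f z} = {a\<in>P. cmod a \<le> t}" using that by (auto simp: P_def)
    also have "(\<Sum>a\<in>{a\<in>P. cmod a \<le> t}. m a) = (\<Sum>a\<in>P. if cmod a \<le> t then m a else 0)"
      using fin by (simp add: sum.inter_filter)
    finally show ?thesis .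
  qed
  have n0: "real (nev_n f 0) = (\<Sum>a\<in>P. if a = 0 then m a else 0)"
    using n_eq[of 0] r by simp
  have diff: "real (nev_n f t) - real (nev_n f 0) = (\<Sum>a\<in>P-{0}. if cmod a \<le> t then m a else 0)"
    if "0 \<le> t" "t \<le> r" for t
  proof -
    have "real (nev_n f t) - real (nev_n f 0) =
      (\<Sum>a\<in>P. (if cmod a \<le> t then m a else 0) - (if a = 0 then m a else 0))"
      using that by (simp add: n_eq n0 sum_subtractf)
    also have "\<dots> = (\<Sum>a\<in>P-{0}. if cmod a \<le> t then m a else 0)"
      using fin that by (intro sum.mono_neutral_cong_right) auto
    finally show ?thesis .
  qed
  have I1: "((\<lambda>t. if t \<in> {cmod a..r} then m a / t else 0) has_integral (m a * jensen_weight r a)) {0..r}"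
    if a: "a \<in> P - {0}" for a
  proof -
    have pos: "0 < cmod a" "cmod a \<le> r" using a by (auto simp: P_def)
    have "((\<lambda>t. m a / t) has_integral (m a * ln r - m a * ln (cmod a))) {cmod a..r}"
    proof (rule fundamental_theorem_of_calculus[OF pos(2)])
      fix t assume "t \<in> {cmod a..r}"
      hence "t > 0" using less_le_trans[OF pos(1)] by auto
      hence "((\<lambda>t. m a * ln t) has_field_derivative m a / t) (at t within {cmod a..r})"
        by (auto intro!: derivative_eq_intros)
      thus "((\<lambda>t. m a * ln t) has_vector_derivative m a / t) (at t within {cmod a..r})"
        by (rule has_real_derivative_iff_has_vector_derivative[THEN iffD1])
    qed
    hence "((\<lambda>t. m a / t) has_integral (m a * jensen_weight r a)) {cmod a..r}"
      using pos r a by (simp add: jensen_weight_def ln_div right_diff_distrib)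
    thus ?thesis by (subst has_integral_restrict) (use pos in auto)
  qed
  have "((\<lambda>t. \<Sum>a\<in>P-{0}. if t \<in> {cmod a..r} then m a / t else 0) has_integral (\<Sum>a\<in>P-{0}. m a * jensen_weight r a)) {0..r}"
    using fin I1 by (intro has_integral_sum) auto
  hence "((\<lambda>t. (real (nev_n f t) - real (nev_n f 0)) / t) has_integral (\<Sum>a\<in>P-{0}. m a * jensen_weight r a)) {0..r}"
  proof (rule has_integral_eq[rotated])
    fix t assume t: "t \<in> {0..r}"
    show "(\<Sum>a\<in>P-{0}. if t \<in> {cmod a..r} then m a / t else 0) = (real (nev_n f t) - real (nev_n f 0)) / t"
      using t by (simp add: diff sum_divide_distrib) (intro sum.cong refl, auto)
  qed
  hence "nev_N f r = (\<Sum>a\<in>P-{0}. m a * jensen_weight r a) + (\<Sum>a\<in>P. if a = 0 then m a else 0) * ln r"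
    by (simp add: nev_N_def integral_unique n0)
  also have "(\<Sum>a\<in>P. if a = 0 then m a else 0) * ln r = (\<Sum>a\<in>P. if a = 0 then m a * jensen_weight r a else 0)"
    unfolding sum_distrib_right by (intro sum.cong refl) (auto simp: jensen_weight_def)
  also have "(\<Sum>a\<in>P-{0}. m a * jensen_weight r a) = (\<Sum>a\<in>P. if a = 0 then 0 else m a * jensen_weight r a)"
    using fin by (intro sum.mono_neutral_cong_left) auto
  finally have "nev_N f r = (\<Sum>a\<in>P. (if a = 0 then 0 else m a * jensen_weight r a) +
      (if a = 0 then m a * jensen_weight r a else 0))"
    by (simp only: sum.distrib)
  also have "\<dots> = (\<Sum>a\<in>P. m a * jensen_weight r a)" by (intro sum.cong) auto
  finally show ?thesis by (simp add: P_def m_def)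
qed

lemma nev_N_nonneg: "f meromorphic_on UNIV \<Longrightarrow> 1 \<le> r \<Longrightarrow> 0 \<le> nev_N f r"
  by (auto simp: nev_N_eq intro!: sum_nonneg mult_nonneg_nonneg jensen_weight_nonneg)

lemma nev_T_nonneg: "f meromorphic_on UNIV \<Longrightarrow> 1 \<le> r \<Longrightarrow> 0 \<le> nev_T f r"
  unfolding nev_T_def by (intro add_nonneg_nonneg nev_m_nonneg nev_N_nonneg)

lemma nev_m_le_T: "f meromorphic_on UNIV \<Longrightarrow> 1 \<le> r \<Longrightarrow> nev_m f r \<le> nev_T f r"
  unfolding nev_T_def using nev_N_nonneg[of f r] by simp

text \<open>Poles with \<open>0 < cmod a < 1\<close> weigh more than \<open>ln r\<close>. There are
  finitely many of them, and \<open>K\<close> absorbs the excess.\<close>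

lemma nev_N_le_n:
  assumes f: "f meromorphic_on UNIV"
  obtains K where "K \<ge> 0" "\<And>r. 1 \<le> r \<Longrightarrow> nev_N f r \<le> real (nev_n f r) * (ln r + K)"
proof -
  define P1 where "P1 = {z. cmod z \<le> 1 \<and> is_pole f z}"
  have fin: "finite P1" unfolding P1_def by (rule finite_poles[OF f])
  define K where "K = (\<Sum>a\<in>P1. \<bar>ln (cmod a)\<bar>)"
  have K0: "K \<ge> 0" by (simp add: K_def sum_nonneg)
  have "nev_N f r \<le> real (nev_n f r) * (ln r + K)" if r: "1 \<le> r" for r
  proof -
    have w: "jensen_weight r a \<le> ln r + K" if a: "cmod a \<le> r" "is_pole f a" for a
    proof (cases "a = 0")
      case False
      have "- ln (cmod a) \<le> K"
      proof (cases "cmod a \<le> 1")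
        case True
        hence "\<bar>ln (cmod a)\<bar> \<le> K" unfolding K_def using a fin by (intro member_le_sum) (auto simp: P1_def)
        thus ?thesis by linarith
      next
        case F: False
        hence "0 \<le> ln (cmod a)" by simp
        thus ?thesis using K0 by linarith
      qed
      thus ?thesis using False r by (simp add: jensen_weight_def ln_div)
    qed (use K0 in \<open>simp add: jensen_weight_def\<close>)
    have "nev_N f r \<le> (\<Sum>a\<in>{z. cmod z \<le> r \<and> is_pole f z}. real (nat (- zorder f a)) * (ln r + K))"
      unfolding nev_N_eq[OF f less_le_trans[OF zero_less_one r]]
      by (intro sum_mono mult_left_mono w) auto
    thus ?thesis by (simp add: nev_n_def sum_distrib_right)
  qed
  thus ?thesis using that K0 by blast
qed

text \<open>This is the disc representation read at the origin, where a Blaschke factor has modulus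
  \<open>cmod a / R\<close>. Since 0 may itself be a zero or pole, the first non-zero Laurent
  coefficient \<open>zor_poly f 0 0\<close> replaces the value of \<open>f\<close>.\<close>

lemma Jensen_leading_coeff:
  assumes f: "f meromorphic_on UNIV" "\<not> (\<forall>\<^sub>\<approx>z. f z = 0)" and R: "R > 0" "R' > R"
    and gen: "\<And>z. cmod z = R \<Longrightarrow> zorder f z = 0"
    and H: "H holomorphic_on ball 0 R'"
    and rep: "\<forall>\<^sub>\<approx>z. cmod z < R' \<longrightarrow> f z = exp (H z) * (\<Prod>a\<in>div_set f R. blaschke R a z powi zorder f a)"
  shows "Re (H 0) = ln (cmod (zor_poly f 0 0)) + (\<Sum>a\<in>div_set f R. of_int (zorder f a) * jensen_weight R a)"
proof -
  let ?D = "div_set f R" and ?n = "zorder f 0"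
  have fin: "finite ?D" by (rule finite_div_set[OF f])
  have Dlt: "cmod a < R" if "a \<in> ?D" for a using that gen by (force simp: div_set_def)
  have m0: "isolated_singularity_at f 0" "not_essential f 0"
    using f(1) meromorphic_on_subset[of f UNIV "{0}"] by (auto simp: meromorphic_at_iff)
  obtain r where r: "r > 0" "zor_poly f 0 0 \<noteq> 0" "zor_poly f 0 holomorphic_on cball 0 r"
    "\<And>w. w \<in> cball 0 r - {0} \<Longrightarrow> f w = zor_poly f 0 w * (w - 0) powi ?n"
    using zorder_exist[OF m0 meromorphic_nonzero_at(2)[OF f]] by blast
  \<comment> \<open>The representation divided by the power of \<open>z\<close> at the origin: the
    Blaschke factor of the point 0 is \<open>z / R\<close>, of which only \<open>1 / R\<close>
    remains. Thus \<open>Q\<close> is continuous at 0 and can be evaluated there.\<close>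
  define Q where "Q = (\<lambda>z. exp (H z) * (1 / of_real R) powi ?n * (\<Prod>a\<in>?D-{0}. blaschke R a z powi zorder f a))"
  have "\<forall>\<^sub>F z::complex in at 0. z \<in> ball 0 r - {0} \<and> z \<in> ball 0 R'"
    using r(1) R eventually_at_in_open[of "ball 0 r" "0::complex"] eventually_at_in_open'[of "ball 0 R'" "0::complex"]
    by (intro eventually_conj) auto
  moreover have "\<forall>\<^sub>F z in at 0. cmod z < R' \<longrightarrow>
      f z = exp (H z) * (\<Prod>a\<in>?D. blaschke R a z powi zorder f a)"
    by (rule eventually_cosparse_imp_eventually_at[OF rep]) auto
  ultimately have ev: "\<forall>\<^sub>F z in at 0. zor_poly f 0 z = Q z"
  proof eventually_elim
    case (elim z)
    have z0: "z \<noteq> 0" using elim by auto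
    have "(\<Prod>a\<in>?D. blaschke R a z powi zorder f a) = (z / of_real R) powi ?n * (\<Prod>a\<in>?D-{0}. blaschke R a z powi zorder f a)"
    proof (cases "0 \<in> ?D")
      case True
      thus ?thesis using fin R by (subst prod.remove[of _ 0]) (auto simp: blaschke_def power2_eq_square)
    next
      case False
      hence "?n = 0" using R by (auto simp: div_set_def)
      thus ?thesis using False by simp
    qed
    hence "zor_poly f 0 z * z powi ?n = Q z * z powi ?n"
      using elim r(4)[of z] by (simp add: Q_def power_int_mult_distrib power_int_divide_distrib)
    thus ?case using z0 by simp
  qed
  have "isCont (zor_poly f 0) 0"
    using holomorphic_on_imp_continuous_on[OF r(3)] r(1)
    by (auto simp: continuous_on_interior)
  moreover have "isCont Q 0"
  proof -
    have "isCont H 0" using holomorphic_on_imp_continuous_on[OF H] R by (auto simp: continuous_on_interior)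
    thus ?thesis unfolding Q_def blaschke_def using R by (intro continuous_intros) auto
  qed
  ultimately have lims: "zor_poly f 0 \<midarrow>0\<rightarrow> zor_poly f 0 0" "Q \<midarrow>0\<rightarrow> Q 0"
    by (auto simp: isCont_def)
  have "zor_poly f 0 \<midarrow>0\<rightarrow> Q 0" using lims(2) by (simp add: tendsto_cong[OF ev])
  from tendsto_unique[OF _ lims(1) this] have "zor_poly f 0 0 = Q 0" by simp
  moreover have bl0: "cmod (blaschke R a 0) = cmod a / R" for a
    using R by (simp add: blaschke_def norm_divide norm_mult norm_power power2_eq_square)
  moreover have "blaschke R a 0 \<noteq> 0" if "a \<in> ?D - {0}" for a using that R by (auto simp: blaschke_def)
  ultimately have "ln (cmod (zor_poly f 0 0)) = Re (H 0) + of_int ?n * ln (1 / R) + (\<Sum>a\<in>?D-{0}. of_int (zorder f a) * ln (cmod a / R))"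
  proof -
    assume a: "zor_poly f 0 0 = Q 0" "\<And>a. cmod (blaschke R a 0) = cmod a / R"
      "\<And>a. a \<in> ?D - {0} \<Longrightarrow> blaschke R a 0 \<noteq> 0"
    have "cmod (Q 0) = exp (Re (H 0)) * (1 / R) powi ?n * cmod (\<Prod>a\<in>?D-{0}. blaschke R a 0 powi zorder f a)"
      using R by (simp add: Q_def norm_mult norm_power_int norm_divide)
    hence "ln (cmod (Q 0)) = Re (H 0) + ln ((1 / R) powi ?n) + ln (cmod (\<Prod>a\<in>?D-{0}. blaschke R a 0 powi zorder f a))"
      using R a(3) fin by (simp add: ln_mult)
    also have "ln ((1 / R) powi ?n) = of_int ?n * ln (1 / R)"
      using R by (simp add: ln_powr flip: powr_real_of_int')
    also have "ln (cmod (\<Prod>a\<in>?D-{0}. blaschke R a 0 powi zorder f a)) = (\<Sum>a\<in>?D-{0}. of_int (zorder f a) * ln (cmod a / R))"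
      using fin a(3) by (subst ln_norm_prod_powi) (auto simp: a(2))
    finally show ?thesis using a(1) by simp
  qed
  moreover have "(\<Sum>a\<in>?D. of_int (zorder f a) * jensen_weight R a) =
     of_int ?n * ln R + (\<Sum>a\<in>?D-{0}. of_int (zorder f a) * ln (R / cmod a))"
  proof (cases "0 \<in> ?D")
    case True
    have "(\<Sum>a\<in>?D-{0}. of_int (zorder f a) * jensen_weight R a) = (\<Sum>a\<in>?D-{0}. of_int (zorder f a) * ln (R / cmod a))"
      by (intro sum.cong refl) (auto simp: jensen_weight_def)
    thus ?thesis using True fin by (subst sum.remove[of _ 0]) (auto simp: jensen_weight_def)
  next
    case False
    hence n: "?n = 0" using R by (auto simp: div_set_def)
    have D: "?D - {0} = ?D" using False by auto
    show ?thesis unfolding D n using False by (auto simp: jensen_weight_def intro!: sum.cong)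
  qed
  moreover have "(\<Sum>a\<in>?D-{0}. of_int (zorder f a) * ln (cmod a / R)) = - (\<Sum>a\<in>?D-{0}. of_int (zorder f a) * ln (R / cmod a))"
    unfolding sum_negf[symmetric] using R by (intro sum.cong refl) (auto simp: ln_div algebra_simps)
  ultimately show "Re (H 0) = ln (cmod (zor_poly f 0 0)) + (\<Sum>a\<in>?D. of_int (zorder f a) * jensen_weight R a)"
    using R by (simp add: ln_div)
qed

text \<open>Adding twice the pole part to Jensen's formula makes all multiplicities positive: the
  weighted count plus \<open>m(r, 1/f)\<close> equals \<open>m(r, f) + 2 N(r, f)\<close> up to a
  constant. Both terms on the left are non-negative, so each is at most \<open>2 T\<close> plus a
  constant. On the circle \<open>Re H = ln |f|\<close>, whence the mean of its absolute value is
  \<open>m(r, f) + m(r, 1/f)\<close>, at most \<open>3 T\<close> plus a constant.\<close>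

lemma Jensen_bound:
  assumes f: "f meromorphic_on UNIV" "\<not> (\<forall>\<^sub>\<approx>z. f z = 0)"
  obtains C where "C \<ge> 0"
    "\<And>R. 1 \<le> R \<Longrightarrow> (\<And>z. cmod z = R \<Longrightarrow> zorder f z = 0) \<Longrightarrow>
      (\<Sum>a\<in>div_set f R. \<bar>of_int (zorder f a)\<bar> * jensen_weight R a) \<le> 2 * nev_T f R + C \<and>
      (\<exists>H. H holomorphic_on cball 0 R \<and>
        (\<forall>\<^sub>\<approx>z. cmod z < R \<longrightarrow> f z = exp (H z) * (\<Prod>a\<in>div_set f R. blaschke R a z powi zorder f a)) \<and>
        circ_mean R (\<lambda>z. \<bar>Re (H z)\<bar>) \<le> 3 * nev_T f R + C)"
proof -
  define C where "C = \<bar>ln (cmod (zor_poly f 0 0))\<bar>"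
  have main: "(\<Sum>a\<in>div_set f R. \<bar>of_int (zorder f a)\<bar> * jensen_weight R a) \<le> 2 * nev_T f R + C \<and>
      (\<exists>H. H holomorphic_on cball 0 R \<and>
        (\<forall>\<^sub>\<approx>z. cmod z < R \<longrightarrow> f z = exp (H z) * (\<Prod>a\<in>div_set f R. blaschke R a z powi zorder f a)) \<and>
        circ_mean R (\<lambda>z. \<bar>Re (H z)\<bar>) \<le> 3 * nev_T f R + C)"
    if R: "1 \<le> R" and gen: "\<And>z. cmod z = R \<Longrightarrow> zorder f z = 0" for R
  proof -
    let ?D = "div_set f R"
    have R0: "R > 0" using R by simp
    have fin: "finite ?D" by (rule finite_div_set[OF f])
    have Dlt: "cmod a < R" if "a \<in> ?D" for a using that gen by (force simp: div_set_def)
    obtain R' H where H: "R' > R" "H holomorphic_on ball 0 R'"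
      "\<forall>\<^sub>\<approx>z. cmod z < R' \<longrightarrow> f z = exp (H z) * (\<Prod>a\<in>?D. blaschke R a z powi zorder f a)"
      by (rule meromorphic_disc_representation[OF f R0 gen])
    have Hc: "H holomorphic_on cball 0 R" using H(1) by (intro holomorphic_on_subset[OF H(2)]) auto
    have fi: "(\<lambda>z. 1 / f z) meromorphic_on UNIV" using f(1) by (intro meromorphic_intros)
    have lnf: "\<forall>\<^sub>\<approx>z. cmod z = R \<longrightarrow> Re (H z) = ln (cmod (f z))"
      using H(3)
    proof eventually_elim
      case (elim z)
      show ?case
      proof
        assume z: "cmod z = R"
        have "cmod (f z) = exp (Re (H z)) * (\<Prod>a\<in>?D. cmod (blaschke R a z) powi zorder f a)"
          using elim z H(1) by (simp add: norm_mult norm_power_int flip: prod_norm)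
        also have "(\<Prod>a\<in>?D. cmod (blaschke R a z) powi zorder f a) = 1"
          using z Dlt by (intro prod.neutral) (simp add: cmod_blaschke_circle)
        finally show "Re (H z) = ln (cmod (f z))" by simp
      qed
    qed
    note ci = circ_int_nev_m[OF f(1) R] circ_int_nev_m[OF fi R]
    have "Re (H 0) = circ_mean R (\<lambda>z. logp (cmod (f z)) - logp (cmod (1 / f z)))"
      unfolding circ_mean_Re[OF Hc R0, symmetric]
      by (intro circ_mean_cong) (use lnf R0 in \<open>auto simp: ln_eq_logp_diff norm_divide elim!: eventually_mono\<close>)
    hence mm: "Re (H 0) = nev_m f R - nev_m (\<lambda>z. 1 / f z) R"
      using ci by (simp add: circ_mean_diff nev_m_eq)
    have "circ_mean R (\<lambda>z. \<bar>Re (H z)\<bar>) = circ_mean R (\<lambda>z. logp (cmod (f z)) + logp (cmod (1 / f z)))"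
      by (intro circ_mean_cong) (use lnf R0 in \<open>auto simp: abs_ln_eq norm_divide elim!: eventually_mono\<close>)
    hence mabs: "circ_mean R (\<lambda>z. \<bar>Re (H z)\<bar>) = nev_m f R + nev_m (\<lambda>z. 1 / f z) R"
      using ci by (simp add: circ_mean_add nev_m_eq)
    have lead: "Re (H 0) = ln (cmod (zor_poly f 0 0)) + (\<Sum>a\<in>?D. of_int (zorder f a) * jensen_weight R a)"
      by (rule Jensen_leading_coeff[OF f R0 H(1) gen H(2,3)])
    have "nev_N f R = (\<Sum>a\<in>{z. cmod z \<le> R \<and> is_pole f z}. real (nat (- zorder f a)) * jensen_weight R a)"
      by (rule nev_N_eq[OF f(1) R0])
    also have "\<dots> = (\<Sum>a\<in>?D. real (nat (- zorder f a)) * jensen_weight R a)"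
      using fin by (intro sum.mono_neutral_left) (auto simp: div_set_def is_pole_iff_zorder[OF f])
    finally have N: "nev_N f R = (\<Sum>a\<in>?D. real (nat (- zorder f a)) * jensen_weight R a)" .
    have "(\<Sum>a\<in>?D. \<bar>of_int (zorder f a)\<bar> * jensen_weight R a) =
        (\<Sum>a\<in>?D. of_int (zorder f a) * jensen_weight R a + 2 * (real (nat (- zorder f a)) * jensen_weight R a))"
    proof (intro sum.cong refl)
      fix a
      have "\<bar>real_of_int (zorder f a)\<bar> = of_int (zorder f a) + 2 * real (nat (- zorder f a))" by auto
      thus "\<bar>of_int (zorder f a)\<bar> * jensen_weight R a = of_int (zorder f a) * jensen_weight R a + 2 * (real (nat (- zorder f a)) * jensen_weight R a)"
        by (simp only:) (simp add: algebra_simps)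
    qed
    also have "\<dots> = (\<Sum>a\<in>?D. of_int (zorder f a) * jensen_weight R a) + 2 * nev_N f R"
      by (simp add: sum.distrib N sum_distrib_left)
    finally have S: "(\<Sum>a\<in>?D. \<bar>of_int (zorder f a)\<bar> * jensen_weight R a) + nev_m (\<lambda>z. 1 / f z) R =
        nev_m f R + 2 * nev_N f R - ln (cmod (zor_poly f 0 0))"
      using lead mm by simp
    have S0: "0 \<le> (\<Sum>a\<in>?D. \<bar>of_int (zorder f a)\<bar> * jensen_weight R a)"
      using R by (intro sum_nonneg mult_nonneg_nonneg jensen_weight_nonneg) (auto simp: div_set_def)
    have T: "nev_m f R + nev_N f R = nev_T f R" by (simp add: nev_T_def)
    have "0 \<le> nev_m f R" "0 \<le> nev_m (\<lambda>z. 1 / f z) R" "0 \<le> nev_N f R"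
      using nev_m_nonneg nev_N_nonneg[OF f(1) R] by auto
    moreover have "- ln (cmod (zor_poly f 0 0)) \<le> C" unfolding C_def by linarith
    ultimately have "(\<Sum>a\<in>?D. \<bar>of_int (zorder f a)\<bar> * jensen_weight R a) \<le> 2 * nev_T f R + C"
       "circ_mean R (\<lambda>z. \<bar>Re (H z)\<bar>) \<le> 3 * nev_T f R + C"
      using S S0 T mabs by linarith+
    moreover have "\<forall>\<^sub>\<approx>z. cmod z < R \<longrightarrow> f z = exp (H z) * (\<Prod>a\<in>?D. blaschke R a z powi zorder f a)"
      using H(3) by eventually_elim (use H(1) in auto)
    ultimately show ?thesis using Hc by blast
  qed
  show ?thesis by (rule that[of C]) (use main in \<open>auto simp: C_def\<close>)
qed

section \<open>Zeros, poles and the exponential factor for polylogarithmic growth\<close>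

lemma generic_radius:
  assumes f: "f meromorphic_on UNIV" "\<not> (\<forall>\<^sub>\<approx>z. f z = 0)" and pq: "p < q"
  obtains R where "p < R" "R < q" "\<And>z. cmod z = R \<Longrightarrow> zorder f z = 0"
proof -
  have "infinite ({p<..<q} - cmod ` div_set f q)"
    using finite_div_set[OF f] pq by (intro Diff_infinite_finite) auto
  then obtain R where "R \<in> {p<..<q} - cmod ` div_set f q" using infinite_imp_nonempty by blast
  thus ?thesis by (intro that[of R]) (auto simp: div_set_def)
qed

lemma powr_cube_ln_le:
  fixes r R s :: real
  assumes "1 \<le> r" "r\<^sup>2 < R" "R < r ^ 3" "0 \<le> s"
  shows "(ln R) powr s \<le> 3 powr s * (ln r) powr s"
proof -
  have r0: "0 < r\<^sup>2" using assms(1) by simp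
  have "ln R \<le> ln (r ^ 3)" using assms r0 less_trans[OF r0 assms(2)] by (subst ln_le_cancel_iff) auto
  hence le: "ln R \<le> 3 * ln r" using assms by (simp add: ln_realpow)
  have "1 \<le> r\<^sup>2" using assms(1) by simp
  hence "0 \<le> ln R" using assms(2) by (intro ln_ge_zero) linarith
  hence "(ln R) powr s \<le> (3 * ln r) powr s" using le assms(4) by (intro powr_mono2) auto
  also have "\<dots> = 3 powr s * (ln r) powr s" using assms(1) by (intro powr_mult)
  finally show ?thesis .
qed

text \<open>The exponent drops by one because Jensen's formula is used at a radius beyond
  \<open>r ^ 2\<close>: every point with \<open>cmod a \<le> r\<close> then has weight at least
  \<open>ln r\<close>, so the number of points times \<open>ln r\<close> is still bounded by the
  characteristic.\<close>

lemma divisor_count_bound: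
  assumes f: "f meromorphic_on UNIV" "\<not> (\<forall>\<^sub>\<approx>z. f z = 0)" and s: "1 \<le> s"
    and T: "\<forall>\<^sub>F r in at_top. nev_T f r \<le> (ln r) powr s"
  obtains C where "C \<ge> 0"
    "\<forall>\<^sub>F r in at_top. (\<Sum>a\<in>div_set f r. \<bar>real_of_int (zorder f a)\<bar>) \<le> C * (ln r) powr (s - 1)"
proof -
  obtain K where K: "K \<ge> 0" "\<And>R. 1 \<le> R \<Longrightarrow> (\<And>z. cmod z = R \<Longrightarrow> zorder f z = 0) \<Longrightarrow>
      (\<Sum>a\<in>div_set f R. \<bar>of_int (zorder f a)\<bar> * jensen_weight R a) \<le> 2 * nev_T f R + K"
    by (rule Jensen_bound[OF f]) blast
  obtain r0 where r0: "\<And>r. r \<ge> r0 \<Longrightarrow> nev_T f r \<le> (ln r) powr s"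
    using T unfolding eventually_at_top_linorder by blast
  define C where "C = 2 * 3 powr s + K"
  have "(\<Sum>a\<in>div_set f r. \<bar>real_of_int (zorder f a)\<bar>) \<le> C * (ln r) powr (s - 1)" if r: "r \<ge> max r0 3" for r
  proof -
    have r3: "r \<ge> 3" "r \<ge> r0" using r by auto
    have "1 = ln (exp 1 :: real)" by simp
    also have "\<dots> \<le> ln r" using exp_le r3 by (subst ln_le_cancel_iff) auto
    finally have ln1: "1 \<le> ln r" .
    have "r\<^sup>2 < r ^ 3" using r3 by (intro power_strict_increasing) auto
    from generic_radius[OF f this] obtain R where R: "r\<^sup>2 < R" "R < r ^ 3" "\<And>z. cmod z = R \<Longrightarrow> zorder f z = 0"
      by blast
    have rr: "r \<le> r\<^sup>2" using r3 by (simp add: power2_eq_square)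
    hence Rr: "r < R" using R by linarith
    have R1: "1 \<le> R" using Rr r3 by linarith
    have sub: "div_set f r \<subseteq> div_set f R" using Rr by (auto simp: div_set_def)
    have w: "ln r \<le> jensen_weight R a" if "a \<in> div_set f r" for a
    proof (cases "a = 0")
      case True
      thus ?thesis using Rr r3 by (simp add: jensen_weight_def)
    next
      case False
      have "r * cmod a \<le> r * r" using that r3 by (intro mult_left_mono) (auto simp: div_set_def)
      also have "\<dots> \<le> R" using R(1) by (simp add: power2_eq_square)
      finally have "r \<le> R / cmod a" using False by (simp add: field_simps)
      thus ?thesis using False r3 by (simp add: jensen_weight_def)
    qed
    have "(\<Sum>a\<in>div_set f r. \<bar>real_of_int (zorder f a)\<bar>) * ln r \<le> (\<Sum>a\<in>div_set f r. \<bar>of_int (zorder f a)\<bar> * jensen_weight R a)"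
      unfolding sum_distrib_right using w by (intro sum_mono mult_left_mono) auto
    also have "\<dots> \<le> (\<Sum>a\<in>div_set f R. \<bar>of_int (zorder f a)\<bar> * jensen_weight R a)"
      using sub R1 by (intro sum_mono2 finite_div_set[OF f] mult_nonneg_nonneg jensen_weight_nonneg) (auto simp: div_set_def)
    also have "\<dots> \<le> 2 * nev_T f R + K" by (rule K(2)[OF R1 R(3)])
    also have "nev_T f R \<le> (ln R) powr s" using Rr r3 by (intro r0) simp
    also have "(ln R) powr s \<le> 3 powr s * (ln r) powr s"
      using r3 R s by (intro powr_cube_ln_le) auto
    finally have 1: "(\<Sum>a\<in>div_set f r. \<bar>real_of_int (zorder f a)\<bar>) * ln r \<le> 2 * (3 powr s * (ln r) powr s) + K"
      by simp
    have "K * 1 \<le> K * (ln r) powr s" using ln1 s K(1) by (intro mult_left_mono ge_one_powr_ge_zero) auto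
    with 1 have "(\<Sum>a\<in>div_set f r. \<bar>real_of_int (zorder f a)\<bar>) * ln r \<le> C * (ln r) powr s"
      by (simp add: C_def algebra_simps)
    also have "\<dots> = C * (ln r) powr (s - 1) * ln r" using ln1 by (simp add: powr_diff)
    finally show ?thesis using ln1 by simp
  qed
  hence "\<forall>\<^sub>F r in at_top. (\<Sum>a\<in>div_set f r. \<bar>real_of_int (zorder f a)\<bar>) \<le> C * (ln r) powr (s - 1)"
    unfolding eventually_at_top_linorder by blast
  thus ?thesis using that[of C] K(1) by (simp add: C_def)
qed

text \<open>The radius \<open>\<rho>\<close> may be as large as \<open>r\<^sup>3\<close>, since \<open>log r\<^sup>3 = 3 log r\<close> only costs a constant; being
  much larger than \<open>r\<close>, it makes the derivative of \<open>H\<close> tiny.\<close>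
lemma eventual_disc_representation:
  assumes f: "f meromorphic_on UNIV" "\<not> (\<forall>\<^sub>\<approx>z. f z = 0)" and s: "1 \<le> s"
    and T: "\<forall>\<^sub>F r in at_top. nev_T f r \<le> (ln r) powr s"
  obtains C where "C \<ge> 0"
    "\<forall>\<^sub>F r in at_top. \<exists>\<rho> H. r\<^sup>2 < \<rho> \<and> \<rho> < r ^ 3 \<and> (\<forall>z. cmod z = \<rho> \<longrightarrow> zorder f z = 0) \<and>
       H holomorphic_on ball 0 \<rho> \<and>
       (\<forall>\<^sub>\<approx>z. cmod z < \<rho> \<longrightarrow> f z = exp (H z) * (\<Prod>a\<in>div_set f \<rho>. blaschke \<rho> a z powi zorder f a)) \<and>
       (\<Sum>a\<in>div_set f \<rho>. \<bar>real_of_int (zorder f a)\<bar>) \<le> C * (ln r) powr (s - 1) \<and>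
       \<bar>Re (H 0)\<bar> \<le> C * (ln r) powr s \<and>
       (\<forall>z. cmod z \<le> \<rho> / 2 \<longrightarrow> cmod (deriv H z) \<le> 1 / r)"
proof -
  obtain K where K: "K \<ge> 0" "\<And>R. 1 \<le> R \<Longrightarrow> (\<And>z. cmod z = R \<Longrightarrow> zorder f z = 0) \<Longrightarrow>
      (\<exists>H. H holomorphic_on cball 0 R \<and>
        (\<forall>\<^sub>\<approx>z. cmod z < R \<longrightarrow> f z = exp (H z) * (\<Prod>a\<in>div_set f R. blaschke R a z powi zorder f a)) \<and>
        circ_mean R (\<lambda>z. \<bar>Re (H z)\<bar>) \<le> 3 * nev_T f R + K)"
    by (rule Jensen_bound[OF f]) blast
  obtain r0 where r0: "\<And>r. r \<ge> r0 \<Longrightarrow> nev_T f r \<le> (ln r) powr s"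
    using T unfolding eventually_at_top_linorder by blast
  obtain C1 where C1: "C1 \<ge> 0" "\<forall>\<^sub>F r in at_top. (\<Sum>a\<in>div_set f r. \<bar>real_of_int (zorder f a)\<bar>) \<le> C1 * (ln r) powr (s - 1)"
    by (rule divisor_count_bound[OF f s T])
  obtain r1 where r1: "\<And>r. r \<ge> r1 \<Longrightarrow> (\<Sum>a\<in>div_set f r. \<bar>real_of_int (zorder f a)\<bar>) \<le> C1 * (ln r) powr (s - 1)"
    using C1(2) unfolding eventually_at_top_linorder by blast
  define C2 where "C2 = 3 * 3 powr s + K"
  define C where "C = max C2 (C1 * 3 powr (s - 1))"
  have "C2 \<ge> 0" using K by (simp add: C2_def)
  hence C0: "C \<ge> 0" by (simp add: C_def)
  \<comment> \<open>For \<open>cmod z \<le> R / 2\<close> the kernel of the Schwarz formula is at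
    most \<open>2 * R / (R / 2)^2 = 8 / R\<close>. Once \<open>8 * M \<le> r\<close>, the derivative
    is at most \<open>r / R\<close>, which is below \<open>1 / r\<close> since
    \<open>R > r ^ 2\<close>.\<close>
  have "\<forall>\<^sub>F r in at_top. 8 * C2 * (ln r) powr s \<le> r" by real_asymp
  hence ev: "\<forall>\<^sub>F r in at_top. r \<ge> max (max r0 r1) 3 \<and> 8 * C2 * (ln r) powr s \<le> r"
    by (intro eventually_conj eventually_ge_at_top)
  hence "\<forall>\<^sub>F r in at_top. \<exists>\<rho> H. r\<^sup>2 < \<rho> \<and> \<rho> < r ^ 3 \<and> (\<forall>z. cmod z = \<rho> \<longrightarrow> zorder f z = 0) \<and>
       H holomorphic_on ball 0 \<rho> \<and>
       (\<forall>\<^sub>\<approx>z. cmod z < \<rho> \<longrightarrow> f z = exp (H z) * (\<Prod>a\<in>div_set f \<rho>. blaschke \<rho> a z powi zorder f a)) \<and>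
       (\<Sum>a\<in>div_set f \<rho>. \<bar>real_of_int (zorder f a)\<bar>) \<le> C * (ln r) powr (s - 1) \<and>
       \<bar>Re (H 0)\<bar> \<le> C * (ln r) powr s \<and>
       (\<forall>z. cmod z \<le> \<rho> / 2 \<longrightarrow> cmod (deriv H z) \<le> 1 / r)"
  proof eventually_elim
    case (elim r)
    have r3: "r \<ge> 3" "r \<ge> r0" "r \<ge> r1" using elim by auto
    have "1 = ln (exp 1 :: real)" by simp
    also have "\<dots> \<le> ln r" using exp_le r3 by (subst ln_le_cancel_iff) auto
    finally have ln1: "1 \<le> ln r" .
    have "r\<^sup>2 < r ^ 3" using r3 by (intro power_strict_increasing) auto
    from generic_radius[OF f this] obtain R where R: "r\<^sup>2 < R" "R < r ^ 3" "\<And>z. cmod z = R \<Longrightarrow> zorder f z = 0"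
      by blast
    have rr: "r \<le> r\<^sup>2" using r3 by (simp add: power2_eq_square)
    hence Rr: "r < R" using R by linarith
    have R1: "1 \<le> R" using Rr r3 by linarith
    obtain H where H: "H holomorphic_on cball 0 R"
        "\<forall>\<^sub>\<approx>z. cmod z < R \<longrightarrow> f z = exp (H z) * (\<Prod>a\<in>div_set f R. blaschke R a z powi zorder f a)"
        "circ_mean R (\<lambda>z. \<bar>Re (H z)\<bar>) \<le> 3 * nev_T f R + K"
      using K(2)[OF R1 R(3)] by blast
    define M where "M = circ_mean R (\<lambda>z. \<bar>Re (H z)\<bar>)"
    have M0: "M \<ge> 0" unfolding M_def by (rule circ_mean_nonneg) simp
    have "M \<le> 3 * nev_T f R + K" using H(3) by (simp add: M_def)
    also have "nev_T f R \<le> (ln R) powr s" using Rr r3 by (intro r0) simp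
    also have "(ln R) powr s \<le> 3 powr s * (ln r) powr s"
      using r3 R s by (intro powr_cube_ln_le) auto
    finally have 1: "M \<le> 3 * (3 powr s * (ln r) powr s) + K" by simp
    have "K * 1 \<le> K * (ln r) powr s" using ln1 s K(1) by (intro mult_left_mono ge_one_powr_ge_zero) auto
    with 1 have M: "M \<le> C2 * (ln r) powr s" by (simp add: C2_def algebra_simps)
    have cont: "continuous_on (sphere 0 R) (\<lambda>z. Re (H z))"
      by (intro continuous_intros continuous_on_subset[OF holomorphic_on_imp_continuous_on[OF H(1)]]) auto
    have ci: "circ_int R (\<lambda>z. Re (H z))" using R1 by (intro circ_int_continuous[OF cont]) auto
    have "Re (H 0) \<le> M" "- Re (H 0) \<le> M"
    proof -
      have "circ_mean R (\<lambda>z. Re (H z)) \<le> M" unfolding M_def using R1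
        by (intro circ_mean_mono circ_int_abs ci) (auto intro!: always_eventually)
      moreover have "circ_mean R (\<lambda>z. -1 * Re (H z)) \<le> M" unfolding M_def using R1
        by (intro circ_mean_mono circ_int_abs circ_int_cmult ci) (auto intro!: always_eventually)
      ultimately show "Re (H 0) \<le> M" "- Re (H 0) \<le> M"
        using circ_mean_Re[OF H(1)] R1 circ_mean_cmult[of R "-1" "\<lambda>z. Re (H z)"] by auto
    qed
    hence "\<bar>Re (H 0)\<bar> \<le> M" by linarith
    also have "M \<le> C * (ln r) powr s"
      by (rule order_trans[OF M]) (intro mult_right_mono, auto simp: C_def)
    finally have H0: "\<bar>Re (H 0)\<bar> \<le> C * (ln r) powr s" .
    have "(\<Sum>a\<in>div_set f R. \<bar>real_of_int (zorder f a)\<bar>) \<le> C1 * (ln R) powr (s - 1)"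
      using Rr r3 by (intro r1) simp
    also have "\<dots> \<le> C1 * (3 powr (s - 1) * (ln r) powr (s - 1))"
      using r3 R s C1(1) by (intro mult_left_mono powr_cube_ln_le) auto
    also have "\<dots> = (C1 * 3 powr (s - 1)) * (ln r) powr (s - 1)" by simp
    also have "\<dots> \<le> C * (ln r) powr (s - 1)" by (intro mult_right_mono) (auto simp: C_def)
    finally have cnt: "(\<Sum>a\<in>div_set f R. \<bar>real_of_int (zorder f a)\<bar>) \<le> C * (ln r) powr (s - 1)" .
    have dH: "cmod (deriv H z) \<le> 1 / r" if z: "cmod z \<le> R / 2" for z
    proof -
      have "cmod (deriv H z) \<le> 2 * R / (R - cmod z)\<^sup>2 * M" unfolding M_def
        using z R1 by (intro deriv_bound_Re[OF H(1)]) auto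
      also have "\<dots> \<le> 2 * R / (R / 2)\<^sup>2 * M"
        using z R1 M0 by (intro mult_right_mono divide_left_mono power_mono mult_pos_pos) auto
      also have "\<dots> = 8 * M / R" using R1 by (simp add: power2_eq_square field_simps)
      also have "\<dots> \<le> r / R" using M elim R1 by (intro divide_right_mono) auto
      also have "\<dots> \<le> r / r\<^sup>2" using R(1) R1 r3 by (intro divide_left_mono) auto
      also have "\<dots> = 1 / r" by (simp add: power2_eq_square)
      finally show ?thesis .
    qed
    show ?case
      by (rule exI[of _ R], rule exI[of _ H])
         (use R H(2) cnt H0 dH holomorphic_on_subset[OF H(1), of "ball 0 R"] in auto)
  qed
  thus ?thesis using that[of C] C0 by blast
qed

subsection \<open>Proximity functions of delay quotients\<close>

lemma abs_ln_diff_le: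
  assumes "0 < x" "0 < y" "x \<le> k * y" "y \<le> k * x"
  shows "\<bar>ln x - ln y\<bar> \<le> ln (k::real)"
proof -
  have k: "k > 0" using assms by (smt (verit) mult_nonpos_nonneg)
  have "ln x \<le> ln (k * y)" "ln y \<le> ln (k * x)" using assms k by (auto simp: ln_le_cancel_iff)
  thus ?thesis using assms k by (simp add: ln_mult)
qed

text \<open>\<open>1 + k / y\<close> is at most \<open>1 + k\<close> times the larger of 1 and
  \<open>1 / y\<close>.\<close>

lemma ln_shift_le:
  assumes "0 < x" "0 < y" "x \<le> y + k" "0 \<le> k"
  shows "ln x - ln y \<le> ln (1 + k) + logp (1 / y)"
proof -
  have "ln x \<le> ln (y + k)" using assms by simp
  also have "y + k = y * (1 + k / y)" using assms by (simp add: field_simps)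
  also have "ln \<dots> = ln y + ln (1 + k / y)" using assms by (intro ln_mult_pos) (auto intro!: add_pos_nonneg)
  also have "ln (1 + k / y) \<le> ln (1 + k) + logp (1 / y)"
  proof (cases "y \<le> 1")
    case True
    have "1 + k / y \<le> (1 + k) * (1 / y)" using assms True by (simp add: field_simps)
    hence "ln (1 + k / y) \<le> ln ((1 + k) * (1 / y))"
      using assms by (subst ln_le_cancel_iff) (auto intro!: add_pos_nonneg divide_pos_pos)
    also have "\<dots> = ln (1 + k) + ln (1 / y)" using assms by (intro ln_mult_pos) auto
    also have "ln (1 / y) \<le> logp (1 / y)" by (rule ln_le_logp)
    finally show ?thesis by simp
  next
    case False
    have "k / y \<le> k / 1" using False assms by (intro divide_left_mono) auto
    hence "ln (1 + k / y) \<le> ln (1 + k)" using assms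
      by (subst ln_le_cancel_iff) (auto intro!: add_pos_nonneg)
    thus ?thesis using logp_nonneg[of "1/y"] by linarith
  qed
  finally show ?thesis by simp
qed

lemma blaschke_denom_bounds:
  assumes "cmod a < R" "cmod z \<le> R / 2"
  shows "R\<^sup>2 / 2 \<le> cmod (of_real (R\<^sup>2) - cnj a * z)" "cmod (of_real (R\<^sup>2) - cnj a * z) \<le> 3 * R\<^sup>2 / 2"
proof -
  have R: "R > 0" using assms(1) norm_ge_zero[of a] by linarith
  have "cmod (cnj a * z) \<le> R * (R / 2)" unfolding norm_mult using assms R by (intro mult_mono) auto
  hence 1: "cmod (cnj a * z) \<le> R\<^sup>2 / 2" by (simp add: power2_eq_square)
  have 2: "cmod (of_real (R\<^sup>2)) = R\<^sup>2" by (simp only: norm_of_real) simp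
  show "R\<^sup>2 / 2 \<le> cmod (of_real (R\<^sup>2) - cnj a * z)"
    using norm_triangle_ineq2[of "of_real (R\<^sup>2)" "cnj a * z"] 1 2 by linarith
  show "cmod (of_real (R\<^sup>2) - cnj a * z) \<le> 3 * R\<^sup>2 / 2"
    using norm_triangle_ineq4[of "of_real (R\<^sup>2)" "cnj a * z"] 1 2 by linarith
qed

lemma ln_cmod_blaschke:
  assumes "cmod a < R" "cmod z \<le> R / 2" "z \<noteq> a"
  shows "ln (cmod (blaschke R a z)) = ln R + ln (cmod (z - a)) - ln (cmod (of_real (R\<^sup>2) - cnj a * z))"
proof -
  have R: "R > 0" using assms(1) norm_ge_zero[of a] by linarith
  have "0 < R\<^sup>2 / 2" using R by simp
  also note blaschke_denom_bounds(1)[OF assms(1,2)]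
  finally have "cmod (of_real (R\<^sup>2) - cnj a * z) > 0" .
  thus ?thesis using R assms(3) unfolding blaschke_def norm_divide norm_mult
    by (subst ln_divide_pos) (auto simp: ln_mult_pos)
qed

text \<open>The size of \<open>R\<close> cancels in the ratio. In \<open>ln 6\<close>, the factor 2
  is the change of the distance to \<open>a\<close> when \<open>z1\<close> moves to
  \<open>w\<close>, and the factor 3 compares the two denominators, which lie between
  \<open>R^2 / 2\<close> and \<open>3 * R^2 / 2\<close>. The rest is the passage from
  \<open>z1\<close> to \<open>z2\<close>.\<close>

lemma ln_blaschke_ratio:
  assumes a: "cmod a < R" and w: "cmod w \<le> R / 2" and z2: "cmod z2 \<le> R / 2"
    and ne: "z1 \<noteq> a" "z2 \<noteq> a" and wz: "cmod (w - z1) \<le> cmod (z1 - a) / 2"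
  shows "\<bar>ln (cmod (blaschke R a w)) - ln (cmod (blaschke R a z2))\<bar>
    \<le> (ln 6 + ln (1 + cmod (z1 - z2))) + logp (1 / cmod (z1 - a)) + logp (1 / cmod (z2 - a))"
proof -
  have R: "R > 0" using a norm_ge_zero[of a] by linarith
  have p: "0 < cmod (z1 - a)" "0 < cmod (z2 - a)" using ne by auto
  have "cmod (w - a) \<le> cmod (w - z1) + cmod (z1 - a)" using norm_triangle_ineq[of "w - z1" "z1 - a"] by simp
  moreover have "cmod (z1 - a) \<le> cmod (w - z1) + cmod (w - a)"
    using norm_triangle_ineq4[of "w - a" "w - z1"] by (simp add: algebra_simps)
  ultimately have wa: "cmod (w - a) \<le> 2 * cmod (z1 - a)" "cmod (z1 - a) \<le> 2 * cmod (w - a)"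
    using wz p by linarith+
  have wne: "w \<noteq> a" using wa p by auto
  have 1: "\<bar>ln (cmod (w - a)) - ln (cmod (z1 - a))\<bar> \<le> ln 2"
    using wa wne p by (intro abs_ln_diff_le) auto
  have "cmod (z1 - a) \<le> cmod (z2 - a) + cmod (z1 - z2)"
    using norm_triangle_ineq[of "z2 - a" "z1 - z2"] by simp
  hence 2: "ln (cmod (z1 - a)) - ln (cmod (z2 - a)) \<le> ln (1 + cmod (z1 - z2)) + logp (1 / cmod (z2 - a))"
    using p by (intro ln_shift_le) auto
  have "cmod (z2 - a) \<le> cmod (z1 - a) + cmod (z1 - z2)"
    using norm_triangle_ineq4[of "z1 - a" "z1 - z2"] by simp
  hence 3: "ln (cmod (z2 - a)) - ln (cmod (z1 - a)) \<le> ln (1 + cmod (z1 - z2)) + logp (1 / cmod (z1 - a))"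
    using p by (intro ln_shift_le) auto
  have R2: "0 < R\<^sup>2 / 2" using R by simp
  note bw = blaschke_denom_bounds[OF a w] and bz = blaschke_denom_bounds[OF a z2]
  have 4: "\<bar>ln (cmod (of_real (R\<^sup>2) - cnj a * w)) - ln (cmod (of_real (R\<^sup>2) - cnj a * z2))\<bar> \<le> ln 3"
    by (rule abs_ln_diff_le) (use bw bz R2 in linarith)+
  have "ln (6::real) = ln 2 + ln 3" by (simp flip: ln_mult_pos)
  thus ?thesis
    using 1 2 3 4 ln_cmod_blaschke[OF a w wne] ln_cmod_blaschke[OF a z2 ne(2)]
      logp_nonneg[of "1 / cmod (z1 - a)"] logp_nonneg[of "1 / cmod (z2 - a)"] by linarith
qed

text \<open>A single factor has modulus comparable to \<open>cmod (z - a) / R\<close>; with nothing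
  to cancel against, a term \<open>ln (2 * R)\<close> survives. It accounts for one extra power of
  \<open>ln r\<close> in the bound for \<open>1 / f\<close>.\<close>

lemma abs_ln_blaschke:
  assumes a: "cmod a < R" and z: "cmod z \<le> R / 2" and ne: "z \<noteq> a" and R1: "1 \<le> R"
  shows "\<bar>ln (cmod (blaschke R a z))\<bar> \<le> ln 3 + ln (2 * R) + logp (1 / cmod (z - a))"
proof -
  have R2: "0 < R\<^sup>2 / 2" using R1 by simp
  note b = blaschke_denom_bounds[OF a z]
  have eq: "ln (R\<^sup>2 / 2) = 2 * ln R - ln 2" "ln (2 * R) = ln 2 + ln R" "ln (3 * R\<^sup>2 / 2) = ln 3 + 2 * ln R - ln 2"
    using R1 by (auto simp: ln_div ln_mult ln_realpow)
  have "cmod (z - a) \<le> 2 * R" using norm_triangle_ineq4[of z a] a z R1 by linarith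
  hence u: "ln (cmod (z - a)) \<le> ln (2 * R)" using ne R1 by (subst ln_le_cancel_iff) auto
  have l: "- ln (cmod (z - a)) \<le> logp (1 / cmod (z - a))"
    using ln_le_logp[of "1 / cmod (z - a)"] ne by (simp add: ln_div)
  have d1: "ln (R\<^sup>2 / 2) \<le> ln (cmod (of_real (R\<^sup>2) - cnj a * z))"
    using b(1) R2 by (subst ln_le_cancel_iff) linarith+
  have d2: "ln (cmod (of_real (R\<^sup>2) - cnj a * z)) \<le> ln (3 * R\<^sup>2 / 2)"
    using b R2 by (subst ln_le_cancel_iff) linarith+
  have lp: "0 \<le> ln R" "0 \<le> ln (2::real)" "ln (2::real) \<le> ln 3" using R1 by auto
  show ?thesis
    using ln_cmod_blaschke[OF a z ne] u l d1 d2 eq lp logp_nonneg[of "1 / cmod (z - a)"] by linarith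
qed

lemma eventually_cosparse_shift:
  assumes "\<forall>\<^sub>\<approx>z. P z"
  shows "\<forall>\<^sub>\<approx>z. P (z + c :: complex)"
proof -
  have "{z. \<not> P z} sparse_in UNIV" using assms by (simp add: eventually_cosparse)
  hence "(+) (-c) ` {z. \<not> P z} sparse_in UNIV" by (rule sparse_in_translate_UNIV)
  moreover have "(+) (-c) ` {z. \<not> P z} = {z. \<not> P (z + c)}"
    by (auto simp: image_iff intro!: exI[of _ "_ + c"])
  ultimately show ?thesis by (simp add: eventually_cosparse)
qed

text \<open>Derivatives depend on a neighbourhood. An identity off a sparse set holds in a punctured
  neighbourhood of every point, so wherever it also holds at the point it may be
  differentiated.\<close>

lemma eventually_cosparse_nhds:
  assumes "\<forall>\<^sub>\<approx>z::complex. P z"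
  shows "\<forall>\<^sub>\<approx>z. eventually P (nhds z)"
  using assms
proof eventually_elim
  case (elim z)
  thus ?case using eventually_cosparse_imp_eventually_at[OF assms, of z UNIV]
    by (simp add: eventually_nhds_conv_at)
qed

text \<open>The \<open>j\<close>-th derivative is estimated by Cauchy's inequality on a disc around \<open>z1\<close> whose
  radius is half the distance to the nearest zero or pole; on it, the zero and pole factors change by at most a
  bounded factor each, so no iteration of the logarithmic derivative is needed.\<close>
lemma logp_deriv_ratio_le:
  fixes z1 z2 :: complex and j :: nat
  assumes fin: "finite D" and D: "\<And>a. a \<in> D \<Longrightarrow> cmod a < R" "\<And>a. a \<in> D \<Longrightarrow> o' a \<noteq> 0"
    and H: "H holomorphic_on ball 0 R" and dH: "\<And>z. cmod z \<le> R / 2 \<Longrightarrow> cmod (deriv H z) \<le> B"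
    and B: "0 \<le> B" "B \<le> 1"
    and z: "cmod z1 + 1 \<le> R / 2" "cmod z2 \<le> R / 2" "z1 \<notin> D" "z2 \<notin> D"
  defines "\<phi> \<equiv> \<lambda>z. exp (H z) * (\<Prod>a\<in>D. blaschke R a z powi o' a)"
  shows "logp (cmod ((deriv ^^ j) \<phi> z1 / \<phi> z2)) \<le>
    ln (fact j) + (1 + cmod (z1 - z2)) + j * ln 2 +
    (\<Sum>a\<in>D. \<bar>of_int (o' a)\<bar> * ((ln 6 + ln (1 + cmod (z1 - z2))) + (1 + real j) * logp (1 / cmod (z1 - a)) + logp (1 / cmod (z2 - a))))"
proof -
  \<comment> \<open>The entry 1 keeps the disc around \<open>z1\<close> inside
    \<open>cball 0 (R / 2)\<close>, by the margin in \<open>cmod z1 + 1 \<le> R / 2\<close>, and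
    covers an empty \<open>D\<close>.\<close>
  define \<delta> where "\<delta> = Min (insert 1 ((\<lambda>a. cmod (z1 - a) / 2) ` D))"
  have "\<delta> > 0" "\<delta> \<le> 1" using fin z(3) by (auto simp: \<delta>_def Min_le_iff)
  moreover have "\<delta> \<le> cmod (z1 - a) / 2" if "a \<in> D" for a
    unfolding \<delta>_def using fin that by (intro Min_le) auto
  ultimately have \<delta>: "\<delta> > 0" "\<delta> \<le> 1" "\<And>a. a \<in> D \<Longrightarrow> \<delta> \<le> cmod (z1 - a) / 2" by blast+
  have R: "R > 0" using z(1) norm_ge_zero[of z1] by linarith
  define L where "L = (\<Sum>a\<in>D. \<bar>of_int (o' a)\<bar> * logp (1 / cmod (z1 - a)))"
  define U where "U = (1 + cmod (z1 - z2)) + (\<Sum>a\<in>D. \<bar>of_int (o' a)\<bar> *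
    ((ln 6 + ln (1 + cmod (z1 - z2))) + logp (1 / cmod (z1 - a)) + logp (1 / cmod (z2 - a))))"
  have U0: "0 \<le> U" unfolding U_def by (auto intro!: add_nonneg_nonneg sum_nonneg mult_nonneg_nonneg)
  have L0: "0 \<le> L" unfolding L_def by (auto intro!: sum_nonneg)
  have bnz: "blaschke R a w \<noteq> 0" if "a \<in> D" "cmod w \<le> R / 2" "w \<noteq> a" for a w
    using that D R blaschke_denom_nonzero[of a R w] by (auto simp: blaschke_def)
  have lnphi: "ln (cmod (\<phi> w)) = Re (H w) + (\<Sum>a\<in>D. of_int (o' a) * ln (cmod (blaschke R a w)))" and phinz: "\<phi> w \<noteq> 0"
    if "cmod w \<le> R / 2" "w \<notin> D" for w
  proof -
    have nz: "blaschke R a w \<noteq> 0" if "a \<in> D" for a using bnz[of a w] that \<open>cmod w \<le> R / 2\<close> \<open>w \<notin> D\<close> by auto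
    thus "\<phi> w \<noteq> 0" using fin by (simp add: \<phi>_def)
    have "ln (cmod (\<phi> w)) = ln (exp (Re (H w))) + ln (cmod (\<Prod>a\<in>D. blaschke R a w powi o' a))"
      unfolding \<phi>_def norm_mult norm_exp_eq_Re using nz fin by (intro ln_mult_pos) auto
    thus "ln (cmod (\<phi> w)) = Re (H w) + (\<Sum>a\<in>D. of_int (o' a) * ln (cmod (blaschke R a w)))"
      using ln_norm_prod_powi[OF fin nz] by simp
  qed
  have main: "cmod (\<phi> w) \<le> cmod (\<phi> z2) * exp U" if w: "cmod (z1 - w) = \<delta>" for w
  proof -
    have wz: "cmod (w - z1) \<le> \<delta>" using w by (simp add: norm_minus_commute)
    have w2: "cmod w \<le> R / 2" using norm_triangle_ineq[of z1 "w - z1"] wz \<delta>(2) z(1) by simp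
    have wD: "w \<notin> D"
    proof
      assume "w \<in> D"
      from \<delta>(3)[OF this] w \<delta>(1) show False by simp
    qed
    have "cmod (H w - H z2) \<le> B * cmod (w - z2)"
    proof (rule field_differentiable_bound[of "cball 0 (R / 2)"])
      fix x :: complex assume x: "x \<in> cball 0 (R / 2)"
      have "H field_differentiable at x"
        using holomorphic_on_imp_differentiable_at[OF H] x R by auto
      thus "(H has_field_derivative deriv H x) (at x within cball 0 (R / 2))"
        by (simp add: DERIV_deriv_iff_field_differentiable has_field_derivative_at_within)
      show "cmod (deriv H x) \<le> B" using x by (intro dH) auto
    qed (use w2 z in auto)
    also have "\<dots> \<le> 1 * (1 + cmod (z1 - z2))"
      using B norm_triangle_ineq[of "w - z1" "z1 - z2"] wz \<delta>(2) by (intro mult_mono) auto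
    finally have h: "Re (H w) - Re (H z2) \<le> 1 + cmod (z1 - z2)"
      using complex_Re_le_cmod[of "H w - H z2"] by simp
    have "(\<Sum>a\<in>D. of_int (o' a) * ln (cmod (blaschke R a w))) - (\<Sum>a\<in>D. of_int (o' a) * ln (cmod (blaschke R a z2)))
      = (\<Sum>a\<in>D. of_int (o' a) * (ln (cmod (blaschke R a w)) - ln (cmod (blaschke R a z2))))"
      by (simp add: sum_subtractf right_diff_distrib)
    also have "\<dots> \<le> (\<Sum>a\<in>D. \<bar>of_int (o' a)\<bar> *
        ((ln 6 + ln (1 + cmod (z1 - z2))) + logp (1 / cmod (z1 - a)) + logp (1 / cmod (z2 - a))))"
    proof (rule sum_mono)
      fix a assume a: "a \<in> D"
      have "of_int (o' a) * (ln (cmod (blaschke R a w)) - ln (cmod (blaschke R a z2))) \<le>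
        \<bar>of_int (o' a)\<bar> * \<bar>ln (cmod (blaschke R a w)) - ln (cmod (blaschke R a z2))\<bar>"
        by (metis abs_ge_self abs_mult)
      also have "\<dots> \<le> \<bar>of_int (o' a)\<bar> * ((ln 6 + ln (1 + cmod (z1 - z2))) + logp (1 / cmod (z1 - a)) + logp (1 / cmod (z2 - a)))"
        by (intro mult_left_mono ln_blaschke_ratio)
           (use a D z w2 wz \<delta>(3)[OF a] in auto)
      finally show "of_int (o' a) * (ln (cmod (blaschke R a w)) - ln (cmod (blaschke R a z2))) \<le>
        \<bar>of_int (o' a)\<bar> * ((ln 6 + ln (1 + cmod (z1 - z2))) + logp (1 / cmod (z1 - a)) + logp (1 / cmod (z2 - a)))" .
    qed
    finally have "ln (cmod (\<phi> w)) - ln (cmod (\<phi> z2)) \<le> U"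
      using h lnphi[OF w2 wD] lnphi[OF z(2,4)] by (simp add: U_def)
    hence "exp (ln (cmod (\<phi> w))) \<le> exp (ln (cmod (\<phi> z2)) + U)" by simp
    thus ?thesis using phinz[OF w2 wD] phinz[OF z(2,4)] by (simp add: exp_add)
  qed
  have hol: "\<phi> holomorphic_on cball z1 \<delta>"
  proof -
    have "cmod x \<le> R / 2 \<and> x \<notin> D" if "x \<in> cball z1 \<delta>" for x
    proof -
      have "cmod (x - z1) \<le> \<delta>" using that by (simp add: dist_norm norm_minus_commute)
      moreover from this have "cmod x \<le> R / 2" using norm_triangle_ineq[of z1 "x - z1"] \<delta>(2) z(1) by simp
      moreover have "x \<notin> D" using \<delta>(3)[of x] \<delta>(1) that by (auto simp: dist_norm)
      ultimately show ?thesis by simp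
    qed
    hence "cball z1 \<delta> \<subseteq> cball 0 (R/2) - D" by auto
    moreover have "\<phi> holomorphic_on cball 0 (R/2) - D"
      unfolding \<phi>_def
    proof (intro holomorphic_intros holomorphic_on_subset[OF H])
      fix a assume a: "a \<in> D"
      show "blaschke R a holomorphic_on cball 0 (R / 2) - D"
        unfolding blaschke_def using blaschke_denom_nonzero[of a R] D(1)[OF a] R
        by (intro holomorphic_intros) auto
      show "0 \<le> o' a \<or> (\<forall>x\<in>cball 0 (R / 2) - D. blaschke R a x \<noteq> 0)"
        by (intro disjI2 ballI bnz[OF a]) (use a in auto)
    qed (use R in auto)
    ultimately show ?thesis by (rule holomorphic_on_subset[rotated])
  qed
  have "cmod ((deriv ^^ j) \<phi> z1) \<le> fact j * (cmod (\<phi> z2) * exp U) / \<delta> ^ j"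
    using hol \<delta>(1) main
    by (intro Cauchy_inequality holomorphic_on_imp_continuous_on) (auto intro: holomorphic_on_subset)
  hence "cmod ((deriv ^^ j) \<phi> z1 / \<phi> z2) \<le> fact j * exp U * (1 / \<delta>) ^ j"
    using phinz[OF z(2,4)] by (simp add: norm_divide field_simps power_divide)
  hence "logp (cmod ((deriv ^^ j) \<phi> z1 / \<phi> z2)) \<le> logp (fact j * exp U * (1 / \<delta>) ^ j)"
    by (intro logp_mono) auto
  also have "\<dots> = ln (fact j * exp U * (1 / \<delta>) ^ j)"
    using \<delta> U0 by (intro logp_eq_ln mult_ge1_I one_le_power) (auto simp: fact_ge_1)
  also have "\<dots> = ln (fact j) + U + j * ln (1 / \<delta>)"
    using \<delta> by (simp add: ln_mult ln_realpow)
  \<comment> \<open>The minimum is attained at 1 or at one point of \<open>D\<close>; that point has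
    non-zero order, so its term occurs in \<open>L\<close> with weight at least 1. Cauchy's
    inequality uses this \<open>j\<close> times, which together with the term in \<open>U\<close>
    gives the factor \<open>1 + real j\<close>.\<close>
  also have "ln (1 / \<delta>) \<le> ln 2 + L"
  proof -
    have "\<delta> \<in> insert 1 ((\<lambda>a. cmod (z1 - a) / 2) ` D)"
      unfolding \<delta>_def using fin by (intro Min_in) auto
    then consider "\<delta> = 1" | a where "a \<in> D" "\<delta> = cmod (z1 - a) / 2" by auto
    thus ?thesis
    proof cases
      case 1
      thus ?thesis using L0 by simp
    next
      case 2
      have "1 \<le> \<bar>real_of_int (o' a)\<bar>" using D(2)[OF 2(1)] by linarith
      hence "1 * logp (1 / cmod (z1 - a)) \<le> \<bar>of_int (o' a)\<bar> * logp (1 / cmod (z1 - a))"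
        by (intro mult_right_mono) auto
      also have "\<dots> \<le> L" unfolding L_def using fin 2(1) by (intro member_le_sum) auto
      finally have "ln (1 / cmod (z1 - a)) \<le> L" using ln_le_logp[of "1 / cmod (z1 - a)"] by linarith
      moreover have "ln (1 / \<delta>) = ln 2 + ln (1 / cmod (z1 - a))"
      proof -
        have "1 / \<delta> = 2 * (1 / cmod (z1 - a))" unfolding 2(2) by simp
        thus ?thesis using 2 \<delta>(1) by (simp only:) (subst ln_mult_pos, auto)
      qed
      ultimately show ?thesis by simp
    qed
  qed
  hence "real j * ln (1 / \<delta>) \<le> real j * (ln 2 + L)" by (intro mult_left_mono) auto
  also have "ln (fact j) + U + real j * (ln 2 + L) = ln (fact j) + (1 + cmod (z1 - z2)) + j * ln 2 +
    (\<Sum>a\<in>D. \<bar>of_int (o' a)\<bar> * ((ln 6 + ln (1 + cmod (z1 - z2))) + (1 + real j) * logp (1 / cmod (z1 - a)) + logp (1 / cmod (z2 - a))))"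
    unfolding U_def L_def by (simp add: algebra_simps sum.distrib sum_distrib_left)
  finally show ?thesis by simp
qed

section \<open>Averaging the pointwise bounds over circles\<close>

lemma meromorphic_on_shift:
  assumes "f meromorphic_on UNIV"
  shows "(\<lambda>z. f (z + c)) meromorphic_on UNIV"
  by (rule meromorphic_on_compose[OF assms]) (auto intro!: analytic_intros)

lemma circ_int_logp_inverse_shift: "1 \<le> r \<Longrightarrow> circ_int r (\<lambda>z. logp (1 / cmod (z + c - a)))"
  using circ_int_logp_inverse[of r "a - c"] by (simp add: diff_diff_eq2)

lemma circ_mean_logp_inverse_shift: "1 \<le> r \<Longrightarrow> circ_mean r (\<lambda>z. logp (1 / cmod (z + c - a))) \<le> circle_log_const"
  using circ_mean_logp_inverse[of r "a - c"] by (simp add: diff_diff_eq2)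

text \<open>This serves as the logarithmic derivative lemma and its difference analogue at once. The
  exponential factor contributes a constant, since \<open>deriv H\<close> is small and the two
  arguments differ by \<open>c - d\<close>; each zero or pole contributes a bounded mean. What
  remains is their number, hence the exponent \<open>s - 1\<close>.\<close>

lemma nev_m_deriv_ratio_bound:
  assumes f: "f meromorphic_on UNIV" "\<not> (\<forall>\<^sub>\<approx>z. f z = 0)" and s: "1 \<le> s"
    and T: "\<forall>\<^sub>F r in at_top. nev_T f r \<le> (ln r) powr s"
  shows "\<exists>C. \<forall>\<^sub>F r in at_top. nev_m (\<lambda>z. (deriv ^^ j) f (z + c) / f (z + d)) r \<le> C * (ln r) powr (s - 1)"
proof -
  obtain C0 where C0: "C0 \<ge> 0"
    "\<forall>\<^sub>F r in at_top. \<exists>\<rho> H. r\<^sup>2 < \<rho> \<and> \<rho> < r ^ 3 \<and> (\<forall>z. cmod z = \<rho> \<longrightarrow> zorder f z = 0) \<and>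
       H holomorphic_on ball 0 \<rho> \<and>
       (\<forall>\<^sub>\<approx>z. cmod z < \<rho> \<longrightarrow> f z = exp (H z) * (\<Prod>a\<in>div_set f \<rho>. blaschke \<rho> a z powi zorder f a)) \<and>
       (\<Sum>a\<in>div_set f \<rho>. \<bar>real_of_int (zorder f a)\<bar>) \<le> C0 * (ln r) powr (s - 1) \<and>
       \<bar>Re (H 0)\<bar> \<le> C0 * (ln r) powr s \<and>
       (\<forall>z. cmod z \<le> \<rho> / 2 \<longrightarrow> cmod (deriv H z) \<le> 1 / r)"
    by (rule eventual_disc_representation[OF f s T])
  define k0 where "k0 = ln (fact j) + (1 + cmod (c - d)) + j * ln 2"
  define k1 where "k1 = ln 6 + ln (1 + cmod (c - d))"
  define k2 where "k2 = k1 + (1 + real j) * circle_log_const + circle_log_const"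
  have k0: "k0 \<ge> 0" unfolding k0_def by (intro add_nonneg_nonneg) (auto simp: fact_ge_1)
  have k2: "k2 \<ge> 0" unfolding k2_def k1_def using circle_log_const_nonneg by (intro add_nonneg_nonneg) auto
  have mero: "(\<lambda>z. (deriv ^^ j) f (z + c) / f (z + d)) meromorphic_on UNIV"
    by (intro meromorphic_intros meromorphic_on_shift f)
  have "\<forall>\<^sub>F r in at_top. r \<ge> 4 + 2 * cmod c + 2 * cmod d" by (rule eventually_ge_at_top)
  with C0(2) have "\<forall>\<^sub>F r in at_top. nev_m (\<lambda>z. (deriv ^^ j) f (z + c) / f (z + d)) r \<le> (k0 + k2 * C0) * (ln r) powr (s - 1)"
  proof eventually_elim
    case (elim r)
    then obtain \<rho> H where \<rho>: "r\<^sup>2 < \<rho>" and gen: "\<And>z. cmod z = \<rho> \<Longrightarrow> zorder f z = 0"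
      and H: "H holomorphic_on ball 0 \<rho>"
      and rep: "\<forall>\<^sub>\<approx>z. cmod z < \<rho> \<longrightarrow> f z = exp (H z) * (\<Prod>a\<in>div_set f \<rho>. blaschke \<rho> a z powi zorder f a)"
      and cnt: "(\<Sum>a\<in>div_set f \<rho>. \<bar>real_of_int (zorder f a)\<bar>) \<le> C0 * (ln r) powr (s - 1)"
      and dH: "\<And>z. cmod z \<le> \<rho> / 2 \<Longrightarrow> cmod (deriv H z) \<le> 1 / r" by blast
    have r: "r \<ge> 4 + 2 * cmod c + 2 * cmod d" using elim by simp
    have r4: "r \<ge> 4" using r norm_ge_zero[of c] norm_ge_zero[of d] by linarith
    have r1: "1 \<le> r" using r4 by simp
    \<comment> \<open>The right-hand side is \<open>r ^ 2\<close>, which is less than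
      \<open>\<rho>\<close>. So both shifted circles lie in \<open>cball 0 (\<rho> / 2)\<close>, the
      one shifted by \<open>c\<close> with the margin 1 needed for Cauchy's inequality.\<close>
    have "(4 + 2 * cmod c + 2 * cmod d) * 1 + (r - 1) * 4 \<le> r * 1 + (r - 1) * r"
      using r r4 by (intro add_mono mult_mono) auto
    hence \<rho>2: "r + cmod c + 1 \<le> \<rho> / 2" "r + cmod d \<le> \<rho> / 2"
      using \<rho> r4 norm_ge_zero[of c] norm_ge_zero[of d] unfolding power2_eq_square left_diff_distrib
      by (simp_all only: mult_1 mult_1_right)
    let ?D = "div_set f \<rho>"
    define \<phi> where "\<phi> = (\<lambda>z. exp (H z) * (\<Prod>a\<in>?D. blaschke \<rho> a z powi zorder f a))"
    have fin: "finite ?D" by (rule finite_div_set[OF f])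
    have Dlt: "cmod a < \<rho>" "zorder f a \<noteq> 0" if "a \<in> ?D" for a using that gen by (force simp: div_set_def)+
    define u where "u = (\<lambda>z. k0 + (\<Sum>a\<in>?D. \<bar>of_int (zorder f a)\<bar> *
       (k1 + (1 + real j) * logp (1 / cmod (z + c - a)) + logp (1 / cmod (z + d - a)))))"
    have ci: "circ_int r (\<lambda>z. k1 + (1 + real j) * logp (1 / cmod (z + c - a)) + logp (1 / cmod (z + d - a)))" for a
      by (intro circ_int_add circ_int_cmult circ_int_const circ_int_logp_inverse_shift r1)
    have ciu: "circ_int r u" unfolding u_def by (intro circ_int_add circ_int_cmult circ_int_const circ_int_sum ci)
    have nD: "\<forall>\<^sub>\<approx>z. z \<notin> ?D" using fin by (intro eventually_not_in_cosparse finite_imp_sparse)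
    have "\<forall>\<^sub>\<approx>z. cmod z = r \<longrightarrow> logp (cmod ((deriv ^^ j) f (z + c) / f (z + d))) \<le> u z"
      using eventually_cosparse_shift[OF nD, of c] eventually_cosparse_shift[OF nD, of d]
        eventually_cosparse_shift[OF rep, of d] eventually_cosparse_shift[OF eventually_cosparse_nhds[OF rep], of c]
    proof eventually_elim
      case (elim z)
      show ?case
      proof
        assume z: "cmod z = r"
        have zc: "cmod (z + c) + 1 \<le> \<rho> / 2" using norm_triangle_ineq[of z c] z \<rho>2 by linarith
        have zd: "cmod (z + d) \<le> \<rho> / 2" using norm_triangle_ineq[of z d] z \<rho>2 by linarith
        have lt: "cmod (z + c) < \<rho>" "cmod (z + d) < \<rho>"
          using zc zd norm_ge_zero[of "z + c"] norm_ge_zero[of "z + d"] r4 \<rho>2 by linarith+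
        have fd: "f (z + d) = \<phi> (z + d)" using elim(3) lt(2) by (simp add: \<phi>_def)
        have "eventually (\<lambda>w. w \<in> ball 0 \<rho>) (nhds (z + c))"
          using lt(1) by (intro eventually_nhds_in_open) auto
        with elim(4) have "eventually (\<lambda>w. f w = \<phi> w) (nhds (z + c))"
          by eventually_elim (simp add: \<phi>_def)
        hence fc: "(deriv ^^ j) f (z + c) = (deriv ^^ j) \<phi> (z + c)"
          by (rule higher_deriv_cong_ev) simp
        have "logp (cmod ((deriv ^^ j) \<phi> (z + c) / \<phi> (z + d))) \<le> u z"
          using logp_deriv_ratio_le[OF fin Dlt H dH _ _ zc zd elim(1,2), where j = j] r4
          unfolding \<phi>_def u_def k0_def k1_def by (simp add: add_ac)
        thus "logp (cmod ((deriv ^^ j) f (z + c) / f (z + d))) \<le> u z" by (simp add: fc fd)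
      qed
    qed
    hence "nev_m (\<lambda>z. (deriv ^^ j) f (z + c) / f (z + d)) r \<le> circ_mean r u"
      by (rule nev_m_le[OF mero r1 _ ciu])
    also have "circ_mean r u = k0 + (\<Sum>a\<in>?D. \<bar>of_int (zorder f a)\<bar> * circ_mean r (\<lambda>z.
       k1 + (1 + real j) * logp (1 / cmod (z + c - a)) + logp (1 / cmod (z + d - a))))"
      unfolding u_def
      by (simp only: circ_mean_add[OF circ_int_const circ_int_sum[OF circ_int_cmult[OF ci]]]
        circ_mean_sum[OF circ_int_cmult[OF ci]] circ_mean_cmult circ_mean_const)
    also have "\<dots> \<le> k0 + (\<Sum>a\<in>?D. \<bar>of_int (zorder f a)\<bar> * k2)"
    proof (intro add_left_mono sum_mono mult_left_mono)
      fix a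
      have "circ_mean r (\<lambda>z. k1 + (1 + real j) * logp (1 / cmod (z + c - a)) + logp (1 / cmod (z + d - a)))
        = k1 + (1 + real j) * circ_mean r (\<lambda>z. logp (1 / cmod (z + c - a))) + circ_mean r (\<lambda>z. logp (1 / cmod (z + d - a)))"
        using r1 by (simp add: circ_mean_add circ_mean_cmult circ_int_add circ_int_cmult circ_int_logp_inverse_shift)
      also have "\<dots> \<le> k2" unfolding k2_def
        by (intro add_mono mult_left_mono circ_mean_logp_inverse_shift r1) auto
      finally show "circ_mean r (\<lambda>z. k1 + (1 + real j) * logp (1 / cmod (z + c - a)) + logp (1 / cmod (z + d - a))) \<le> k2" .
    qed auto
    also have "\<dots> = k0 + k2 * (\<Sum>a\<in>?D. \<bar>real_of_int (zorder f a)\<bar>)" by (simp add: sum_distrib_left mult.commute)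
    also have "\<dots> \<le> k0 + k2 * (C0 * (ln r) powr (s - 1))" using cnt k2 by (intro add_left_mono mult_left_mono) auto
    also have "k0 \<le> k0 * (ln r) powr (s - 1)"
    proof -
      have "1 = ln (exp 1 :: real)" by simp
      also have "\<dots> \<le> ln r" using exp_le r4 by (subst ln_le_cancel_iff) auto
      finally have "1 \<le> ln r powr (s - 1)" using s by (intro ge_one_powr_ge_zero) auto
      hence "k0 * 1 \<le> k0 * (ln r) powr (s - 1)" using k0 by (intro mult_left_mono)
      thus ?thesis by simp
    qed
    finally show ?case by (simp add: algebra_simps)
  qed
  thus ?thesis by blast
qed

text \<open>Without a second value of \<open>f\<close> nothing cancels: \<open>Re (H 0)\<close> may
  be as large as a multiple of \<open>(ln r) powr s\<close>, and each of the about
  \<open>(ln r) powr (s - 1)\<close> zeros and poles costs a multiple of \<open>ln r\<close>. Both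
  effects give the exponent \<open>s\<close>.\<close>

lemma nev_m_inverse_shift_bound:
  assumes f: "f meromorphic_on UNIV" "\<not> (\<forall>\<^sub>\<approx>z. f z = 0)" and s: "1 \<le> s"
    and T: "\<forall>\<^sub>F r in at_top. nev_T f r \<le> (ln r) powr s"
  shows "\<exists>C. \<forall>\<^sub>F r in at_top. nev_m (\<lambda>z. 1 / f (z + d)) r \<le> C * (ln r) powr s"
proof -
  obtain C0 where C0: "C0 \<ge> 0"
    "\<forall>\<^sub>F r in at_top. \<exists>\<rho> H. r\<^sup>2 < \<rho> \<and> \<rho> < r ^ 3 \<and> (\<forall>z. cmod z = \<rho> \<longrightarrow> zorder f z = 0) \<and>
       H holomorphic_on ball 0 \<rho> \<and>
       (\<forall>\<^sub>\<approx>z. cmod z < \<rho> \<longrightarrow> f z = exp (H z) * (\<Prod>a\<in>div_set f \<rho>. blaschke \<rho> a z powi zorder f a)) \<and>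
       (\<Sum>a\<in>div_set f \<rho>. \<bar>real_of_int (zorder f a)\<bar>) \<le> C0 * (ln r) powr (s - 1) \<and>
       \<bar>Re (H 0)\<bar> \<le> C0 * (ln r) powr s \<and>
       (\<forall>z. cmod z \<le> \<rho> / 2 \<longrightarrow> cmod (deriv H z) \<le> 1 / r)"
    by (rule eventual_disc_representation[OF f s T])
  \<comment> \<open>The 4 stems from \<open>2 * \<rho> \<le> 4 * r ^ 3 \<le> r ^ 4\<close>, that is,
    \<open>ln (2 * \<rho>) \<le> 4 * ln r\<close>.\<close>
  define k1 where "k1 = ln 3 + 4 + circle_log_const"
  have k1: "k1 \<ge> 0" using circle_log_const_nonneg by (simp add: k1_def)
  have mero: "(\<lambda>z. 1 / f (z + d)) meromorphic_on UNIV"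
    by (intro meromorphic_intros meromorphic_on_shift f)
  have "\<forall>\<^sub>F r in at_top. r \<ge> 4 + 2 * cmod d" by (rule eventually_ge_at_top)
  with C0(2) have "\<forall>\<^sub>F r in at_top. nev_m (\<lambda>z. 1 / f (z + d)) r \<le> (C0 + 2 + k1 * C0) * (ln r) powr s"
  proof eventually_elim
    case (elim r)
    then obtain \<rho> H where \<rho>: "r\<^sup>2 < \<rho>" "\<rho> < r ^ 3" and gen: "\<And>z. cmod z = \<rho> \<Longrightarrow> zorder f z = 0"
      and H: "H holomorphic_on ball 0 \<rho>"
      and rep: "\<forall>\<^sub>\<approx>z. cmod z < \<rho> \<longrightarrow> f z = exp (H z) * (\<Prod>a\<in>div_set f \<rho>. blaschke \<rho> a z powi zorder f a)"
      and cnt: "(\<Sum>a\<in>div_set f \<rho>. \<bar>real_of_int (zorder f a)\<bar>) \<le> C0 * (ln r) powr (s - 1)"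
      and H0: "\<bar>Re (H 0)\<bar> \<le> C0 * (ln r) powr s"
      and dH: "\<And>z. cmod z \<le> \<rho> / 2 \<Longrightarrow> cmod (deriv H z) \<le> 1 / r" by blast
    have r: "r \<ge> 4 + 2 * cmod d" using elim by simp
    have r4: "r \<ge> 4" using r norm_ge_zero[of d] by linarith
    have r1: "1 \<le> r" using r4 by simp
    have "1 = ln (exp 1 :: real)" by simp
    also have "\<dots> \<le> ln r" using exp_le r4 by (subst ln_le_cancel_iff) auto
    finally have ln1: "1 \<le> ln r" .
    have "(4 + 2 * cmod d) * 1 + (r - 1) * 4 \<le> r * 1 + (r - 1) * r"
      using r r4 by (intro add_mono mult_mono) auto
    hence \<rho>2: "r + cmod d \<le> \<rho> / 2"
      using \<rho> r4 norm_ge_zero[of d] by (auto simp: power2_eq_square algebra_simps)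
    have \<rho>1: "1 \<le> \<rho>" using \<rho>2 r4 norm_ge_zero[of d] by linarith
    have "2 * \<rho> \<le> 4 * r ^ 3" using \<rho>(2) \<rho>1 by linarith
    also have "\<dots> \<le> r * r ^ 3" using r4 by (intro mult_right_mono) auto
    finally have "ln (2 * \<rho>) \<le> ln (r ^ 4)" using \<rho>1 by (subst ln_le_cancel_iff) (auto simp: power_Suc[symmetric] eval_nat_numeral)
    hence ln\<rho>: "ln (2 * \<rho>) \<le> 4 * ln r" using r4 by (simp add: ln_realpow)
    let ?D = "div_set f \<rho>"
    have fin: "finite ?D" by (rule finite_div_set[OF f])
    have Dlt: "cmod a < \<rho>" "zorder f a \<noteq> 0" if "a \<in> ?D" for a using that gen by (force simp: div_set_def)+
    \<comment> \<open>The summand 2 bounds the change of \<open>H\<close> between 0 and the shifted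
      circle: a derivative of at most \<open>1 / r\<close> along a length of at most
      \<open>r + cmod d \<le> 2 * r\<close>.\<close>
    define k0 where "k0 = C0 * (ln r) powr s + 2"
    define u where "u = (\<lambda>z. k0 + (\<Sum>a\<in>?D. \<bar>of_int (zorder f a)\<bar> *
       ((ln 3 + 4 * ln r) + logp (1 / cmod (z + d - a)))))"
    have ci: "circ_int r (\<lambda>z. (ln 3 + 4 * ln r) + logp (1 / cmod (z + d - a)))" for a
      by (intro circ_int_add circ_int_cmult circ_int_const circ_int_logp_inverse_shift r1)
    have ciu: "circ_int r u" unfolding u_def by (intro circ_int_add circ_int_cmult circ_int_const circ_int_sum ci)
    have nD: "\<forall>\<^sub>\<approx>z. z \<notin> ?D" using fin by (intro eventually_not_in_cosparse finite_imp_sparse)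
    have "\<forall>\<^sub>\<approx>z. cmod z = r \<longrightarrow> logp (cmod (1 / f (z + d))) \<le> u z"
      using eventually_cosparse_shift[OF nD, of d] eventually_cosparse_shift[OF rep, of d]
    proof eventually_elim
      case (elim z)
      show ?case
      proof
        assume z: "cmod z = r"
        have zd: "cmod (z + d) \<le> \<rho> / 2" using norm_triangle_ineq[of z d] z \<rho>2 by linarith
        have lt: "cmod (z + d) < \<rho>" using zd \<rho>1 by linarith
        have bnz: "blaschke \<rho> a (z + d) \<noteq> 0" if "a \<in> ?D" for a
          using that elim(1) \<rho>1 blaschke_denom_nonzero[OF Dlt(1)[OF that], of "z + d"] lt by (auto simp: blaschke_def)
        have fd: "f (z + d) = exp (H (z + d)) * (\<Prod>a\<in>?D. blaschke \<rho> a (z + d) powi zorder f a)" using elim(2) lt by simp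
        have "ln (cmod (f (z + d))) = ln (exp (Re (H (z + d)))) + ln (cmod (\<Prod>a\<in>?D. blaschke \<rho> a (z + d) powi zorder f a))"
          unfolding fd norm_mult norm_exp_eq_Re using bnz fin by (intro ln_mult_pos) auto
        also have "ln (cmod (\<Prod>a\<in>?D. blaschke \<rho> a (z + d) powi zorder f a)) = (\<Sum>a\<in>?D. of_int (zorder f a) * ln (cmod (blaschke \<rho> a (z + d))))"
          by (rule ln_norm_prod_powi[OF fin bnz])
        finally have lnf: "ln (cmod (f (z + d))) = Re (H (z + d)) + (\<Sum>a\<in>?D. of_int (zorder f a) * ln (cmod (blaschke \<rho> a (z + d))))"
          by simp
        have "\<bar>\<Sum>a\<in>?D. of_int (zorder f a) * ln (cmod (blaschke \<rho> a (z + d)))\<bar> \<le>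
          (\<Sum>a\<in>?D. \<bar>of_int (zorder f a) * ln (cmod (blaschke \<rho> a (z + d)))\<bar>)" by (rule sum_abs)
        also have "\<dots> \<le> (\<Sum>a\<in>?D. \<bar>of_int (zorder f a)\<bar> * ((ln 3 + 4 * ln r) + logp (1 / cmod (z + d - a))))"
        proof (rule sum_mono)
          fix a assume a: "a \<in> ?D"
          have "z + d \<noteq> a" using elim(1) a by auto
          from abs_ln_blaschke[OF Dlt(1)[OF a] zd this \<rho>1]
          have "\<bar>ln (cmod (blaschke \<rho> a (z + d)))\<bar> \<le> (ln 3 + 4 * ln r) + logp (1 / cmod (z + d - a))"
            using ln\<rho> by linarith
          thus "\<bar>of_int (zorder f a) * ln (cmod (blaschke \<rho> a (z + d)))\<bar> \<le> \<bar>of_int (zorder f a)\<bar> * ((ln 3 + 4 * ln r) + logp (1 / cmod (z + d - a)))"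
            unfolding abs_mult by (intro mult_left_mono) auto
        qed
        finally have 1: "\<bar>\<Sum>a\<in>?D. of_int (zorder f a) * ln (cmod (blaschke \<rho> a (z + d)))\<bar> \<le>
           (\<Sum>a\<in>?D. \<bar>of_int (zorder f a)\<bar> * ((ln 3 + 4 * ln r) + logp (1 / cmod (z + d - a))))" .
        have "cmod (H (z + d) - H 0) \<le> 1 / r * cmod (z + d - 0)"
        proof (rule field_differentiable_bound[of "cball 0 (\<rho> / 2)"])
          fix x :: complex assume x: "x \<in> cball 0 (\<rho> / 2)"
          have "H field_differentiable at x"
            using holomorphic_on_imp_differentiable_at[OF H] x \<rho>1 by auto
          thus "(H has_field_derivative deriv H x) (at x within cball 0 (\<rho> / 2))"
            by (simp add: DERIV_deriv_iff_field_differentiable has_field_derivative_at_within)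
          show "cmod (deriv H x) \<le> 1 / r" using x by (intro dH) auto
        qed (use zd \<rho>1 in auto)
        also have "\<dots> \<le> 1 / r * (r + cmod d)" using norm_triangle_ineq[of z d] z r1 by (intro mult_left_mono) auto
        also have "\<dots> \<le> 2" using r r1 by (simp add: field_simps)
        finally have "\<bar>Re (H (z + d)) - Re (H 0)\<bar> \<le> 2" using abs_Re_le_cmod[of "H (z + d) - H 0"] by simp
        hence "\<bar>ln (cmod (f (z + d)))\<bar> \<le> u z" unfolding lnf u_def k0_def using 1 H0 by linarith
        moreover have "logp (cmod (1 / f (z + d))) \<le> \<bar>ln (cmod (f (z + d)))\<bar>"
          by (simp add: abs_ln_eq norm_divide)
        ultimately show "logp (cmod (1 / f (z + d))) \<le> u z" by linarith
      qed
    qed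
    hence "nev_m (\<lambda>z. 1 / f (z + d)) r \<le> circ_mean r u"
      by (rule nev_m_le[OF mero r1 _ ciu])
    also have "circ_mean r u = k0 + (\<Sum>a\<in>?D. \<bar>of_int (zorder f a)\<bar> * circ_mean r (\<lambda>z.
       (ln 3 + 4 * ln r) + logp (1 / cmod (z + d - a))))"
      unfolding u_def
      by (simp only: circ_mean_add[OF circ_int_const circ_int_sum[OF circ_int_cmult[OF ci]]]
        circ_mean_sum[OF circ_int_cmult[OF ci]] circ_mean_cmult circ_mean_const)
    also have "\<dots> \<le> k0 + (\<Sum>a\<in>?D. \<bar>of_int (zorder f a)\<bar> * (k1 * ln r))"
    proof (intro add_left_mono sum_mono mult_left_mono)
      fix a
      have "circ_mean r (\<lambda>z. (ln 3 + 4 * ln r) + logp (1 / cmod (z + d - a)))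
        = (ln 3 + 4 * ln r) + circ_mean r (\<lambda>z. logp (1 / cmod (z + d - a)))"
        using r1 by (simp add: circ_mean_add circ_int_logp_inverse_shift)
      also have "\<dots> \<le> (ln 3 * ln r + 4 * ln r) + circle_log_const * ln r"
      proof (intro add_mono order_refl)
        show "ln 3 \<le> ln 3 * ln r" using ln1 by simp
        have "circle_log_const * 1 \<le> circle_log_const * ln r" using ln1 circle_log_const_nonneg by (intro mult_left_mono)
        thus "circ_mean r (\<lambda>z. logp (1 / cmod (z + d - a))) \<le> circle_log_const * ln r"
          using circ_mean_logp_inverse_shift[OF r1, of d a] by simp
      qed
      also have "\<dots> = k1 * ln r" by (simp add: k1_def algebra_simps)
      finally show "circ_mean r (\<lambda>z. (ln 3 + 4 * ln r) + logp (1 / cmod (z + d - a))) \<le> k1 * ln r" .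
    qed auto
    also have "\<dots> = k0 + k1 * ln r * (\<Sum>a\<in>?D. \<bar>real_of_int (zorder f a)\<bar>)" by (simp add: sum_distrib_left mult.commute)
    also have "\<dots> \<le> k0 + k1 * ln r * (C0 * (ln r) powr (s - 1))" using cnt k1 ln1 by (intro add_left_mono mult_left_mono) auto
    also have "\<dots> = k0 + k1 * C0 * (ln r) powr s" using ln1 by (simp add: powr_diff)
    also have "\<dots> \<le> (C0 + 2 + k1 * C0) * (ln r) powr s"
    proof -
      have "1 \<le> ln r powr s" using s ln1 by (intro ge_one_powr_ge_zero) auto
      thus ?thesis by (simp add: k0_def algebra_simps)
    qed
    finally show ?case .
  qed
  thus ?thesis by blast
qed

subsection \<open>Logarithmic order and type\<close>

lemma eventually_lnln_pos: "\<forall>\<^sub>F r::real in at_top. 0 < ln (ln r) \<and> 1 < ln r \<and> 1 \<le> r"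
  by (intro eventually_conj) real_asymp+

lemma ln_ratio_less_iff:
  fixes T r s :: real
  assumes "0 < T" "0 < ln (ln r)" "1 < ln r"
  shows "ln T / ln (ln r) < s \<longleftrightarrow> T < (ln r) powr s"
proof -
  have "ln T / ln (ln r) < s \<longleftrightarrow> ln T < s * ln (ln r)" using assms by (simp add: divide_less_eq)
  also have "\<dots> \<longleftrightarrow> ln T < ln ((ln r) powr s)" using assms by (simp add: ln_powr)
  also have "\<dots> \<longleftrightarrow> T < (ln r) powr s" using assms by (intro ln_less_cancel_iff) auto
  finally show ?thesis .
qed

lemma less_ln_ratio_iff:
  fixes T r s :: real
  assumes "0 < T" "0 < ln (ln r)" "1 < ln r"
  shows "s < ln T / ln (ln r) \<longleftrightarrow> (ln r) powr s < T"
proof -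
  have "s < ln T / ln (ln r) \<longleftrightarrow> s * ln (ln r) < ln T" using assms by (simp add: less_divide_eq)
  also have "\<dots> \<longleftrightarrow> ln ((ln r) powr s) < ln T" using assms by (simp add: ln_powr)
  also have "\<dots> \<longleftrightarrow> (ln r) powr s < T" using assms by (intro ln_less_cancel_iff) auto
  finally show ?thesis .
qed

lemma frequently_of_Liminf_less:
  fixes f :: "real \<Rightarrow> ereal"
  assumes "Liminf at_top f < C"
  shows "\<exists>\<^sub>F r in at_top. f r < C"
proof (rule ccontr)
  assume "\<not> ?thesis"
  hence "\<forall>\<^sub>F r in at_top. C \<le> f r" by (simp add: frequently_def not_less)
  hence "C \<le> Liminf at_top f" by (rule Liminf_bounded)
  thus False using assms by simp
qed

lemma log_order_less_imp:
  assumes g: "g meromorphic_on UNIV" and less: "log_order g < ereal s"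
  shows "\<forall>\<^sub>F r in at_top. nev_T g r \<le> (ln r) powr s"
  using Limsup_lessD[OF less[unfolded log_order_def]] eventually_lnln_pos
proof eventually_elim
  case (elim r)
  show ?case
  \<comment> \<open>At 0 the logarithmic ratio says nothing, because \<open>ln 0 = 0\<close>; there
    the bound is trivial.\<close>
  proof (cases "nev_T g r = 0")
    case False
    hence "0 < nev_T g r" using nev_T_nonneg[OF g, of r] elim by simp
    thus ?thesis using ln_ratio_less_iff[of "nev_T g r" r s] elim by auto
  qed auto
qed

lemma log_lower_order_less_imp:
  assumes g: "g meromorphic_on UNIV" and less: "log_lower_order g < ereal s"
  shows "\<exists>\<^sub>F r in at_top. nev_T g r \<le> (ln r) powr s"
  using frequently_eventually_conj[OF frequently_of_Liminf_less[OF less[unfolded log_lower_order_def]] eventually_lnln_pos]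
proof (rule frequently_elim1)
  fix r assume elim: "(0 < ln (ln r) \<and> 1 < ln r \<and> 1 \<le> r) \<and> ereal (ln (nev_T g r) / ln (ln r)) < ereal s"
  show "nev_T g r \<le> (ln r) powr s"
  proof (cases "nev_T g r = 0")
    case False
    hence "0 < nev_T g r" using nev_T_nonneg[OF g, of r] elim by simp
    thus ?thesis using ln_ratio_less_iff[of "nev_T g r" r s] elim by auto
  qed auto
qed

lemma less_log_lower_order_imp:
  assumes g: "g meromorphic_on UNIV" and less: "ereal s < log_lower_order g" and s: "0 \<le> s"
  shows "\<forall>\<^sub>F r in at_top. (ln r) powr s \<le> nev_T g r"
  using less_LiminfD[OF less[unfolded log_lower_order_def]] eventually_lnln_pos
proof eventually_elim
  case (elim r)
  \<comment> \<open>A vanishing characteristic would give the ratio 0 by \<open>ln 0 = 0\<close>,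
    whereas the ratio exceeds \<open>s \<ge> 0\<close>.\<close>
  have "nev_T g r \<noteq> 0" using elim s by auto
  hence "0 < nev_T g r" using nev_T_nonneg[OF g, of r] elim by simp
  thus ?case using less_ln_ratio_iff[of "nev_T g r" r s] elim by auto
qed

lemma log_type_nonneg:
  assumes g: "g meromorphic_on UNIV"
  shows "0 \<le> log_type g"
proof -
  have "0 \<le> Limsup at_top (\<lambda>r. ereal (nev_T g r / ln r powr p))" for p
    by (rule le_Limsup) (use eventually_lnln_pos in \<open>auto elim!: eventually_mono intro!: divide_nonneg_nonneg nev_T_nonneg[OF g]\<close>)
  thus ?thesis by (simp add: log_type_def split: ereal.split)
qed

lemma log_lower_type_nonneg:
  assumes g: "g meromorphic_on UNIV"
  shows "0 \<le> log_lower_type g"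
proof -
  have "0 \<le> Liminf at_top (\<lambda>r. ereal (nev_T g r / ln r powr p))" for p
    by (rule Liminf_bounded) (use eventually_lnln_pos in \<open>auto elim!: eventually_mono intro!: divide_nonneg_nonneg nev_T_nonneg[OF g]\<close>)
  thus ?thesis by (simp add: log_lower_type_def split: ereal.split)
qed

lemma log_type_less_imp:
  assumes "log_order g = ereal p" "log_type g < ereal t"
  shows "\<forall>\<^sub>F r in at_top. nev_T g r \<le> t * (ln r) powr p"
proof -
  have "Limsup at_top (\<lambda>r. ereal (nev_T g r / ln r powr p)) < ereal t"
    using assms by (simp add: log_type_def)
  from Limsup_lessD[OF this] eventually_lnln_pos show ?thesis
  proof eventually_elim
    case (elim r)
    have "0 < ln r powr p" using elim by (auto simp: powr_gt_zero)
    thus ?case using elim by (simp add: divide_less_eq)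
  qed
qed

lemma log_lower_type_less_imp:
  assumes "log_lower_order g = ereal p" "log_lower_type g < ereal t"
  shows "\<exists>\<^sub>F r in at_top. nev_T g r \<le> t * (ln r) powr p"
proof -
  have "Liminf at_top (\<lambda>r. ereal (nev_T g r / ln r powr p)) < ereal t"
    using assms by (simp add: log_lower_type_def)
  from frequently_eventually_conj[OF frequently_of_Liminf_less[OF this] eventually_lnln_pos] show ?thesis
  proof (rule frequently_elim1)
    fix r assume elim: "(0 < ln (ln r) \<and> 1 < ln r \<and> 1 \<le> r) \<and> ereal (nev_T g r / ln r powr p) < ereal t"
    have "0 < ln r powr p" using elim by (auto simp: powr_gt_zero)
    thus "nev_T g r \<le> t * (ln r) powr p" using elim by (auto simp add: divide_less_eq)
  qed
qed

lemma less_log_lower_type_imp: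
  assumes "log_lower_order g = ereal p" "ereal t < log_lower_type g"
  shows "\<forall>\<^sub>F r in at_top. t * (ln r) powr p \<le> nev_T g r"
proof -
  have "ereal t < Liminf at_top (\<lambda>r. ereal (nev_T g r / ln r powr p))"
    using assms by (simp add: log_lower_type_def)
  from less_LiminfD[OF this] eventually_lnln_pos show ?thesis
  proof eventually_elim
    case (elim r)
    have "0 < ln r powr p" using elim by (auto simp: powr_gt_zero)
    thus ?case using elim by (simp add: less_divide_eq)
  qed
qed

text \<open>A count of 0 yields \<open>ln 0 = 0\<close>, and every other count is at least 1.
  Through the hypothesis on the poles of \<open>A l 0\<close> this forces its lower order above
  1.\<close>

lemma log_exp_conv_poles_nonneg: "0 \<le> log_exp_conv_poles f"
  unfolding log_exp_conv_poles_def
proof (rule le_Limsup)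
  have "0 \<le> ln (real n)" for n by (cases "n = 0") auto
  thus "\<forall>\<^sub>F r in at_top. 0 \<le> ereal (ln (real (nev_n f r)) / ln (ln r))"
    using eventually_lnln_pos by (auto elim!: eventually_mono)
qed simp

text \<open>Each pole weighs at most about \<open>ln r\<close>, which raises the exponent by one;
  hence the summand 1 in the hypothesis on the poles of \<open>A l 0\<close>.\<close>

lemma nev_N_le_of_exp_conv:
  assumes f: "f meromorphic_on UNIV" and less: "log_exp_conv_poles f < ereal s"
  shows "\<exists>C. \<forall>\<^sub>F r in at_top. nev_N f r \<le> C * (ln r) powr (s + 1)"
proof -
  obtain K where K: "K \<ge> 0" "\<And>r. 1 \<le> r \<Longrightarrow> nev_N f r \<le> real (nev_n f r) * (ln r + K)"
    by (rule nev_N_le_n[OF f]) blast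
  have "\<forall>\<^sub>F r in at_top. nev_N f r \<le> (1 + K) * (ln r) powr (s + 1)"
    using Limsup_lessD[OF less[unfolded log_exp_conv_poles_def]] eventually_lnln_pos
  proof eventually_elim
    case (elim r)
    have n: "real (nev_n f r) \<le> (ln r) powr s"
    proof (cases "nev_n f r = 0")
      case False
      thus ?thesis using ln_ratio_less_iff[of "real (nev_n f r)" r s] elim by auto
    qed auto
    have "nev_N f r \<le> real (nev_n f r) * (ln r + K)" using elim by (intro K) auto
    also have "\<dots> \<le> (ln r) powr s * (ln r + K * ln r)"
    proof (intro mult_mono n add_left_mono)
      have "K * 1 \<le> K * ln r" using elim K(1) by (intro mult_left_mono) auto
      thus "K \<le> K * ln r" by simp
    qed (use elim K(1) in auto)
    also have "\<dots> = (1 + K) * (ln r) powr (s + 1)" using elim by (simp add: powr_add algebra_simps)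
    finally show ?case .
  qed
  thus ?thesis by blast
qed

section \<open>Comparison at the critical exponent\<close>

lemma powr_ln_dominates:
  fixes a b c :: real
  assumes "a < b"
  shows "\<forall>\<^sub>F r in at_top. c * (ln r) powr a < (ln r) powr b"
proof -
  have "((\<lambda>r::real. c * ln r powr (a - b)) \<longlongrightarrow> 0) at_top" using assms by real_asymp
  hence "\<forall>\<^sub>F r in at_top. c * ln r powr (a - b) < 1" by (rule order_tendstoD(2)) simp
  with eventually_lnln_pos show ?thesis
  proof eventually_elim
    case (elim r)
    have p: "0 < ln r powr b" using elim by (auto simp: powr_gt_zero)
    have "c * ln r powr (a - b) * ln r powr b < 1 * ln r powr b"
      using elim p by (intro mult_strict_right_mono) auto
    moreover have "r \<noteq> 1" using elim by auto
    ultimately show ?case using elim by (auto simp: powr_diff)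
  qed
qed

text \<open>Bounds from limits superior, and the lower bound for \<open>A\<close>, hold for all
  large \<open>r\<close> and can be combined; the bound for \<open>B\<close> holds only frequently.
  One frequent event can be intersected with eventual ones, but not safely with another frequent
  one, so exactly one function may be measured by its lower growth. If no function attains the
  exponent \<open>\<mu>\<close>, exponents are compared, otherwise the coefficients of
  \<open>(ln r) powr \<mu>\<close>.\<close>

lemma growth_comparison:
  fixes g :: "'k \<Rightarrow> complex \<Rightarrow> complex" and \<mu> s C :: real
  assumes K: "finite K" and g: "\<And>k. k \<in> K \<Longrightarrow> g k meromorphic_on UNIV"
    and A: "A meromorphic_on UNIV" and B: "B meromorphic_on UNIV"
    and mu: "log_lower_order A = ereal \<mu>" and s: "0 \<le> s" "s < \<mu>"
    and gle: "\<And>k. k \<in> K \<Longrightarrow> log_order (g k) \<le> ereal \<mu>" and Ble: "log_lower_order B \<le> ereal \<mu>"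
    and c2: "log_lower_order B = ereal \<mu> \<Longrightarrow> log_lower_type B < log_lower_type A"
    and c3: "\<And>k. k \<in> K \<Longrightarrow> log_order (g k) = ereal \<mu> \<Longrightarrow>
       (\<Sum>k\<in>{k\<in>K. log_order (g k) = ereal \<mu>}. log_type (g k)) < log_lower_type A"
    and c4: "\<And>k. k \<in> K \<Longrightarrow> log_order (g k) = ereal \<mu> \<Longrightarrow> log_lower_order B = ereal \<mu> \<Longrightarrow>
       (\<Sum>k\<in>{k\<in>K. log_order (g k) = ereal \<mu>}. log_type (g k)) + log_lower_type B < log_lower_type A"
    and ineq: "\<forall>\<^sub>F r in at_top. nev_T A r \<le> (\<Sum>k\<in>K. nev_T (g k) r) + nev_T B r + C * (ln r) powr s"
  shows False
proof (cases "(\<exists>k\<in>K. log_order (g k) = ereal \<mu>) \<or> log_lower_order B = ereal \<mu>")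
  case False
  define M where "M = Max (insert (ereal s) (insert (log_lower_order B) ((\<lambda>k. log_order (g k)) ` K)))"
  have "M < ereal \<mu>"
  proof -
    have "log_lower_order B < ereal \<mu>" "\<forall>k\<in>K. log_order (g k) < ereal \<mu>"
      using False gle Ble by (auto simp: less_le)
    thus ?thesis unfolding M_def using K s by simp
  qed
  then obtain \<nu> where \<nu>: "M < ereal \<nu>" "\<nu> < \<mu>" using ereal_dense2[of M "ereal \<mu>"] by auto
  have lt: "s < \<nu>" "log_lower_order B < ereal \<nu>" "\<And>k. k \<in> K \<Longrightarrow> log_order (g k) < ereal \<nu>"
    using \<nu>(1) K by (auto simp: M_def)
  obtain \<nu>' where \<nu>': "\<nu> < \<nu>'" "\<nu>' < \<mu>" using dense[OF \<nu>(2)] by blast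
  have evg: "\<forall>\<^sub>F r in at_top. \<forall>k\<in>K. nev_T (g k) r \<le> (ln r) powr \<nu>"
    using K g lt(3) by (intro eventually_ball_finite ballI log_order_less_imp) auto
  have evA: "\<forall>\<^sub>F r in at_top. (ln r) powr \<nu>' \<le> nev_T A r"
    using \<nu>' lt s mu by (intro less_log_lower_order_imp A) auto
  \<comment> \<open>One multiple of \<open>(ln r) powr \<nu>\<close> for each \<open>g k\<close>,
    one for \<open>B\<close> and one for the error term.\<close>
  have "\<forall>\<^sub>F r in at_top. (real (card K) + 2) * (ln r) powr \<nu> < (ln r) powr \<nu>'"
    by (rule powr_ln_dominates[OF \<nu>'(1)])
  with evg evA ineq powr_ln_dominates[OF lt(1), of C]
  have "\<forall>\<^sub>F r in at_top. \<not> nev_T B r \<le> (ln r) powr \<nu>"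
  proof eventually_elim
    case (elim r)
    have "(\<Sum>k\<in>K. nev_T (g k) r) \<le> real (card K) * (ln r) powr \<nu>"
      using elim(1) by (intro sum_bounded_above) auto
    thus ?case using elim(2-5) by (auto simp: algebra_simps)
  qed
  thus False using log_lower_order_less_imp[OF B lt(2)] by (simp add: frequently_def)
next
  case True
  define W where "W = (\<Sum>k\<in>{k\<in>K. log_order (g k) = ereal \<mu>}. log_type (g k))"
  \<comment> \<open>Counting \<open>B\<close> as 0 when its lower order is below
    \<open>\<mu>\<close> merges the three type conditions \<open>c2\<close>, \<open>c3\<close> and
    \<open>c4\<close> into \<open>W + wB < log_lower_type A\<close>.\<close>
  define wB where "wB = (if log_lower_order B = ereal \<mu> then log_lower_type B else 0)"
  have W0: "0 \<le> W" unfolding W_def using g by (intro sum_nonneg log_type_nonneg) auto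
  have wB0: "0 \<le> wB" unfolding wB_def using log_lower_type_nonneg[OF B] by auto
  have "W + wB < log_lower_type A"
  proof (cases "\<exists>k\<in>K. log_order (g k) = ereal \<mu>")
    case ex: True
    thus ?thesis using c3 c4 by (auto simp: W_def wB_def)
  next
    case False
    hence "{k\<in>K. log_order (g k) = ereal \<mu>} = {}" by auto
    hence "W = 0" unfolding W_def by (simp only: sum.empty)
    thus ?thesis using False True c2 by (auto simp: wB_def)
  qed
  then obtain d where d: "W + wB < ereal d" "ereal d < log_lower_type A" using ereal_dense2 by blast
  have fin: "W < \<infinity>" "wB < \<infinity>" using d(1) W0 wB0 by (auto intro: le_less_trans[OF _ less_trans[OF d(1)]])
  define t where "t = (\<lambda>k. if log_order (g k) = ereal \<mu> then real_of_ereal (log_type (g k)) else 0)"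
  define tB where "tB = real_of_ereal wB"
  have wB: "wB = ereal tB" using fin wB0 unfolding tB_def by (cases wB) auto
  have tk: "log_type (g k) = ereal (t k)" if k: "k \<in> K" "log_order (g k) = ereal \<mu>" for k
  proof -
    have "log_type (g k) \<le> W" unfolding W_def
      using k K g by (subst sum.remove[of _ k]) (auto intro!: add_increasing2 sum_nonneg log_type_nonneg)
    hence "log_type (g k) < \<infinity>" using fin(1) by auto
    moreover have "0 \<le> log_type (g k)" using g k by (intro log_type_nonneg)
    ultimately show ?thesis using k by (cases "log_type (g k)") (auto simp: t_def)
  qed
  have "W = (\<Sum>k\<in>{k\<in>K. log_order (g k) = ereal \<mu>}. ereal (t k))"
    unfolding W_def using tk by (intro sum.cong) auto
  also have "\<dots> = ereal (\<Sum>k\<in>{k\<in>K. log_order (g k) = ereal \<mu>}. t k)" by simp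
  also have "(\<Sum>k\<in>{k\<in>K. log_order (g k) = ereal \<mu>}. t k) = (\<Sum>k\<in>K. t k)"
    using K by (intro sum.mono_neutral_left) (auto simp: t_def)
  finally have W: "W = ereal (\<Sum>k\<in>K. t k)" .
  \<comment> \<open>The gap below \<open>d\<close> is cut into one share for each
    \<open>g k\<close>, one for \<open>B\<close>, one for the error term, and a spare one that makes
    the final inequality strict.\<close>
  define \<epsilon> where "\<epsilon> = (d - (\<Sum>k\<in>K. t k) - tB) / (real (card K) + 3)"
  have dgt: "(\<Sum>k\<in>K. t k) + tB < d" using d(1) W wB by simp
  hence \<epsilon>: "\<epsilon> > 0" unfolding \<epsilon>_def by (intro divide_pos_pos) auto
  have small: "\<forall>\<^sub>F r in at_top. c * (ln r) powr a \<le> \<epsilon> * (ln r) powr \<mu>" if "a < \<mu>" for a c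
    using powr_ln_dominates[OF that, of "c / \<epsilon>"]
    by eventually_elim (use \<epsilon> in \<open>simp add: field_simps\<close>)
  have evg: "\<forall>\<^sub>F r in at_top. \<forall>k\<in>K. nev_T (g k) r \<le> (t k + \<epsilon>) * (ln r) powr \<mu>"
  proof (intro eventually_ball_finite K ballI)
    fix k assume k: "k \<in> K"
    show "\<forall>\<^sub>F r in at_top. nev_T (g k) r \<le> (t k + \<epsilon>) * (ln r) powr \<mu>"
    proof (cases "log_order (g k) = ereal \<mu>")
      case True
      show ?thesis by (rule log_type_less_imp[OF True]) (use tk[OF k True] \<epsilon> in auto)
    next
      case False
      hence "log_order (g k) < ereal \<mu>" using gle[OF k] by auto
      then obtain \<nu> where \<nu>: "log_order (g k) < ereal \<nu>" "\<nu> < \<mu>" using ereal_dense2 by force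
      from log_order_less_imp[OF g[OF k] \<nu>(1)] small[OF \<nu>(2), of 1] show ?thesis
        by eventually_elim (use False in \<open>auto simp: t_def\<close>)
    qed
  qed
  have frB: "\<exists>\<^sub>F r in at_top. nev_T B r \<le> (tB + \<epsilon>) * (ln r) powr \<mu>"
  proof (cases "log_lower_order B = ereal \<mu>")
    case True
    show ?thesis by (rule log_lower_type_less_imp[OF True]) (use True wB \<epsilon> in \<open>auto simp: wB_def\<close>)
  next
    case False
    hence "log_lower_order B < ereal \<mu>" using Ble by auto
    then obtain \<nu> where \<nu>: "log_lower_order B < ereal \<nu>" "\<nu> < \<mu>" using ereal_dense2 by force
    have tB0: "tB = 0" using False by (simp add: tB_def wB_def)
    from frequently_eventually_conj[OF log_lower_order_less_imp[OF B \<nu>(1)] small[OF \<nu>(2), of 1]]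
    show ?thesis by (rule frequently_elim1) (auto simp: tB0)
  qed
  have "\<forall>\<^sub>F r in at_top. d * (ln r) powr \<mu> \<le> nev_T A r"
    by (rule less_log_lower_type_imp[OF mu d(2)])
  with evg small[OF s(2), of C] ineq eventually_lnln_pos
  have "\<forall>\<^sub>F r in at_top. \<not> nev_T B r \<le> (tB + \<epsilon>) * (ln r) powr \<mu>"
  proof eventually_elim
    case (elim r)
    define X where "X = (ln r) powr \<mu>"
    have X: "X > 0" using elim by (auto simp: X_def powr_gt_zero)
    show ?case
    proof
      assume b: "nev_T B r \<le> (tB + \<epsilon>) * (ln r) powr \<mu>"
      have "(\<Sum>k\<in>K. nev_T (g k) r) \<le> (\<Sum>k\<in>K. (t k + \<epsilon>) * X)"
        using elim(1) by (intro sum_mono) (auto simp: X_def)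
      also have "\<dots> = ((\<Sum>k\<in>K. t k) + real (card K) * \<epsilon>) * X"
        by (simp add: sum.distrib distrib_right sum_distrib_right)
      finally have "d * X \<le> ((\<Sum>k\<in>K. t k) + real (card K) * \<epsilon>) * X + (tB + \<epsilon>) * X + \<epsilon> * X"
        using elim(2,3,5) b by (simp add: X_def)
      hence "d * X \<le> ((\<Sum>k\<in>K. t k) + tB + (real (card K) + 2) * \<epsilon>) * X" by (simp add: algebra_simps)
      hence "d \<le> (\<Sum>k\<in>K. t k) + tB + (real (card K) + 2) * \<epsilon>" using X by simp
      also have "\<dots> < (\<Sum>k\<in>K. t k) + tB + (real (card K) + 3) * \<epsilon>" using \<epsilon> by simp
      also have "\<dots> = d" by (simp add: \<epsilon>_def)
      finally show False by simp
    qed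
  qed
  thus False using frB by (simp add: frequently_def)
qed

subsection \<open>Growth of solutions\<close>

lemma nev_m_add:
  assumes "f meromorphic_on UNIV" "g meromorphic_on UNIV" "1 \<le> r"
  shows "nev_m (\<lambda>z. f z + g z) r \<le> nev_m f r + nev_m g r + ln 2"
  using nev_m_sum[of "UNIV :: bool set" "\<lambda>b. if b then f else g" r] assms
  by (simp add: UNIV_bool add_ac)

lemma nev_m_uminus: "nev_m (\<lambda>z. - f z) r = nev_m f r"
  by (simp add: nev_m_def)

text \<open>Only proximity functions are compared, because the counting functions of the quotients
  can be of the order of \<open>T(r, f)\<close> and would destroy the gain in the exponent.\<close>

lemma delay_proximity_bound:
  fixes A :: "nat \<Rightarrow> nat \<Rightarrow> complex \<Rightarrow> complex" and n m l :: nat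
  defines "J \<equiv> {..n} \<times> {..m} - {(l, 0)}"
  assumes A: "\<forall>i\<le>n. \<forall>j\<le>m. A i j meromorphic_on UNIV" and G: "G meromorphic_on UNIV" and l: "l \<le> n"
    and sol: "dde_solution n m c A G f" and nz: "\<not> (\<forall>\<^sub>\<approx>z. f z = 0)" and r: "1 \<le> r"
  shows "nev_m (A l 0) r \<le> nev_m (\<lambda>z. G z * (1 / f (z + c l))) r +
     (\<Sum>(i, j)\<in>J. nev_m (A i j) r + nev_m (\<lambda>z. (deriv ^^ j) f (z + c i) / f (z + c l)) r) + ln (real (card J)) + ln 2"
proof -
  have f: "f meromorphic_on UNIV" using sol by (simp add: dde_solution_def)
  have eq: "\<forall>\<^sub>\<approx>z. (\<Sum>i\<le>n. \<Sum>j\<le>m. A i j z * (deriv ^^ j) f (z + c i)) = G z"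
    using sol by (simp add: dde_solution_def)
  define q where "q = (\<lambda>p z. A (fst p) (snd p) z * ((deriv ^^ snd p) f (z + c (fst p)) / f (z + c l)))"
  have finJ: "finite J" by (simp add: J_def)
  have Am: "A (fst p) (snd p) meromorphic_on UNIV" if "p \<in> J" for p using A that by (auto simp: J_def)
  have rm: "(\<lambda>z. (deriv ^^ j) f (z + c i) / f (z + c l)) meromorphic_on UNIV" for i j
    by (intro meromorphic_intros meromorphic_on_shift f)
  have qm: "q p meromorphic_on UNIV" if "p \<in> J" for p
    unfolding q_def by (intro meromorphic_on_mult Am[OF that] rm)
  have Gm: "(\<lambda>z. G z * (1 / f (z + c l))) meromorphic_on UNIV"
    by (intro meromorphic_intros G meromorphic_on_shift f)
  have Sm: "(\<lambda>z. \<Sum>p\<in>J. q p z) meromorphic_on UNIV" by (intro meromorphic_on_sum qm)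
  have "\<forall>\<^sub>\<approx>z. A l 0 z = G z * (1 / f (z + c l)) + - (\<Sum>p\<in>J. q p z)"
    using eq eventually_cosparse_shift[OF meromorphic_nonzero_cosparse[OF f nz], of "c l"]
  proof eventually_elim
    case (elim z)
    have "G z = (\<Sum>p\<in>{..n} \<times> {..m}. A (fst p) (snd p) z * (deriv ^^ snd p) f (z + c (fst p)))"
      unfolding elim(1)[symmetric] by (subst sum.cartesian_product) (auto simp: case_prod_unfold)
    also have "\<dots> = A l 0 z * f (z + c l) + (\<Sum>p\<in>J. A (fst p) (snd p) z * (deriv ^^ snd p) f (z + c (fst p)))"
      unfolding J_def using l by (subst sum.remove[of _ "(l, 0)"]) auto
    finally have "G z / f (z + c l) = A l 0 z + (\<Sum>p\<in>J. A (fst p) (snd p) z * (deriv ^^ snd p) f (z + c (fst p))) / f (z + c l)"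
      using elim(2) by (simp add: add_divide_distrib)
    thus ?case by (simp add: q_def sum_divide_distrib)
  qed
  hence "nev_m (A l 0) r = nev_m (\<lambda>z. G z * (1 / f (z + c l)) + - (\<Sum>p\<in>J. q p z)) r"
    using r by (rule nev_m_cong)
  also have "\<dots> \<le> nev_m (\<lambda>z. G z * (1 / f (z + c l))) r + nev_m (\<lambda>z. \<Sum>p\<in>J. q p z) r + ln 2"
    using nev_m_add[OF Gm meromorphic_on_uminus[OF Sm] r] by (simp add: nev_m_uminus)
  also have "nev_m (\<lambda>z. \<Sum>p\<in>J. q p z) r \<le> (\<Sum>p\<in>J. nev_m (q p) r) + ln (real (card J))"
    by (rule nev_m_sum[OF finJ qm r])
  also have "(\<Sum>p\<in>J. nev_m (q p) r) \<le> (\<Sum>p\<in>J. nev_m (A (fst p) (snd p)) r + nev_m (\<lambda>z. (deriv ^^ snd p) f (z + c (fst p)) / f (z + c l)) r)"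
    unfolding q_def by (intro sum_mono nev_m_mult Am rm r)
  finally show ?thesis by (simp add: case_prod_unfold)
qed

lemma higher_deriv_zero_cosparse:
  assumes "\<forall>\<^sub>\<approx>z. f z = (0::complex)"
  shows "\<forall>\<^sub>\<approx>z. (deriv ^^ j) f (z + c) = 0"
  using eventually_cosparse_shift[OF eventually_cosparse_nhds[OF assms], of c]
proof eventually_elim
  case (elim z)
  have "(deriv ^^ j) f (z + c) = (deriv ^^ j) (\<lambda>_. 0) (z + c)"
    by (rule higher_deriv_cong_ev[OF elim]) simp
  thus ?case by simp
qed


lemma deriv_ratio_sum_bound:
  assumes f: "f meromorphic_on UNIV" "\<not> (\<forall>\<^sub>\<approx>z. f z = 0)" and s: "1 \<le> s"
    and T: "\<forall>\<^sub>F r in at_top. nev_T f r \<le> (ln r) powr s" and J: "finite J"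
  shows "\<exists>C. \<forall>\<^sub>F r in at_top. (\<Sum>(i, j)\<in>J. nev_m (\<lambda>z. (deriv ^^ j) f (z + c i) / f (z + d)) r) \<le> C * (ln r) powr (s - 1)"
proof -
  have "\<forall>p. \<exists>C. \<forall>\<^sub>F r in at_top. nev_m (\<lambda>z. (deriv ^^ snd p) f (z + c (fst p)) / f (z + d)) r \<le> C * (ln r) powr (s - 1)"
    using nev_m_deriv_ratio_bound[OF f s T] by blast
  then obtain C where C: "\<And>p. \<forall>\<^sub>F r in at_top. nev_m (\<lambda>z. (deriv ^^ snd p) f (z + c (fst p)) / f (z + d)) r \<le> C p * (ln r) powr (s - 1)"
    by metis
  have "\<forall>\<^sub>F r in at_top. \<forall>p\<in>J. nev_m (\<lambda>z. (deriv ^^ snd p) f (z + c (fst p)) / f (z + d)) r \<le> C p * (ln r) powr (s - 1)"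
    by (intro eventually_ball_finite J ballI C)
  hence "\<forall>\<^sub>F r in at_top. (\<Sum>p\<in>J. nev_m (\<lambda>z. (deriv ^^ snd p) f (z + c (fst p)) / f (z + d)) r) \<le> (\<Sum>p\<in>J. C p) * (ln r) powr (s - 1)"
    by eventually_elim (auto simp: sum_distrib_right intro!: sum_mono)
  thus ?thesis by (auto simp: case_prod_unfold)
qed

theorem theorem1p1:
  fixes n m a b l :: nat
    and c :: "nat \<Rightarrow> complex"
    and A :: "nat \<Rightarrow> nat \<Rightarrow> complex \<Rightarrow> complex"
    and F :: "complex \<Rightarrow> complex"
  defines "I \<equiv> ({..n} \<times> {..m}) - {(l, 0), (a, b)}"
  defines "rhoS \<equiv> Max (insert (log_order F) ((\<lambda>(i, j). log_order (A i j)) ` I))"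
  defines "sumT \<equiv> (\<Sum>(i, j)\<in>{(i, j) \<in> I. log_order (A i j) = log_lower_order (A l 0)}.
                      log_type (A i j))"
  assumes c_inj: "inj_on c {..n}"
    and c_nz: "\<forall>i\<le>n. c i \<noteq> 0"
    and A_mero: "\<forall>i\<le>n. \<forall>j\<le>m. A i j meromorphic_on UNIV"
    and F_mero: "F meromorphic_on UNIV"
    and a_le: "a \<le> n" and l_le: "l \<le> n" and b_le: "b \<le> m"
    and ab_ne: "(a, b) \<noteq> (l, 0)"
    and lam: "log_exp_conv_poles (A l 0) + 1 < log_lower_order (A l 0)"
    and mu_fin: "log_lower_order (A l 0) < \<infinity>"
    and h1: "max (log_lower_order (A a b)) rhoS \<le> log_lower_order (A l 0)"
    and h2: "log_lower_order (A l 0) = log_lower_order (A a b) \<Longrightarrow>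
               log_lower_type (A l 0) > log_lower_type (A a b)"
    and h3: "log_lower_order (A l 0) = rhoS \<Longrightarrow>
               sumT + log_type F < log_lower_type (A l 0) \<and> log_lower_type (A l 0) < \<infinity>"
    and h4: "log_lower_order (A l 0) = log_lower_order (A a b) \<and> log_lower_order (A a b) = rhoS \<Longrightarrow>
               sumT + log_type F + log_lower_type (A a b) < log_lower_type (A l 0) \<and>
               log_lower_type (A l 0) < \<infinity>"
  shows "(\<not> (\<forall>\<^sub>\<approx>z. F z = 0) \<longrightarrow>
            (\<forall>f. dde_solution n m c A F f \<longrightarrow> log_order f \<ge> log_lower_order (A l 0)))
       \<and> ((\<forall>\<^sub>\<approx>z. F z = 0) \<longrightarrow>
            (\<forall>f. dde_solution n m c A (\<lambda>_. 0) f \<and> \<not> (\<forall>\<^sub>\<approx>z. f z = 0) \<longrightarrow>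
                 log_order f \<ge> log_lower_order (A l 0) + 1))"
proof -
  have lam0: "0 \<le> log_exp_conv_poles (A l 0)" by (rule log_exp_conv_poles_nonneg)
  have one: "(0::ereal) \<le> 1" by simp
  have "0 < log_lower_order (A l 0)"
    by (rule le_less_trans[OF add_nonneg_nonneg[OF lam0 one] lam])
  then obtain \<mu> where mu: "log_lower_order (A l 0) = ereal \<mu>"
    using mu_fin by (cases "log_lower_order (A l 0)") auto
  \<comment> \<open>\<open>y\<close> is the exponent for the poles of \<open>A l 0\<close>. It
    exceeds 1, since the exponent of convergence is non-negative, and so does
    \<open>\<mu>\<close>.\<close>
  obtain y where y: "log_exp_conv_poles (A l 0) + 1 < ereal y" "y < \<mu>"
    using ereal_dense2[OF lam] unfolding mu by auto
  have y1: "log_exp_conv_poles (A l 0) < ereal (y - 1)"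
    using y(1) lam0 by (cases "log_exp_conv_poles (A l 0)") auto
  hence "0 < ereal (y - 1)" using lam0 by (rule le_less_trans[rotated])
  hence mu1: "1 < y" "1 < \<mu>" using y(2) by (auto simp: zero_ereal_def)
  have Al: "A l 0 meromorphic_on UNIV" and Aab: "A a b meromorphic_on UNIV" using A_mero a_le l_le b_le by auto
  have AI: "A i j meromorphic_on UNIV" if "(i, j) \<in> I" for i j using that A_mero by (auto simp: I_def)
  have finI: "finite I" by (simp add: I_def)
  obtain CN where CN: "\<forall>\<^sub>F r in at_top. nev_N (A l 0) r \<le> CN * (ln r) powr y"
    using nev_N_le_of_exp_conv[OF Al y1] by auto

  \<comment> \<open>Indices in \<open>option\<close> list \<open>F\<close> and the coefficients as a
    family, with \<open>None\<close> standing for \<open>F\<close>. Functions that happen to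
    coincide are thus counted separately, as in \<open>sumT + log_type F\<close>.\<close>
  define K where "K = insert None (Some ` I)"
  define g where "g = (\<lambda>k. case k of None \<Rightarrow> F | Some (i, j) \<Rightarrow> A i j)"
  have finK: "finite K" using finI by (simp add: K_def)
  have sumK: "(\<Sum>k\<in>K. h (g k)) = h F + (\<Sum>(i, j)\<in>I. h (A i j))" for h :: "(complex \<Rightarrow> complex) \<Rightarrow> real"
    using finI by (simp add: K_def g_def sum.reindex case_prod_unfold)
  have gm: "g k meromorphic_on UNIV" if "k \<in> K" for k
    using that AI F_mero by (auto simp: K_def g_def)
  have rhoS: "rhoS = Max ((\<lambda>k. log_order (g k)) ` K)"
    unfolding rhoS_def K_def by (simp add: image_image g_def case_prod_unfold)
  have gle: "log_order (g k) \<le> ereal \<mu>" if "k \<in> K" for k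
  proof -
    have "log_order (g k) \<le> rhoS" unfolding rhoS using finK that by (intro Max_ge finite_imageI imageI)
    also have "\<dots> \<le> ereal \<mu>" using h1 mu by simp
    finally show ?thesis .
  qed
  have rhoS_eq: "log_lower_order (A l 0) = rhoS" if "k \<in> K" "log_order (g k) = ereal \<mu>" for k
  proof -
    have "log_order (g k) \<le> rhoS" unfolding rhoS using finK that(1) by (intro Max_ge finite_imageI imageI)
    thus ?thesis using h1 mu that by (auto intro: antisym)
  qed
  \<comment> \<open>Only an inequality: the right side contains \<open>log_type F\<close> even when
    the order of \<open>F\<close> stays below \<open>\<mu>\<close>.\<close>
  have W: "(\<Sum>k\<in>{k\<in>K. log_order (g k) = ereal \<mu>}. log_type (g k)) \<le> sumT + log_type F"
  proof -
    have "{k\<in>K. log_order (g k) = ereal \<mu>} = (if log_order F = ereal \<mu> then {None} else {}) \<union>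
       Some ` {p \<in> I. log_order (A (fst p) (snd p)) = ereal \<mu>}" (is "_ = ?X \<union> ?Y")
      by (auto simp: K_def g_def case_prod_unfold)
    hence "(\<Sum>k\<in>{k\<in>K. log_order (g k) = ereal \<mu>}. log_type (g k)) = (\<Sum>k\<in>?X. log_type (g k)) + (\<Sum>k\<in>?Y. log_type (g k))"
      using finI by (simp only:) (intro sum.union_disjoint, auto)
    also have "(\<Sum>k\<in>?Y. log_type (g k)) = sumT"
      unfolding sumT_def mu by (subst sum.reindex) (auto simp: g_def case_prod_unfold intro!: sum.cong)
    also have "(\<Sum>k\<in>?X. log_type (g k)) \<le> log_type F"
      using log_type_nonneg[OF F_mero] by (auto simp: g_def)
    finally show ?thesis by (simp add: add.commute add_right_mono)
  qed

  \<comment> \<open>Both claims are instances. The number \<open>\<sigma>\<close> bounds the order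
    of \<open>f\<close>, and \<open>s1\<close> is the error exponent of the term with
    \<open>1 / f\<close>: for non-zero \<open>F\<close> one takes \<open>\<sigma> < \<mu>\<close>
    and \<open>s1 = \<sigma>\<close>, for zero \<open>F\<close> only
    \<open>\<sigma> < \<mu> + 1\<close>, with \<open>s1 = 0\<close>.\<close>
  have main: False
    if f: "f meromorphic_on UNIV" "\<not> (\<forall>\<^sub>\<approx>z. f z = 0)" and G: "G meromorphic_on UNIV"
      and sol: "dde_solution n m c A G f"
      and \<sigma>: "1 < \<sigma>" "\<sigma> - 1 < \<mu>" and of: "log_order f < ereal \<sigma>" and s1: "s1 < \<mu>"
      and Gb: "\<exists>C. \<forall>\<^sub>F r in at_top. nev_m (\<lambda>z. G z * (1 / f (z + c l))) r \<le> nev_T F r + C * (ln r) powr s1"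
    for f G \<sigma> s1
  proof -
    define J where "J = {..n} \<times> {..m} - {(l, 0)}"
    have J: "finite J" "J = insert (a, b) I" "(a, b) \<notin> I"
      using ab_ne a_le b_le by (auto simp: J_def I_def)
    have T: "\<forall>\<^sub>F r in at_top. nev_T f r \<le> (ln r) powr \<sigma>" by (rule log_order_less_imp[OF f(1) of])
    obtain C1 where C1: "\<forall>\<^sub>F r in at_top. (\<Sum>(i, j)\<in>J. nev_m (\<lambda>z. (deriv ^^ j) f (z + c i) / f (z + c l)) r) \<le> C1 * (ln r) powr (\<sigma> - 1)"
      using deriv_ratio_sum_bound[OF f _ T J(1)] \<sigma> by force
    obtain C2 where C2: "\<forall>\<^sub>F r in at_top. nev_m (\<lambda>z. G z * (1 / f (z + c l))) r \<le> nev_T F r + C2 * (ln r) powr s1"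
      using Gb by blast
    \<comment> \<open>The three error exponents: quotients of values of \<open>f\<close>, the term
      with \<open>1 / f\<close>, and the poles of \<open>A l 0\<close>. All lie below
      \<open>\<mu>\<close>.\<close>
    define s where "s = max (max (\<sigma> - 1) s1) y"
    have s: "0 \<le> s" "s < \<mu>" using \<sigma> s1 y mu1 by (auto simp: s_def)
    define k0 where "k0 = ln (real (card J)) + ln 2"
    define C where "C = \<bar>C1\<bar> + \<bar>C2\<bar> + \<bar>CN\<bar> + \<bar>k0\<bar>"
    have ineq: "\<forall>\<^sub>F r in at_top. nev_T (A l 0) r \<le> (\<Sum>k\<in>K. nev_T (g k) r) + nev_T (A a b) r + C * (ln r) powr s"
      using C1 C2 CN eventually_lnln_pos
    proof eventually_elim
      case (elim r)
      have r: "1 \<le> r" "1 < ln r" using elim(4) by auto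
      have pw: "q * (ln r) powr e \<le> \<bar>q\<bar> * (ln r) powr s" if "e \<le> s" for q e
      proof -
        have "q * (ln r) powr e \<le> \<bar>q\<bar> * (ln r) powr e" by (intro mult_right_mono) auto
        also have "\<dots> \<le> \<bar>q\<bar> * (ln r) powr s" using that r by (intro mult_left_mono powr_mono) auto
        finally show ?thesis .
      qed
      have k0: "k0 \<le> \<bar>k0\<bar> * (ln r) powr s" using pw[of 0 k0] s r by (simp split: if_splits)
      have "(\<Sum>(i, j)\<in>J. nev_m (A i j) r) \<le> (\<Sum>(i, j)\<in>J. nev_T (A i j) r)"
        using r(1) A_mero by (intro sum_mono) (auto simp: J_def intro!: nev_m_le_T)
      also have "\<dots> = nev_T (A a b) r + (\<Sum>(i, j)\<in>I. nev_T (A i j) r)"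
        using finI J(3) unfolding J(2) by simp
      finally have mA: "(\<Sum>(i, j)\<in>J. nev_m (A i j) r) \<le> nev_T (A a b) r + (\<Sum>(i, j)\<in>I. nev_T (A i j) r)" .
      have "nev_m (A l 0) r \<le> nev_m (\<lambda>z. G z * (1 / f (z + c l))) r +
         (\<Sum>(i, j)\<in>J. nev_m (A i j) r + nev_m (\<lambda>z. (deriv ^^ j) f (z + c i) / f (z + c l)) r) + k0"
        using delay_proximity_bound[OF A_mero G l_le sol f(2) r(1)] unfolding J_def k0_def by simp
      also have "(\<Sum>(i, j)\<in>J. nev_m (A i j) r + nev_m (\<lambda>z. (deriv ^^ j) f (z + c i) / f (z + c l)) r)
        = (\<Sum>(i, j)\<in>J. nev_m (A i j) r) + (\<Sum>(i, j)\<in>J. nev_m (\<lambda>z. (deriv ^^ j) f (z + c i) / f (z + c l)) r)"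
        by (simp add: case_prod_unfold sum.distrib)
      finally have "nev_T (A l 0) r \<le> nev_T F r + (\<Sum>(i, j)\<in>I. nev_T (A i j) r) + nev_T (A a b) r +
         (C2 * (ln r) powr s1 + C1 * (ln r) powr (\<sigma> - 1) + CN * (ln r) powr y + k0)"
        using mA elim(1-3) by (simp add: nev_T_def)
      also have "C2 * (ln r) powr s1 + C1 * (ln r) powr (\<sigma> - 1) + CN * (ln r) powr y + k0 \<le>
          \<bar>C2\<bar> * (ln r) powr s + \<bar>C1\<bar> * (ln r) powr s + \<bar>CN\<bar> * (ln r) powr s + \<bar>k0\<bar> * (ln r) powr s"
        by (intro add_mono pw k0) (auto simp: s_def)
      also have "\<dots> = C * (ln r) powr s" by (simp add: C_def algebra_simps)
      finally show ?case using sumK[of "\<lambda>h. nev_T h r"] by simp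
    qed
    show False
    proof (rule growth_comparison[of K g "A l 0" "A a b" \<mu> s C])
      show "finite K" using finI by (simp add: K_def)
      show "log_lower_order (A a b) \<le> ereal \<mu>" using h1 mu by simp
      show "log_lower_type (A a b) < log_lower_type (A l 0)" if "log_lower_order (A a b) = ereal \<mu>"
        using h2 that mu by simp
      show "(\<Sum>k\<in>{k\<in>K. log_order (g k) = ereal \<mu>}. log_type (g k)) < log_lower_type (A l 0)"
        if "k \<in> K" "log_order (g k) = ereal \<mu>" for k
        using h3[OF rhoS_eq[OF that]] W by (auto intro: le_less_trans)
      show "(\<Sum>k\<in>{k\<in>K. log_order (g k) = ereal \<mu>}. log_type (g k)) + log_lower_type (A a b) < log_lower_type (A l 0)"
        if "k \<in> K" "log_order (g k) = ereal \<mu>" "log_lower_order (A a b) = ereal \<mu>" for k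
      proof -
        have "sumT + log_type F + log_lower_type (A a b) < log_lower_type (A l 0)"
          using h4 rhoS_eq[OF that(1,2)] that(3) mu by auto
        thus ?thesis using add_right_mono[OF W] by (rule le_less_trans[rotated])
      qed
    qed (use gm gle Al Aab mu s ineq in auto)
  qed

  show ?thesis
  proof (intro conjI impI allI)
    fix f assume F: "\<not> (\<forall>\<^sub>\<approx>z. F z = 0)" and sol: "dde_solution n m c A F f"
    have f: "f meromorphic_on UNIV" using sol by (simp add: dde_solution_def)
    \<comment> \<open>The inhomogeneous claim does not presuppose a non-zero solution; a vanishing
      \<open>f\<close> would make the left side of the equation, and hence \<open>F\<close>,
      vanish.\<close>
    have nz: "\<not> (\<forall>\<^sub>\<approx>z. f z = 0)"
    proof
      assume 0: "\<forall>\<^sub>\<approx>z. f z = 0"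
      have "\<forall>\<^sub>\<approx>z. \<forall>p\<in>{..n} \<times> {..m}. (deriv ^^ snd p) f (z + c (fst p)) = 0"
        by (intro eventually_ball_finite ballI higher_deriv_zero_cosparse 0) auto
      moreover have "\<forall>\<^sub>\<approx>z. (\<Sum>i\<le>n. \<Sum>j\<le>m. A i j z * (deriv ^^ j) f (z + c i)) = F z"
        using sol by (simp add: dde_solution_def)
      ultimately have "\<forall>\<^sub>\<approx>z. F z = 0"
        by eventually_elim auto
      thus False using F by simp
    qed
    show "log_lower_order (A l 0) \<le> log_order f"
    proof (rule ccontr)
      assume "\<not> ?thesis"
      \<comment> \<open>The maximum with 1 secures \<open>\<sigma> > 1\<close>, since the count of
        zeros and poles is bounded only for exponents \<open>s \<ge> 1\<close>. There is room for it
        because \<open>\<mu> > 1\<close>.\<close>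
      hence "max (log_order f) 1 < ereal \<mu>" using mu mu1 by (auto simp: one_ereal_def)
      from ereal_dense2[OF this] obtain \<sigma> where \<sigma>: "max (log_order f) 1 < ereal \<sigma>" "\<sigma> < \<mu>" by auto
      hence \<sigma>1: "1 < \<sigma>" "log_order f < ereal \<sigma>" by (auto simp: one_ereal_def)
      have T: "\<forall>\<^sub>F r in at_top. nev_T f r \<le> (ln r) powr \<sigma>" by (rule log_order_less_imp[OF f \<sigma>1(2)])
      obtain C where C: "\<forall>\<^sub>F r in at_top. nev_m (\<lambda>z. 1 / f (z + c l)) r \<le> C * (ln r) powr \<sigma>"
        using nev_m_inverse_shift_bound[OF f nz _ T] \<sigma>1 by force
      have "\<forall>\<^sub>F r in at_top. nev_m (\<lambda>z. F z * (1 / f (z + c l))) r \<le> nev_T F r + C * (ln r) powr \<sigma>"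
        using C eventually_ge_at_top[of 1]
      proof eventually_elim
        case (elim r)
        have im: "(\<lambda>z. 1 / f (z + c l)) meromorphic_on UNIV" by (intro meromorphic_intros meromorphic_on_shift f)
        show ?case using nev_m_mult[OF F_mero im elim(2)] nev_m_le_T[OF F_mero elim(2)] elim(1) by linarith
      qed
      with \<sigma>(2) show False by (intro main[OF f nz F_mero sol \<sigma>1(1) _ \<sigma>1(2) \<sigma>(2)] exI) simp_all
    qed
  next
    fix f assume "\<forall>\<^sub>\<approx>z. F z = 0" and "dde_solution n m c A (\<lambda>_. 0) f \<and> \<not> (\<forall>\<^sub>\<approx>z. f z = 0)"
    hence sol: "dde_solution n m c A (\<lambda>_. 0) f" and nz: "\<not> (\<forall>\<^sub>\<approx>z. f z = 0)" by auto
    have f: "f meromorphic_on UNIV" using sol by (simp add: dde_solution_def)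
    show "log_lower_order (A l 0) + 1 \<le> log_order f"
    proof (rule ccontr)
      assume "\<not> ?thesis"
      \<comment> \<open>The threshold is \<open>\<mu> + 1\<close> here: only quotients occur, and
        they cost the exponent \<open>\<sigma> - 1 < \<mu>\<close>.\<close>
      hence "max (log_order f) 1 < ereal (\<mu> + 1)" using mu mu1 by (auto simp: one_ereal_def)
      from ereal_dense2[OF this] obtain \<sigma> where \<sigma>: "max (log_order f) 1 < ereal \<sigma>" "\<sigma> < \<mu> + 1" by auto
      hence \<sigma>1: "1 < \<sigma>" "log_order f < ereal \<sigma>" by (auto simp: one_ereal_def)
      have "\<forall>\<^sub>F r in at_top. nev_m (\<lambda>z. (\<lambda>_. 0) z * (1 / f (z + c l))) r \<le> nev_T F r + 0 * (ln r) powr 0"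
        using eventually_ge_at_top[of 1]
        by eventually_elim (use nev_T_nonneg[OF F_mero] in \<open>simp add: nev_m_def\<close>)
      hence "\<exists>C. \<forall>\<^sub>F r in at_top. nev_m (\<lambda>z. (\<lambda>_. 0) z * (1 / f (z + c l))) r \<le> nev_T F r + C * (ln r) powr 0"
        by blast
      with \<sigma>(2) mu1 show False
        by (intro main[OF f nz meromorphic_on_const sol \<sigma>1(1) _ \<sigma>1(2), of 0]) simp_all
    qed
  qed
qed

end
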